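(* Let $n,m\ge 2$ be integers and $q\in\mathbb{C}$ with $|q|=1$. The Fock representation $\pi_F^q$ of $\mathcal E_{n,m}^q$ is faithful.
   Context: For $q\in\mathbb{C}$, $|q|=1$, $\mathcal{E}_{n,m}^q$ denotes the universal unital $C^*$-algebra generated by elements $s_1,\dots,s_n,t_1,\dots,t_m$ subject to the relations $s_i^*s_j=\delta_{ij}\mathbf 1$, $t_r^*t_l=\delta_{rl}\mathbf 1$, $s_j^*t_r=q\,t_rs_j^*$ for all $i,j\in\{1,\dots,n\}$, $r,l\in\{1,\dots,m\}$. The Fock representation of $\mathcal E_{n,m}^q$ is the unique (up to unitary equivalence) irreducible $*$-representation $\pi_F^q$ possessing a unit vector $\Omega$ (the vacuum vector) with $\pi_F^q(s_j^* )\Omega=0$ and $\pi_F^q(t_r^* )\Omega=0$ for all $j=1,\dots,n$, $r=1,\dots,m$. *)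

theory Defs
  imports "HOL-Analysis.Analysis" "HOL-Algebra.Module"
begin

section \<open>Unital C*-algebras\<close>

definition complex_ring :: "complex ring" where
  "complex_ring = \<lparr>carrier = UNIV, monoid.mult = (*), one = 1, ring.zero = 0, add = (+)\<rparr>"

lemma cring_complex_ring: "cring complex_ring"
proof (rule cringI)
  show "abelian_group complex_ring"
    by (rule abelian_groupI)
      (auto simp: complex_ring_def intro: exI[of _ "- x" for x] add.left_inverse)
  show "Group.comm_monoid complex_ring"
    by (rule comm_monoidI) (auto simp: complex_ring_def)
qed (auto simp: complex_ring_def algebra_simps)

record 'a cstar = "(complex, 'a) module" +
  adj :: "'a \<Rightarrow> 'a"
  nrm :: "'a \<Rightarrow> real"

text \<open>
  The zero algebra is admitted. Noncommutative algebras over a ring are not in the library (its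
  locale \<^locale>\<open>algebra\<close> is for commutative ones), hence the combination of
  \<^locale>\<open>Module.module\<close> and \<^locale>\<open>Ring.ring\<close> with the two compatibility axioms.
\<close>

locale unital_cstar_algebra = Module.module complex_ring A + Ring.ring A
  for A :: "'a cstar" (structure) +
  assumes smult_mult_left:
      "\<lbrakk>x \<in> carrier A; y \<in> carrier A\<rbrakk> \<Longrightarrow> (c \<odot> x) \<otimes> y = c \<odot> (x \<otimes> y)"
    and smult_mult_right:
      "\<lbrakk>x \<in> carrier A; y \<in> carrier A\<rbrakk> \<Longrightarrow> x \<otimes> (c \<odot> y) = c \<odot> (x \<otimes> y)"
    and adj_closed: "x \<in> carrier A \<Longrightarrow> adj A x \<in> carrier A"
    and adj_adj: "x \<in> carrier A \<Longrightarrow> adj A (adj A x) = x"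
    and adj_add:
      "\<lbrakk>x \<in> carrier A; y \<in> carrier A\<rbrakk> \<Longrightarrow> adj A (x \<oplus> y) = adj A x \<oplus> adj A y"
    and adj_mult:
      "\<lbrakk>x \<in> carrier A; y \<in> carrier A\<rbrakk> \<Longrightarrow> adj A (x \<otimes> y) = adj A y \<otimes> adj A x"
    and adj_smult: "x \<in> carrier A \<Longrightarrow> adj A (c \<odot> x) = cnj c \<odot> adj A x"
    and nrm_nonneg: "x \<in> carrier A \<Longrightarrow> 0 \<le> nrm A x"
    and nrm_eq_zero: "x \<in> carrier A \<Longrightarrow> nrm A x = 0 \<longleftrightarrow> x = \<zero>"
    and nrm_triangle:
      "\<lbrakk>x \<in> carrier A; y \<in> carrier A\<rbrakk> \<Longrightarrow> nrm A (x \<oplus> y) \<le> nrm A x + nrm A y"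
    and nrm_smult: "x \<in> carrier A \<Longrightarrow> nrm A (c \<odot> x) = cmod c * nrm A x"
    and nrm_mult:
      "\<lbrakk>x \<in> carrier A; y \<in> carrier A\<rbrakk> \<Longrightarrow> nrm A (x \<otimes> y) \<le> nrm A x * nrm A y"
    and cstar_identity: "x \<in> carrier A \<Longrightarrow> nrm A (adj A x \<otimes> x) = (nrm A x)\<^sup>2"
    and complete:
      "\<lbrakk>\<And>k. X k \<in> carrier A;
        \<And>e. 0 < e \<Longrightarrow> \<exists>N. \<forall>k\<ge>N. \<forall>l\<ge>N. nrm A (X k \<ominus> X l) < e\<rbrakk>
       \<Longrightarrow> \<exists>x\<in>carrier A. (\<lambda>k. nrm A (X k \<ominus> x)) \<longlonglongrightarrow> 0"

definition unital_star_hom :: "'a cstar \<Rightarrow> 'b cstar \<Rightarrow> ('a \<Rightarrow> 'b) \<Rightarrow> bool" where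
  "unital_star_hom A B \<phi> \<longleftrightarrow>
     \<phi> \<in> ring_hom A B \<and>
     (\<forall>c. \<forall>x\<in>carrier A. \<phi> (c \<odot>\<^bsub>A\<^esub> x) = c \<odot>\<^bsub>B\<^esub> \<phi> x) \<and>
     (\<forall>x\<in>carrier A. \<phi> (adj A x) = adj B (\<phi> x))"

definition closed_unital_star_subalgebra :: "'a set \<Rightarrow> 'a cstar \<Rightarrow> bool" where
  "closed_unital_star_subalgebra S A \<longleftrightarrow>
     S \<subseteq> carrier A \<and> \<one>\<^bsub>A\<^esub> \<in> S \<and>
     (\<forall>x\<in>S. \<forall>y\<in>S. x \<oplus>\<^bsub>A\<^esub> y \<in> S \<and> x \<otimes>\<^bsub>A\<^esub> y \<in> S) \<and>
     (\<forall>c. \<forall>x\<in>S. c \<odot>\<^bsub>A\<^esub> x \<in> S) \<and>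
     (\<forall>x\<in>S. adj A x \<in> S) \<and>
     (\<forall>x\<in>carrier A. (\<forall>e>0. \<exists>y\<in>S. nrm A (x \<ominus>\<^bsub>A\<^esub> y) < e) \<longrightarrow> x \<in> S)"

definition generates_cstar :: "'a set \<Rightarrow> 'a cstar \<Rightarrow> bool" where
  "generates_cstar G A \<longleftrightarrow>
     G \<subseteq> carrier A \<and> (\<forall>S. closed_unital_star_subalgebra S A \<and> G \<subseteq> S \<longrightarrow> S = carrier A)"


section \<open>The algebra of the relations\<close>

definition E_relations ::
    "nat \<Rightarrow> nat \<Rightarrow> complex \<Rightarrow> 'a cstar \<Rightarrow> (nat \<Rightarrow> 'a) \<Rightarrow> (nat \<Rightarrow> 'a) \<Rightarrow> bool" where
  "E_relations n m q A s t \<longleftrightarrow>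
     s ` {1..n} \<subseteq> carrier A \<and> t ` {1..m} \<subseteq> carrier A \<and>
     (\<forall>i\<in>{1..n}. \<forall>j\<in>{1..n}. adj A (s i) \<otimes>\<^bsub>A\<^esub> s j = (if i = j then \<one>\<^bsub>A\<^esub> else \<zero>\<^bsub>A\<^esub>)) \<and>
     (\<forall>r\<in>{1..m}. \<forall>l\<in>{1..m}. adj A (t r) \<otimes>\<^bsub>A\<^esub> t l = (if r = l then \<one>\<^bsub>A\<^esub> else \<zero>\<^bsub>A\<^esub>)) \<and>
     (\<forall>j\<in>{1..n}. \<forall>r\<in>{1..m}.
        adj A (s j) \<otimes>\<^bsub>A\<^esub> t r = q \<odot>\<^bsub>A\<^esub> (t r \<otimes>\<^bsub>A\<^esub> adj A (s j)))"

text \<open>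
  \<open>A\<close> together with \<open>s\<close>, \<open>t\<close> is the universal unital C*-algebra on the relations. Uniqueness of
  \<open>\<phi>\<close> on \<open>carrier A\<close> is implied by generation.

  HOL cannot quantify over types inside a formula, so the test algebras \<open>B\<close> have carriers in the
  type of \<open>A\<close>. This loses nothing if \<open>A\<close> is nonzero: then \<open>'a\<close> has at least continuum many elements,
  and any C*-algebra generated by finitely many elements, having at most that many, has an
  isomorphic copy with carrier in \<open>'a\<close>; an arbitrary target may be replaced by the subalgebra
  generated by the images. The zero algebra has no unital representation on a nonzero space.
\<close>

definition universal_E ::
    "nat \<Rightarrow> nat \<Rightarrow> complex \<Rightarrow> 'a cstar \<Rightarrow> (nat \<Rightarrow> 'a) \<Rightarrow> (nat \<Rightarrow> 'a) \<Rightarrow> bool" where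
  "universal_E n m q A s t \<longleftrightarrow>
     unital_cstar_algebra A \<and>
     E_relations n m q A s t \<and>
     generates_cstar (s ` {1..n} \<union> t ` {1..m}) A \<and>
     (\<forall>(B :: 'a cstar) s' t'. unital_cstar_algebra B \<and> E_relations n m q B s' t' \<longrightarrow>
        (\<exists>\<phi>. unital_star_hom A B \<phi> \<and>
             (\<forall>i\<in>{1..n}. \<phi> (s i) = s' i) \<and> (\<forall>r\<in>{1..m}. \<phi> (t r) = t' r)))"


section \<open>Representations on complex Hilbert spaces\<close>

text \<open>The inner product is linear in its second argument.\<close>

class complex_hilbert_space = banach +
  fixes scaleC :: "complex \<Rightarrow> 'a \<Rightarrow> 'a" (infixr \<open>*\<^sub>C\<close> 75)
    and cinner :: "'a \<Rightarrow> 'a \<Rightarrow> complex"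
  assumes scaleC_of_real: "complex_of_real r *\<^sub>C x = r *\<^sub>R x"
    and scaleC_add_right: "a *\<^sub>C (x + y) = a *\<^sub>C x + a *\<^sub>C y"
    and scaleC_add_left: "(a + b) *\<^sub>C x = a *\<^sub>C x + b *\<^sub>C x"
    and scaleC_scaleC: "a *\<^sub>C b *\<^sub>C x = (a * b) *\<^sub>C x"
    and cinner_commute: "cinner x y = cnj (cinner y x)"
    and cinner_add_right: "cinner x (y + z) = cinner x y + cinner x z"
    and cinner_scaleC_right: "cinner x (a *\<^sub>C y) = a * cinner x y"
    and cinner_self: "cinner x x = complex_of_real ((norm x)\<^sup>2)"

definition bounded_clinear :: "('h::complex_hilbert_space \<Rightarrow> 'h) \<Rightarrow> bool" where
  "bounded_clinear T \<longleftrightarrow> bounded_linear T \<and> (\<forall>c x. T (c *\<^sub>C x) = c *\<^sub>C T x)"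

definition star_representation ::
    "'a cstar \<Rightarrow> ('a \<Rightarrow> 'h::complex_hilbert_space \<Rightarrow> 'h) \<Rightarrow> bool" where
  "star_representation A \<pi> \<longleftrightarrow>
     (\<forall>a\<in>carrier A. bounded_clinear (\<pi> a)) \<and>
     \<pi> \<one>\<^bsub>A\<^esub> = id \<and>
     (\<forall>a\<in>carrier A. \<forall>b\<in>carrier A.
        \<pi> (a \<oplus>\<^bsub>A\<^esub> b) = (\<lambda>x. \<pi> a x + \<pi> b x) \<and> \<pi> (a \<otimes>\<^bsub>A\<^esub> b) = \<pi> a \<circ> \<pi> b) \<and>
     (\<forall>c. \<forall>a\<in>carrier A. \<pi> (c \<odot>\<^bsub>A\<^esub> a) = (\<lambda>x. c *\<^sub>C \<pi> a x)) \<and>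
     (\<forall>a\<in>carrier A. \<forall>x y. cinner (\<pi> (adj A a) x) y = cinner x (\<pi> a y))"

definition irreducible_representation ::
    "'a cstar \<Rightarrow> ('a \<Rightarrow> 'h::complex_hilbert_space \<Rightarrow> 'h) \<Rightarrow> bool" where
  "irreducible_representation A \<pi> \<longleftrightarrow>
     star_representation A \<pi> \<and> (\<exists>x::'h. x \<noteq> 0) \<and>
     (\<forall>V. subspace V \<and> (\<forall>c. \<forall>x\<in>V. c *\<^sub>C x \<in> V) \<and> closed V \<and>
          (\<forall>a\<in>carrier A. \<forall>x\<in>V. \<pi> a x \<in> V) \<longrightarrow> V = {0} \<or> V = UNIV)"

definition fock_representation ::
    "nat \<Rightarrow> nat \<Rightarrow> 'a cstar \<Rightarrow> (nat \<Rightarrow> 'a) \<Rightarrow> (nat \<Rightarrow> 'a) \<Rightarrow>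
     ('a \<Rightarrow> 'h::complex_hilbert_space \<Rightarrow> 'h) \<Rightarrow> bool" where
  "fock_representation n m A s t \<pi> \<longleftrightarrow>
     irreducible_representation A \<pi> \<and>
     (\<exists>\<Omega>. norm \<Omega> = 1 \<and>
          (\<forall>j\<in>{1..n}. \<pi> (adj A (s j)) \<Omega> = 0) \<and> (\<forall>r\<in>{1..m}. \<pi> (adj A (t r)) \<Omega> = 0))"

definition faithful_representation ::
    "'a cstar \<Rightarrow> ('a \<Rightarrow> 'h::complex_hilbert_space \<Rightarrow> 'h) \<Rightarrow> bool" where
  "faithful_representation A \<pi> \<longleftrightarrow> inj_on \<pi> (carrier A)"

end

theory Submission
  imports Defs
begin

text \<open>
  Write \<open>P\<close> and \<open>P'\<close> for the projections \<open>\<Sum>s\<^sub>i s\<^sub>i\<^sup>*\<close> and \<open>\<Sum>t\<^sub>r t\<^sub>r\<^sup>*\<close>, and \<open>Q = (1 - P)(1 - P')\<close>. The vacuum vector is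
  fixed by \<open>\<pi>(Q)\<close>, so \<open>Q \<noteq> 0\<close>. The words in the generators followed by the adjoints of words span a
  dense subspace, and \<open>Q\<close> kills every such product from one side unless both words are empty; hence
  \<open>Q y Q\<close> is a scalar multiple of \<open>Q\<close> for all \<open>y\<close>. If \<open>\<pi>(a) = 0\<close>, evaluating at the vacuum shows that
  this scalar vanishes for \<open>y = x a x'\<close>. So it has to be shown that \<open>a = 0\<close> as soon as all the elements
  \<open>Q x a x' Q\<close> vanish: an element of the algebra is determined by its matrix with respect to the
  ``Fock basis'' \<open>x\<^sub>w Q\<close>, where \<open>x\<^sub>w = s\<^sub>\<mu> t\<^sub>\<nu>\<close> for a pair \<open>w = (\<mu>, \<nu>)\<close> of words
  (\<open>zero_of_vacuum_compressions\<close>).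

  This is a norm estimate, obtained from a Poisson transform carried out inside the algebra. As
  \<open>n \<ge> 2\<close>, there are isometries \<open>f\<^sub>w\<close> with mutually orthogonal ranges, one for each \<open>w\<close>. They serve as
  labels that turn columns of elements into single elements: \<open>V = \<Sum> f\<^sub>w Q x\<^sub>w\<^sup>*\<close>, summed over all pairs of
  words shorter than \<open>N\<close>, is a partial isometry, and \<open>V y V\<^sup>*\<close> is the truncated Fock matrix of \<open>y\<close>
  with entries in \<open>\<complex> Q\<close>. For a word polynomial \<open>p\<close> the truncated shifts give a scalar matrix \<open>z\<close>, that
  is, a combination of the \<open>f\<^sub>v f\<^sub>w\<^sup>*\<close>, with \<open>V p V\<^sup>* = z G\<close> for \<open>G = V V\<^sup>*\<close>. Two facts are combined.

  \<^item> Multiplication by \<open>G\<close> replaces each entry \<open>\<lambda> 1\<close> by \<open>\<lambda> Q\<close>. It is an injective *-homomorphism on a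
    finite-dimensional algebra, so \<open>\<parallel>z\<parallel> \<le> \<parallel>z G\<parallel>\<close> (\<open>nrm_scalar_matrix_le\<close>). Comparing coefficients
    gives this up to a constant, and the constant disappears on iterating the C*-identity; no spectral
    theory is used.

  \<^item> With \<open>c = \<Sum> f\<^sub>w \<rho>\<^bsup>|w|\<^esup> D x\<^sub>w\<^sup>*\<close>, where \<open>D\<^sup>2 = (1 - \<rho>\<^sup>2 P)(1 - \<rho>\<^sup>2 P')\<close>, the sums telescope to
    \<open>c\<^sup>* z c = p\<close> up to an error that vanishes as \<open>N \<rightarrow> \<infinity>\<close> and then \<open>\<rho> \<rightarrow> 1\<close>, and \<open>\<parallel>c\<parallel> \<le> 1\<close>
    (\<open>poisson_transform_word\<close>, \<open>nrm_poisson\<close>).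

  If \<open>V a V\<^sup>* = 0\<close> and \<open>p\<close> is close to \<open>a\<close>, then, up to a small error,
  \<open>\<parallel>p\<parallel> \<approx> \<parallel>c\<^sup>* z c\<parallel> \<le> \<parallel>z\<parallel> \<le> \<parallel>z G\<parallel> = \<parallel>V (p - a) V\<^sup>*\<parallel> \<le> \<parallel>p - a\<parallel>\<close>, so \<open>p\<close> and with it \<open>a\<close> have
  arbitrarily small norm.
\<close>

section \<open>Norm estimates in a C*-algebra\<close>

context unital_cstar_algebra
begin

lemma complex_ring_simps [simp]:
  "carrier complex_ring = UNIV" "\<one>\<^bsub>complex_ring\<^esub> = 1" "\<zero>\<^bsub>complex_ring\<^esub> = 0"
  "a \<otimes>\<^bsub>complex_ring\<^esub> b = a * b" "a \<oplus>\<^bsub>complex_ring\<^esub> b = a + b"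
  by (simp_all add: complex_ring_def)

lemma scal_closed [simp, intro]: "x \<in> carrier A \<Longrightarrow> c \<odot> x \<in> carrier A"
  using smult_closed[of c x] by simp

lemma scal_one [simp]: "x \<in> carrier A \<Longrightarrow> 1 \<odot> x = x"
  using smult_one[of x] by simp

lemma scal_zero [simp]: "x \<in> carrier A \<Longrightarrow> 0 \<odot> x = \<zero>"
  using smult_l_null[of x] by simp

lemma scal_null [simp]: "c \<odot> \<zero> = \<zero>"
  using smult_r_null[of c] by simp

lemma scal_add: "x \<in> carrier A \<Longrightarrow> (a + b) \<odot> x = a \<odot> x \<oplus> b \<odot> x"
  using smult_l_distr[of a b x] by simp

lemma scal_add_right: "x \<in> carrier A \<Longrightarrow> y \<in> carrier A \<Longrightarrow> a \<odot> (x \<oplus> y) = a \<odot> x \<oplus> a \<odot> y"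
  using smult_r_distr[of a x y] by simp

lemma scal_scal [simp]: "x \<in> carrier A \<Longrightarrow> a \<odot> (b \<odot> x) = (a * b) \<odot> x"
  using smult_assoc1[of a b x] by simp

lemma uminus_eq_scal: "x \<in> carrier A \<Longrightarrow> \<ominus> x = (-1) \<odot> x"
proof -
  assume x: "x \<in> carrier A"
  have "(-1) \<odot> x \<oplus> x = ((-1) + 1) \<odot> x" using x by (simp only: scal_add scal_one)
  then show ?thesis using x by (simp add: minus_equality)
qed

lemma scal_minus_left: "x \<in> carrier A \<Longrightarrow> (- a) \<odot> x = \<ominus> (a \<odot> x)"
  by (simp add: uminus_eq_scal)

lemma scal_diff: "x \<in> carrier A \<Longrightarrow> (a - b) \<odot> x = a \<odot> x \<ominus> b \<odot> x"
  using scal_add[of x a "-b"] by (simp add: scal_minus_left minus_eq)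

lemma scal_minus_right:
  "x \<in> carrier A \<Longrightarrow> y \<in> carrier A \<Longrightarrow> a \<odot> (x \<ominus> y) = a \<odot> x \<ominus> a \<odot> y"
  by (simp add: minus_eq scal_add_right uminus_eq_scal)

lemmas [simp] = smult_mult_left smult_mult_right adj_closed adj_adj

lemma adj_one [simp]: "adj A \<one> = \<one>"
proof -
  have "adj A \<one> = adj A (adj A \<one> \<otimes> \<one>)"
    by (subst adj_mult) auto
  then show ?thesis by simp
qed

lemma adj_zero [simp]: "adj A \<zero> = \<zero>"
  using adj_smult[of \<zero> 0] by simp

lemma adj_minus: "x \<in> carrier A \<Longrightarrow> adj A (\<ominus> x) = \<ominus> adj A x"
  by (simp add: uminus_eq_scal adj_smult)

lemma adj_diff: "x \<in> carrier A \<Longrightarrow> y \<in> carrier A \<Longrightarrow> adj A (x \<ominus> y) = adj A x \<ominus> adj A y"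
  by (simp add: minus_eq adj_add adj_minus)

lemma mult_diff_left: 
  "x \<in> carrier A \<Longrightarrow> y \<in> carrier A \<Longrightarrow> z \<in> carrier A \<Longrightarrow> (x \<ominus> y) \<otimes> z = x \<otimes> z \<ominus> y \<otimes> z"
  by (simp add: minus_eq l_distr l_minus)

lemma mult_diff_right: 
  "x \<in> carrier A \<Longrightarrow> y \<in> carrier A \<Longrightarrow> z \<in> carrier A \<Longrightarrow> z \<otimes> (x \<ominus> y) = z \<otimes> x \<ominus> z \<otimes> y"
  by (simp add: minus_eq r_distr r_minus)

lemma minus_self [simp]: "x \<in> carrier A \<Longrightarrow> x \<ominus> x = \<zero>"
  by (simp add: minus_eq r_neg)

lemma eq_of_minus_zero: "x \<in> carrier A \<Longrightarrow> y \<in> carrier A \<Longrightarrow> x \<ominus> y = \<zero> \<Longrightarrow> x = y"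
  using minus_equality[of x "\<ominus> y"] by (simp add: minus_eq)

lemma minus_minus_cancel:
  "h \<in> carrier A \<Longrightarrow> x \<in> carrier A \<Longrightarrow> y \<in> carrier A \<Longrightarrow> (h \<ominus> y) \<ominus> (h \<ominus> x) = x \<ominus> y"
  by algebra

lemma minus_trans:
  "x \<in> carrier A \<Longrightarrow> y \<in> carrier A \<Longrightarrow> z \<in> carrier A \<Longrightarrow> (x \<ominus> y) \<oplus> (y \<ominus> z) = x \<ominus> z"
  by algebra

lemma nrm_zero [simp]: "nrm A \<zero> = 0"
  using nrm_eq_zero[of \<zero>] by simp

lemma nrm_adj [simp]: assumes x: "x \<in> carrier A" shows "nrm A (adj A x) = nrm A x"
proof -
  have le: "nrm A y \<le> nrm A (adj A y)" if y: "y \<in> carrier A" for y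
  proof (cases "nrm A y = 0")
    case False
    have "(nrm A y)\<^sup>2 \<le> nrm A (adj A y) * nrm A y"
      using cstar_identity[OF y] nrm_mult[of "adj A y" y] y by simp
    then show ?thesis using False nrm_nonneg[OF y] by (simp add: power2_eq_square)
  qed (use y nrm_nonneg in simp)
  show ?thesis using le[OF x] le[of "adj A x"] x by simp
qed

lemma nrm_minus [simp]: "x \<in> carrier A \<Longrightarrow> nrm A (\<ominus> x) = nrm A x"
  by (simp add: uminus_eq_scal nrm_smult)

lemma nrm_diff_triangle:
  "x \<in> carrier A \<Longrightarrow> y \<in> carrier A \<Longrightarrow> nrm A (x \<ominus> y) \<le> nrm A x + nrm A y"
  using nrm_triangle[of x "\<ominus> y"] by (simp add: minus_eq)

lemma nrm_diff_commute:
  "x \<in> carrier A \<Longrightarrow> y \<in> carrier A \<Longrightarrow> nrm A (x \<ominus> y) = nrm A (y \<ominus> x)"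
proof -
  assume "x \<in> carrier A" "y \<in> carrier A"
  then have "x \<ominus> y = \<ominus> (y \<ominus> x)" by algebra
  with \<open>x \<in> carrier A\<close> \<open>y \<in> carrier A\<close> show ?thesis by simp
qed

lemma nrm_le_add_diff:
  assumes "x \<in> carrier A" "y \<in> carrier A" shows "nrm A x \<le> nrm A y + nrm A (x \<ominus> y)"
proof -
  have "x = y \<oplus> (x \<ominus> y)" using assms by algebra
  then show ?thesis using nrm_triangle[of y "x \<ominus> y"] assms by simp
qed

lemma nrm_mult3:
  assumes "x \<in> carrier A" "y \<in> carrier A" "z \<in> carrier A"
  shows "nrm A (x \<otimes> y \<otimes> z) \<le> nrm A x * nrm A y * nrm A z"
  using nrm_mult[of "x \<otimes> y" z] mult_right_mono[OF nrm_mult[of x y], of "nrm A z"] nrm_nonneg assms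
  by fastforce

lemma nrm_finsum:
  assumes "finite S" "f \<in> S \<rightarrow> carrier A"
  shows "nrm A (\<Oplus>i\<in>S. f i) \<le> (\<Sum>i\<in>S. nrm A (f i))"
  using assms
proof (induction S rule: finite_induct)
  case (insert i S)
  have "nrm A (f i \<oplus> (\<Oplus>j\<in>S. f j)) \<le> nrm A (f i) + nrm A (\<Oplus>j\<in>S. f j)"
    using insert by (intro nrm_triangle finsum_closed) auto
  also have "\<dots> \<le> nrm A (f i) + (\<Sum>j\<in>S. nrm A (f j))" using insert by auto
  finally show ?case using insert by (simp add: finsum_insert Pi_def)
qed simp

lemma adj_finsum:
  assumes "finite S" "f \<in> S \<rightarrow> carrier A"
  shows "adj A (\<Oplus>i\<in>S. f i) = (\<Oplus>i\<in>S. adj A (f i))"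
  using assms
proof (induction S rule: finite_induct)
  case (insert i S)
  have "(\<Oplus>j\<in>S. f j) \<in> carrier A" using insert by (auto intro: finsum_closed)
  then show ?case using insert by (simp add: finsum_insert Pi_def adj_add)
qed simp

definition projection :: "'a \<Rightarrow> bool" where
  "projection p \<longleftrightarrow> p \<in> carrier A \<and> adj A p = p \<and> p \<otimes> p = p"

lemma projectionD:
  assumes "projection p" shows "p \<in> carrier A" "adj A p = p" "p \<otimes> p = p"
  using assms by (auto simp: projection_def)

lemma projection_one: "projection \<one>"
  by (simp add: projection_def)

lemma projection_complement: "projection p \<Longrightarrow> projection (\<one> \<ominus> p)"
  by (auto simp: projection_def adj_diff mult_diff_left mult_diff_right) (algebra)

lemma projection_mult:
  assumes "projection p" "projection p'" "p \<otimes> p' = p' \<otimes> p" shows "projection (p \<otimes> p')"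
proof -
  note [simp] = projectionD[OF assms(1)] projectionD[OF assms(2)]
  have "p \<otimes> p' \<otimes> (p \<otimes> p') = p \<otimes> (p' \<otimes> p) \<otimes> p'" by (simp add: m_assoc)
  also have "\<dots> = p \<otimes> (p \<otimes> p') \<otimes> p'" by (simp add: assms(3))
  also have "\<dots> = (p \<otimes> p) \<otimes> (p' \<otimes> p')"
    by (simp only: m_assoc m_closed projectionD(1)[OF assms(1)] projectionD(1)[OF assms(2)])
  finally show ?thesis by (simp add: projection_def adj_mult assms(3))
qed

lemma nrm_projection:
  assumes "projection p" shows "nrm A p = 0 \<or> nrm A p = 1"
  using cstar_identity[of p] projectionD[OF assms] by (auto simp: power2_eq_square)

lemma nrm_projection_le: "projection p \<Longrightarrow> nrm A p \<le> 1"
  using nrm_projection by fastforce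

lemma nrm_one_le: "nrm A \<one> \<le> 1"
  by (rule nrm_projection_le[OF projection_one])

lemma nrm_le_one_of_adj_mult_projection:
  assumes "x \<in> carrier A" "projection (adj A x \<otimes> x)" shows "nrm A x \<le> 1"
  using cstar_identity[OF assms(1)] nrm_projection_le[OF assms(2)] nrm_nonneg[OF assms(1)]
  by (simp add: power_le_one_iff abs_square_le_1)

text \<open>
  The element is the convex combination of \<open>1\<close> and the projection \<open>1 - p\<close>.
\<close>

lemma nrm_one_minus_scal_projection:
  assumes p: "projection p" and "0 \<le> \<rho>" "\<rho> \<le> 1"
  shows "nrm A (\<one> \<ominus> complex_of_real \<rho> \<odot> p) \<le> 1"
proof -
  note [simp] = projectionD[OF p]
  have "\<one> = complex_of_real (1 - \<rho>) \<odot> \<one> \<oplus> complex_of_real \<rho> \<odot> \<one>"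
    using scal_add[of \<one> "complex_of_real (1 - \<rho>)" "complex_of_real \<rho>"] by simp
  then have "\<one> \<ominus> complex_of_real \<rho> \<odot> p
     = complex_of_real (1 - \<rho>) \<odot> \<one> \<oplus> complex_of_real \<rho> \<odot> \<one> \<ominus> complex_of_real \<rho> \<odot> p"
    by simp
  also have "\<dots> = complex_of_real (1 - \<rho>) \<odot> \<one> \<oplus> complex_of_real \<rho> \<odot> (\<one> \<ominus> p)"
    by (simp add: minus_eq scal_add_right uminus_eq_scal a_assoc)
  also have "nrm A \<dots> \<le> nrm A (complex_of_real (1 - \<rho>) \<odot> \<one>) + nrm A (complex_of_real \<rho> \<odot> (\<one> \<ominus> p))"
    by (rule nrm_triangle) auto
  also have "\<dots> = (1 - \<rho>) * nrm A \<one> + \<rho> * nrm A (\<one> \<ominus> p)"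
    using assms by (simp add: nrm_smult del: of_real_diff)
  also have "\<dots> \<le> (1 - \<rho>) * 1 + \<rho> * 1"
    using assms nrm_one_le nrm_projection_le[OF projection_complement[OF p]]
    by (intro add_mono mult_left_mono) auto
  finally show ?thesis by simp
qed

text \<open>
  This plays the role that the spectral radius has in the proof that *-homomorphisms are contractive.
  The C*-identity squares both norms under \<open>y \<mapsto> y\<^sup>*y\<close>, so \<open>k\<close> steps give \<open>\<parallel>z\<parallel>\<^bsup>2^k\<^esup> \<le> C \<parallel>y\<parallel>\<^bsup>2^k\<^esup>\<close>;
  letting \<open>k\<close> grow removes the constant. The relation \<open>R\<close> may be any pairing that is stable under this
  step, in particular the graph of a *-homomorphism.
\<close>

lemma power_bound_comparison:
  assumes cl: "\<And>y z. R y z \<Longrightarrow> y \<in> carrier A \<and> z \<in> carrier A \<and> R (adj A y \<otimes> y) (adj A z \<otimes> z)"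
    and bd: "\<And>y z. R y z \<Longrightarrow> nrm A z \<le> C * nrm A y"
    and R: "R y z"
  shows "nrm A z \<le> nrm A y"
proof (rule ccontr)
  assume "\<not> ?thesis"
  then have lt: "nrm A y < nrm A z" by simp
  have y0: "0 \<le> nrm A y" using cl[OF R] nrm_nonneg by blast
  have iter: "nrm A z ^ (2 ^ k) \<le> C * nrm A y ^ (2 ^ k)" if "R y z" for y z k
    using that
  proof (induction k arbitrary: y z)
    case 0 then show ?case using bd by simp
  next
    case (Suc k)
    note c = cl[OF Suc.prems]
    show ?case using Suc.IH[of "adj A y \<otimes> y" "adj A z \<otimes> z"] c cstar_identity
      by (simp add: power_mult[symmetric] mult.commute)
  qed
  have pos: "0 < nrm A y"
  proof (rule ccontr)
    assume "\<not> ?thesis" 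
    then have "nrm A y = 0" using y0 by simp
    then show False using bd[OF R] lt by simp
  qed
  \<comment> \<open>The powers of this ratio are unbounded, yet all its \<open>2^k\<close>-th powers are at most \<open>C\<close>.\<close>
  define \<rho> where "\<rho> = nrm A z / nrm A y"
  have "1 < \<rho>" using lt pos by (simp add: \<rho>_def)
  then obtain N where N: "C < \<rho> ^ N" using real_arch_pow by blast
  have "\<rho> ^ N \<le> \<rho> ^ (2 ^ N)"
    using \<open>1 < \<rho>\<close> by (intro power_increasing) (auto simp: less_imp_le)
  moreover have "\<rho> ^ (2 ^ N) \<le> C"
    using iter[OF R, of N] pos by (simp add: \<rho>_def power_divide field_simps)
  ultimately show False using N by simp
qed

definition orthonormal :: "'i set \<Rightarrow> ('i \<Rightarrow> 'a) \<Rightarrow> bool" where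
  "orthonormal J g \<longleftrightarrow> g \<in> J \<rightarrow> carrier A \<and>
     (\<forall>i\<in>J. \<forall>j\<in>J. adj A (g i) \<otimes> g j = (if i = j then \<one> else \<zero>))"

lemma finsum_restrict:
  assumes "finite S" "T \<subseteq> S" "f \<in> T \<rightarrow> carrier A" "\<And>i. i \<in> S - T \<Longrightarrow> f i = \<zero>"
  shows "(\<Oplus>i\<in>S. f i) = (\<Oplus>i\<in>T. f i)"
proof -
  have "f i \<in> carrier A" if "i \<in> S" for i
    using assms(3,4) that by (cases "i \<in> T") auto
  then show ?thesis using assms add.finprod_mono_neutral_cong_right[of S T f f] by auto
qed

lemma finsum_delta:
  assumes "finite S" "i \<in> S \<Longrightarrow> a \<in> carrier A"
  shows "(\<Oplus>j\<in>S. if i = j then a else \<zero>) = (if i \<in> S then a else \<zero>)"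
proof (cases "i \<in> S")
  case True
  have "(\<Oplus>j\<in>S. if i = j then a else \<zero>) = (\<Oplus>j\<in>{i}. if i = j then a else \<zero>)"
    using True assms by (intro finsum_restrict) auto
  then show ?thesis using True assms by (simp add: finsum_insert)
next
  case False
  have "(\<Oplus>j\<in>S. if i = j then a else \<zero>) = (\<Oplus>j\<in>S. \<zero>)"
    using False by (intro finsum_cong') auto
  then show ?thesis using False by (simp add: finsum_zero)
qed

lemma orthonormal_mult_sum:
  assumes "orthonormal J g" "finite S" "S \<subseteq> J" "i \<in> J" "a \<in> S \<rightarrow> carrier A"
  shows "adj A (g i) \<otimes> (\<Oplus>j\<in>S. g j \<otimes> a j) = (if i \<in> S then a i else \<zero>)"
proof -
  have g: "\<And>j. j \<in> J \<Longrightarrow> g j \<in> carrier A" using assms by (auto simp: orthonormal_def)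
  have a: "\<And>j. j \<in> S \<Longrightarrow> a j \<in> carrier A" using assms by auto
  have "adj A (g i) \<otimes> (\<Oplus>j\<in>S. g j \<otimes> a j) = (\<Oplus>j\<in>S. adj A (g i) \<otimes> (g j \<otimes> a j))"
    using assms g a by (intro finsum_rdistr) auto
  also have "\<dots> = (\<Oplus>j\<in>S. if i = j then a i else \<zero>)"
  proof (rule finsum_cong')
    fix j assume j: "j \<in> S"
    have "adj A (g i) \<otimes> (g j \<otimes> a j) = (adj A (g i) \<otimes> g j) \<otimes> a j"
      using assms g a j by (subst m_assoc) auto
    then show "adj A (g i) \<otimes> (g j \<otimes> a j) = (if i = j then a i else \<zero>)"
      using assms a j by (auto simp: orthonormal_def subset_iff)
  qed (use a in auto)
  finally show ?thesis using assms a by (simp add: finsum_delta)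
qed

text \<open>
  An orthonormal family codes a finite column \<open>(a\<^sub>i)\<close> by the single element \<open>\<Sum> g\<^sub>i a\<^sub>i\<close>; the lemma is the
  product of a row with a column in this coding. The \<open>C\<^sup>*\<close>-norm of the code is then the norm of the
  column in the Hilbert module.
\<close>

lemma orthonormal_sum_mult_sum:
  assumes "orthonormal J g" "finite S" "S \<subseteq> J" "finite T" "T \<subseteq> J"
    and "b \<in> T \<rightarrow> carrier A" "a \<in> S \<rightarrow> carrier A"
  shows "(\<Oplus>i\<in>T. b i \<otimes> adj A (g i)) \<otimes> (\<Oplus>j\<in>S. g j \<otimes> a j) = (\<Oplus>i\<in>T \<inter> S. b i \<otimes> a i)"
proof -
  have g: "\<And>j. j \<in> J \<Longrightarrow> g j \<in> carrier A" using assms by (auto simp: orthonormal_def)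
  have a: "\<And>j. j \<in> S \<Longrightarrow> a j \<in> carrier A" "\<And>j. j \<in> T \<Longrightarrow> b j \<in> carrier A" using assms by auto
  have G: "(\<Oplus>j\<in>S. g j \<otimes> a j) \<in> carrier A" using g a assms by (intro finsum_closed) auto
  have "(\<Oplus>i\<in>T. b i \<otimes> adj A (g i)) \<otimes> (\<Oplus>j\<in>S. g j \<otimes> a j)
      = (\<Oplus>i\<in>T. b i \<otimes> adj A (g i) \<otimes> (\<Oplus>j\<in>S. g j \<otimes> a j))"
    using assms g a G by (intro finsum_ldistr) auto
  also have "\<dots> = (\<Oplus>i\<in>T. if i \<in> S then b i \<otimes> a i else \<zero>)"
  proof (rule finsum_cong')
    fix i assume i: "i \<in> T"
    have "b i \<otimes> adj A (g i) \<otimes> (\<Oplus>j\<in>S. g j \<otimes> a j) = b i \<otimes> (adj A (g i) \<otimes> (\<Oplus>j\<in>S. g j \<otimes> a j))"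
      using i assms g a G by (intro m_assoc) auto
    then show "b i \<otimes> adj A (g i) \<otimes> (\<Oplus>j\<in>S. g j \<otimes> a j) = (if i \<in> S then b i \<otimes> a i else \<zero>)"
      using orthonormal_mult_sum[OF assms(1,2,3) _ assms(7), of i] i assms a by auto
  qed (use a in auto)
  also have "\<dots> = (\<Oplus>i\<in>T \<inter> S. if i \<in> S then b i \<otimes> a i else \<zero>)"
    using assms a by (intro finsum_restrict) auto
  also have "\<dots> = (\<Oplus>i\<in>T \<inter> S. b i \<otimes> a i)"
    using a by (intro finsum_cong') auto
  finally show ?thesis .
qed

lemma finsum_product:
  assumes "finite I" "finite J" "\<And>i j. i \<in> I \<Longrightarrow> j \<in> J \<Longrightarrow> f i j \<in> carrier A"
  shows "(\<Oplus>w\<in>I \<times> J. f (fst w) (snd w)) = (\<Oplus>i\<in>I. \<Oplus>j\<in>J. f i j)"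
  using assms(1,3)
proof (induction I rule: finite_induct)
  case empty then show ?case by simp
next
  case (insert i I)
  have "(\<Oplus>w\<in>insert i I \<times> J. f (fst w) (snd w)) 
      = (\<Oplus>w\<in>Pair i ` J \<union> I \<times> J. f (fst w) (snd w))"
    by (rule arg_cong[where f="finsum A _"]) auto
  also have "\<dots> = (\<Oplus>w\<in>Pair i ` J. f (fst w) (snd w)) \<oplus> (\<Oplus>w\<in>I \<times> J. f (fst w) (snd w))"
    using insert assms(2) by (intro finsum_Un_disjoint) auto
  also have "(\<Oplus>w\<in>Pair i ` J. f (fst w) (snd w)) = (\<Oplus>j\<in>J. f i j)"
    using insert by (subst finsum_reindex) (auto simp: inj_on_def)
  also have "(\<Oplus>w\<in>I \<times> J. f (fst w) (snd w)) = (\<Oplus>i\<in>I. \<Oplus>j\<in>J. f i j)"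
    using insert by blast
  finally show ?case using insert assms(2) by (subst finsum_insert) (auto intro!: finsum_closed)
qed

end

section \<open>Dense subalgebras and words in an orthonormal family\<close>

context unital_cstar_algebra
begin

text \<open>
  The closure of a *-subalgebra is again a *-subalgebra, by continuity of the operations.
\<close>

lemma dense_of_generates:
  assumes gen: "generates_cstar G A" and G: "G \<subseteq> B" and B: "B \<subseteq> carrier A" "\<one> \<in> B"
    and add: "\<And>x y. x \<in> B \<Longrightarrow> y \<in> B \<Longrightarrow> x \<oplus> y \<in> B"
    and mult: "\<And>x y. x \<in> B \<Longrightarrow> y \<in> B \<Longrightarrow> x \<otimes> y \<in> B"
    and scal: "\<And>c x. x \<in> B \<Longrightarrow> c \<odot> x \<in> B"
    and adj: "\<And>x. x \<in> B \<Longrightarrow> adj A x \<in> B"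
    and x: "x \<in> carrier A" and e: "0 < e"
  shows "\<exists>y\<in>B. nrm A (x \<ominus> y) < e"
proof -
  define S where "S = {x \<in> carrier A. \<forall>e>0. \<exists>y\<in>B. nrm A (x \<ominus> y) < e}"
  have BS: "B \<subseteq> S"
  proof
    fix b assume b: "b \<in> B"
    then have bc: "b \<in> carrier A" using B by auto
    then have "b \<ominus> b = \<zero>" by (simp add: minus_eq r_neg)
    then have "\<forall>e>0. \<exists>y\<in>B. nrm A (b \<ominus> y) < e" using b by (metis nrm_zero)
    with bc show "b \<in> S" by (simp add: S_def)
  qed
  have Sc: "S \<subseteq> carrier A" by (auto simp: S_def)
  have S_add: "x \<oplus> y \<in> S" if xy: "x \<in> S" "y \<in> S" for x y
  proof -
    have c: "x \<in> carrier A" "y \<in> carrier A" using xy Sc by auto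
    have "\<exists>z\<in>B. nrm A (x \<oplus> y \<ominus> z) < e" if "e > 0" for e
    proof -
      have "e / 2 > 0" using that by simp
      then obtain x' y' where b: "x' \<in> B" "y' \<in> B" "nrm A (x \<ominus> x') < e/2" "nrm A (y \<ominus> y') < e/2"
        using xy unfolding S_def by blast
      have bc: "x' \<in> carrier A" "y' \<in> carrier A" using b B by auto
      have "x \<oplus> y \<ominus> (x' \<oplus> y') = (x \<ominus> x') \<oplus> (y \<ominus> y')" using c bc by algebra
      then have "nrm A (x \<oplus> y \<ominus> (x' \<oplus> y')) < e"
        using nrm_triangle[of "x \<ominus> x'" "y \<ominus> y'"] b c bc by simp
      then show ?thesis using add b by blast
    qed
    then show ?thesis using c by (simp add: S_def)
  qed
  have S_mult: "x \<otimes> y \<in> S" if xy: "x \<in> S" "y \<in> S" for x y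
  proof -
    have c: "x \<in> carrier A" "y \<in> carrier A" using xy Sc by auto
    have "\<exists>z\<in>B. nrm A (x \<otimes> y \<ominus> z) < e" if e: "e > 0" for e
    proof -
      have "0 < e / (2 * (nrm A y + 1))"
        using e nrm_nonneg[OF c(2)] by (intro divide_pos_pos) auto
      then obtain x' where x': "x' \<in> B" "nrm A (x \<ominus> x') < e / (2 * (nrm A y + 1))"
        using xy unfolding S_def by blast
      have x'c: "x' \<in> carrier A" using x' B by auto
      have "0 < e / (2 * (nrm A x' + 1))"
        using e nrm_nonneg[OF x'c] by (intro divide_pos_pos) auto
      then obtain y' where y': "y' \<in> B" "nrm A (y \<ominus> y') < e / (2 * (nrm A x' + 1))"
        using xy unfolding S_def by blast
      have y'c: "y' \<in> carrier A" using y' B by auto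
      have "x \<otimes> y \<ominus> x' \<otimes> y' = (x \<ominus> x') \<otimes> y \<oplus> x' \<otimes> (y \<ominus> y')"
        using c x'c y'c by algebra
      then have "nrm A (x \<otimes> y \<ominus> x' \<otimes> y') \<le> nrm A ((x \<ominus> x') \<otimes> y) + nrm A (x' \<otimes> (y \<ominus> y'))"
        using c x'c y'c by (simp add: nrm_triangle)
      also have "\<dots> \<le> nrm A (x \<ominus> x') * nrm A y + nrm A x' * nrm A (y \<ominus> y')"
        using c x'c y'c by (intro add_mono nrm_mult) auto
      also have "\<dots> \<le> nrm A (x \<ominus> x') * (nrm A y + 1) + (nrm A x' + 1) * nrm A (y \<ominus> y')"
        using c x'c y'c nrm_nonneg by (intro add_mono mult_mono) auto
      also have "\<dots> < e / 2 + e / 2"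
        using x'(2) y'(2) nrm_nonneg[OF c(2)] nrm_nonneg[OF x'c]
        by (intro add_strict_mono) (simp_all add: field_simps)
      finally show ?thesis using mult x' y' by (intro bexI[of _ "x' \<otimes> y'"]) auto
    qed
    then show ?thesis using c by (simp add: S_def)
  qed
  have S_scal: "c \<odot> x \<in> S" if xS: "x \<in> S" for c x
  proof -
    have xc: "x \<in> carrier A" using xS Sc by auto
    have "\<exists>z\<in>B. nrm A (c \<odot> x \<ominus> z) < e" if e: "e > 0" for e
    proof -
      have "0 < e / (cmod c + 1)"
        using e by (intro divide_pos_pos) (auto simp: add_nonneg_pos)
      then obtain x' where x': "x' \<in> B" "nrm A (x \<ominus> x') < e / (cmod c + 1)"
        using xS unfolding S_def by blast
      have x'c: "x' \<in> carrier A" using x' B by auto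
      have "c \<odot> x \<ominus> c \<odot> x' = c \<odot> (x \<ominus> x')"
        using xc x'c by (simp add: minus_eq scal_add_right uminus_eq_scal)
      then have "nrm A (c \<odot> x \<ominus> c \<odot> x') = cmod c * nrm A (x \<ominus> x')"
        using xc x'c by (simp add: nrm_smult)
      also have "\<dots> \<le> (cmod c + 1) * nrm A (x \<ominus> x')"
        using xc x'c nrm_nonneg by (intro mult_right_mono) auto
      also have "\<dots> < e"
        using x'(2) by (simp add: pos_less_divide_eq add_nonneg_pos mult.commute)
      finally show ?thesis using scal x' by (intro bexI[of _ "c \<odot> x'"]) auto
    qed
    then show ?thesis using xc by (simp add: S_def)
  qed
  have S_adj: "adj A x \<in> S" if xS: "x \<in> S" for x
  proof -
    have xc: "x \<in> carrier A" using xS Sc by auto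
    have "\<exists>z\<in>B. nrm A (adj A x \<ominus> z) < e" if e: "e > 0" for e
    proof -
      obtain x' where x': "x' \<in> B" "nrm A (x \<ominus> x') < e"
        using xS e unfolding S_def by blast
      have x'c: "x' \<in> carrier A" using x' B by auto
      have "nrm A (adj A x \<ominus> adj A x') = nrm A (x \<ominus> x')"
        using xc x'c by (simp flip: adj_diff)
      then show ?thesis using adj x' by (intro bexI[of _ "adj A x'"]) auto
    qed
    then show ?thesis using xc by (simp add: S_def)
  qed
  have S_closed: "x \<in> S" if xc: "x \<in> carrier A" and ap: "\<forall>e>0. \<exists>y\<in>S. nrm A (x \<ominus> y) < e" for x
  proof -
    have "\<exists>z\<in>B. nrm A (x \<ominus> z) < e" if e: "e > 0" for e
    proof -
      have e2: "e / 2 > 0" using e by simp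
      then obtain y where y: "y \<in> S" "nrm A (x \<ominus> y) < e / 2" using ap by blast
      then obtain z where z: "z \<in> B" "nrm A (y \<ominus> z) < e / 2" using e2 unfolding S_def by blast
      have c: "y \<in> carrier A" "z \<in> carrier A" using y z B Sc by auto
      have "x \<ominus> z = (x \<ominus> y) \<oplus> (y \<ominus> z)" using xc c by algebra
      then have "nrm A (x \<ominus> z) < e"
        using nrm_triangle[of "x \<ominus> y" "y \<ominus> z"] xc c y z by simp
      then show ?thesis using z by blast
    qed
    then show ?thesis using xc by (simp add: S_def)
  qed
  have "closed_unital_star_subalgebra S A"
    unfolding closed_unital_star_subalgebra_def
    using Sc BS B S_add S_mult S_scal S_adj S_closed by auto
  then have "S = carrier A"
    using gen G BS unfolding generates_cstar_def by blast
  then show ?thesis using x e by (auto simp: S_def)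
qed

lemma swap_assoc:
  assumes "x \<otimes> y = c \<odot> (y' \<otimes> x')"
    and "x \<in> carrier A" "y \<in> carrier A" "x' \<in> carrier A" "y' \<in> carrier A" "z \<in> carrier A"
  shows "x \<otimes> (y \<otimes> z) = c \<odot> (y' \<otimes> (x' \<otimes> z))"
proof -
  have "x \<otimes> (y \<otimes> z) = (x \<otimes> y) \<otimes> z" using assms(2-) by (simp only: m_assoc)
  also have "\<dots> = c \<odot> (y' \<otimes> x') \<otimes> z" by (simp only: assms(1))
  also have "\<dots> = c \<odot> (y' \<otimes> (x' \<otimes> z))" using assms(2-) by (simp add: m_assoc)
  finally show ?thesis .
qed

primrec word :: "('i \<Rightarrow> 'a) \<Rightarrow> 'i list \<Rightarrow> 'a" where
  "word g [] = \<one>"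
| "word g (i # u) = g i \<otimes> word g u"

lemma word_closed [simp]: "g \<in> J \<rightarrow> carrier A \<Longrightarrow> set u \<subseteq> J \<Longrightarrow> word g u \<in> carrier A"
  by (induction u) auto

lemma word_append:
  "g \<in> J \<rightarrow> carrier A \<Longrightarrow> set u \<subseteq> J \<Longrightarrow> set v \<subseteq> J \<Longrightarrow> word g (u @ v) = word g u \<otimes> word g v"
proof (induction u)
  case (Cons i u)
  then have "g i \<in> carrier A" "word g u \<in> carrier A" "word g v \<in> carrier A"
    using word_closed[of g J] by auto
  with Cons show ?case by (simp add: m_assoc)
qed (use word_closed[of g J] in simp)

text \<open>
  For orthonormal \<open>g\<close> this is the *-endomorphism \<open>y \<mapsto> \<Sum> g\<^sub>i y g\<^sub>i\<^sup>*\<close>; its iterates on \<open>1\<close> are the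
  projections onto the span of the ranges of all words of a given length.
\<close>

definition range_sum :: "('i \<Rightarrow> 'a) \<Rightarrow> 'i set \<Rightarrow> 'a \<Rightarrow> 'a" where
  "range_sum g J y = (\<Oplus>i\<in>J. g i \<otimes> (y \<otimes> adj A (g i)))"

lemma range_sum_closed [simp]:
  "g \<in> J \<rightarrow> carrier A \<Longrightarrow> y \<in> carrier A \<Longrightarrow> range_sum g J y \<in> carrier A"
  unfolding range_sum_def by (intro finsum_closed) (auto simp: Pi_def)

lemma range_sum_assoc:
  assumes "g \<in> J \<rightarrow> carrier A" "y \<in> carrier A"
  shows "range_sum g J y = (\<Oplus>i\<in>J. g i \<otimes> y \<otimes> adj A (g i))"
  unfolding range_sum_def using assms by (intro finsum_cong') (auto simp: m_assoc Pi_def)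

lemma orthonormal_closed: "orthonormal J g \<Longrightarrow> g \<in> J \<rightarrow> carrier A"
  by (simp add: orthonormal_def)

lemma range_sum_mult:
  assumes g: "orthonormal J g" and J: "finite J" "i \<in> J" and y: "y \<in> carrier A"
  shows "range_sum g J y \<otimes> g i = g i \<otimes> y"
proof -
  have gc: "\<And>i. i \<in> J \<Longrightarrow> g i \<in> carrier A" using orthonormal_closed[OF g] by auto
  have "range_sum g J y \<otimes> g i = (\<Oplus>k\<in>J. g k \<otimes> y \<otimes> adj A (g k)) \<otimes> (\<Oplus>j\<in>{i}. g j \<otimes> \<one>)"
    using range_sum_assoc[OF orthonormal_closed[OF g] y] gc J by (simp add: finsum_insert)
  also have "\<dots> = (\<Oplus>k\<in>J \<inter> {i}. g k \<otimes> y \<otimes> \<one>)"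
    by (rule orthonormal_sum_mult_sum[OF g]) (use gc J y in auto)
  also have "J \<inter> {i} = {i}" using J by auto
  finally show ?thesis using gc J y by (simp add: finsum_insert)
qed

lemma range_sum_projection:
  assumes g: "orthonormal J g" and J: "finite J" and p: "projection p"
  shows "projection (range_sum g J p)"
proof -
  note [simp] = projectionD[OF p]
  have gc: "\<And>i. i \<in> J \<Longrightarrow> g i \<in> carrier A" using orthonormal_closed[OF g] by auto
  have "adj A (range_sum g J p) = (\<Oplus>i\<in>J. adj A (g i \<otimes> (p \<otimes> adj A (g i))))"
    unfolding range_sum_def by (rule adj_finsum) (use J gc in auto)
  also have "\<dots> = range_sum g J p"
    unfolding range_sum_def using gc by (intro finsum_cong') (auto simp: adj_mult m_assoc)
  finally have a: "adj A (range_sum g J p) = range_sum g J p" .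
  have pp: "p \<otimes> (p \<otimes> x) = p \<otimes> x" if "x \<in> carrier A" for x
    using that by (metis projectionD(1,3)[OF p] m_assoc)
  have "range_sum g J p \<otimes> range_sum g J p
      = (\<Oplus>k\<in>J. g k \<otimes> p \<otimes> adj A (g k)) \<otimes> (\<Oplus>k\<in>J. g k \<otimes> (p \<otimes> adj A (g k)))"
    using range_sum_assoc[OF orthonormal_closed[OF g], of p] by (simp add: range_sum_def)
  also have "\<dots> = (\<Oplus>k\<in>J \<inter> J. g k \<otimes> p \<otimes> (p \<otimes> adj A (g k)))"
    by (rule orthonormal_sum_mult_sum[OF g]) (use gc J in auto)
  also have "\<dots> = range_sum g J p"
    unfolding range_sum_def using gc by (intro finsum_cong') (auto simp: m_assoc pp)
  finally show ?thesis
    using a orthonormal_closed[OF g] by (simp add: projection_def)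
qed

lemma range_sum_one_minus_scal:
  assumes g: "g \<in> J \<rightarrow> carrier A" and J: "finite J" and y: "y \<in> carrier A"
  shows "range_sum g J (\<one> \<ominus> c \<odot> y) = range_sum g J \<one> \<ominus> c \<odot> range_sum g J y"
proof -
  have gc: "\<And>i. i \<in> J \<Longrightarrow> g i \<in> carrier A" using g by auto
  have "range_sum g J (\<one> \<ominus> c \<odot> y)
     = (\<Oplus>i\<in>J. g i \<otimes> (\<one> \<otimes> adj A (g i)) \<oplus> (- c) \<odot> (g i \<otimes> (y \<otimes> adj A (g i))))"
    unfolding range_sum_def using gc y
    by (intro finsum_cong') (auto simp: minus_eq l_distr r_distr scal_minus_left l_minus r_minus)
  also have "\<dots> = range_sum g J \<one> \<oplus> (\<Oplus>i\<in>J. (- c) \<odot> (g i \<otimes> (y \<otimes> adj A (g i))))"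
    unfolding range_sum_def using gc y by (intro finsum_addf) auto
  also have "(\<Oplus>i\<in>J. (- c) \<odot> (g i \<otimes> (y \<otimes> adj A (g i)))) = (- c) \<odot> range_sum g J y"
    unfolding range_sum_def using gc y J by (intro finsum_smult_ldistr[symmetric]) auto
  finally show ?thesis using g y by (simp add: minus_eq scal_minus_left)
qed

definition words :: "'i set \<Rightarrow> nat \<Rightarrow> 'i list set" where
  "words J a = {u. set u \<subseteq> J \<and> length u < a}"

lemma words_0 [simp]: "words J 0 = {}"
  by (simp add: words_def)

lemma finite_words [simp]: "finite J \<Longrightarrow> finite (words J a)"
  by (rule finite_subset[OF _ finite_lists_length_le[of J a]]) (auto simp: words_def)

lemma words_Suc: "words J (Suc a) = insert [] ((\<lambda>w. fst w # snd w) ` (J \<times> words J a))"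
proof
  show "words J (Suc a) \<subseteq> insert [] ((\<lambda>w. fst w # snd w) ` (J \<times> words J a))"
  proof
    fix u assume u: "u \<in> words J (Suc a)"
    show "u \<in> insert [] ((\<lambda>w. fst w # snd w) ` (J \<times> words J a))"
    proof (cases u)
      case (Cons i v)
      then have "(i, v) \<in> J \<times> words J a" using u by (auto simp: words_def)
      then show ?thesis using Cons by (auto intro!: image_eqI[of _ _ "(i, v)"])
    qed simp
  qed
qed (auto simp: words_def)

lemma finsum_words_Suc:
  assumes J: "finite J" and f: "\<And>u. set u \<subseteq> J \<Longrightarrow> f u \<in> carrier A"
  shows "(\<Oplus>u\<in>words J (Suc a). f u) = f [] \<oplus> (\<Oplus>i\<in>J. \<Oplus>u\<in>words J a. f (i # u))"
proof -
  have fc: "f u \<in> carrier A" if "u \<in> words J b" for u b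
    using that f by (auto simp: words_def)
  have fc': "f (i # u) \<in> carrier A" if "i \<in> J" "u \<in> words J b" for i u b
    using that f by (auto simp: words_def)
  have "(\<Oplus>u\<in>words J (Suc a). f u) = f [] \<oplus> (\<Oplus>u\<in>(\<lambda>w. fst w # snd w) ` (J \<times> words J a). f u)"
    unfolding words_Suc using J fc' f[of "[]"] by (intro finsum_insert) auto
  also have "(\<Oplus>u\<in>(\<lambda>w. fst w # snd w) ` (J \<times> words J a). f u)
     = (\<Oplus>w\<in>J \<times> words J a. f (fst w # snd w))"
    using fc' by (intro finsum_reindex) (auto simp: inj_on_def)
  also have "\<dots> = (\<Oplus>i\<in>J. \<Oplus>u\<in>words J a. f (i # u))"
    by (rule finsum_product[where f = "\<lambda>i u. f (i # u)"]) (use J fc' in auto)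
  finally show ?thesis .
qed

lemma range_sum_power_projection:
  assumes "orthonormal J g" "finite J"
  shows "projection ((range_sum g J ^^ a) \<one>)"
  by (induction a) (auto simp: projection_one intro: range_sum_projection[OF assms])

text \<open>
  With \<open>P\<^sub>l\<close> the range projection of the words of length \<open>l\<close>, the words of length \<open>l\<close> contribute
  \<open>\<rho>\<^sup>l P\<^sub>l - \<rho>\<^bsup>l+1\<^esup> P\<^bsub>l+1\<^esub>\<close>. The induction splits off the first letter, so that all words of length
  at least one are collected by one application of \<open>range_sum\<close>.
\<close>

lemma telescoping_words:
  fixes \<rho> :: complex
  assumes g: "orthonormal J g" and J: "finite J"
  shows "(\<Oplus>u\<in>words J a. \<rho> ^ length u \<odot> (word g u \<otimes> ((\<one> \<ominus> \<rho> \<odot> range_sum g J \<one>) \<otimes> adj A (word g u))))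
       = \<one> \<ominus> \<rho> ^ a \<odot> (range_sum g J ^^ a) \<one>"
proof (induction a)
  case 0 then show ?case by (simp add: minus_eq r_neg)
next
  case (Suc a)
  note gm = orthonormal_closed[OF g]
  have gc [simp]: "\<And>i. i \<in> J \<Longrightarrow> g i \<in> carrier A" using gm by auto
  have wc: "set u \<subseteq> J \<Longrightarrow> word g u \<in> carrier A" for u using word_closed[OF gm] by blast
  define D where "D = \<one> \<ominus> \<rho> \<odot> range_sum g J \<one>"
  have Dc [simp]: "D \<in> carrier A" using gm by (simp add: D_def)
  define f where "f = (\<lambda>u. \<rho> ^ length u \<odot> (word g u \<otimes> (D \<otimes> adj A (word g u))))"
  have fc: "f u \<in> carrier A" if "set u \<subseteq> J" for u using wc[OF that] by (simp add: f_def)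
  have fw [simp]: "f u \<in> carrier A" if "u \<in> words J a" for u using fc that by (auto simp: words_def)
  define T where "T = (range_sum g J ^^ a) \<one>"
  have Tc [simp]: "T \<in> carrier A"
    using range_sum_power_projection[OF g J, of a] by (simp add: T_def projection_def)
  have Cons: "f (i # u) = \<rho> \<odot> (g i \<otimes> (f u \<otimes> adj A (g i)))" if "i \<in> J" "u \<in> words J a" for i u
    using that wc[of u] by (simp add: f_def words_def adj_mult m_assoc)
  have "(\<Oplus>u\<in>words J (Suc a). f u) = f [] \<oplus> (\<Oplus>i\<in>J. \<Oplus>u\<in>words J a. f (i # u))"
    by (rule finsum_words_Suc[OF J fc])
  also have "f [] = D" by (simp add: f_def)
  also have "(\<Oplus>i\<in>J. \<Oplus>u\<in>words J a. f (i # u)) = (\<Oplus>i\<in>J. \<rho> \<odot> (g i \<otimes> ((\<Oplus>u\<in>words J a. f u) \<otimes> adj A (g i))))"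
  proof (rule finsum_cong')
    fix i assume i: "i \<in> J"
    have "(\<Oplus>u\<in>words J a. f (i # u)) = (\<Oplus>u\<in>words J a. \<rho> \<odot> (g i \<otimes> (f u \<otimes> adj A (g i))))"
      using i fw by (intro finsum_cong') (auto simp: Cons)
    also have "\<dots> = \<rho> \<odot> (\<Oplus>u\<in>words J a. g i \<otimes> (f u \<otimes> adj A (g i)))"
      using i J fw by (intro finsum_smult_ldistr[symmetric]) auto
    also have "(\<Oplus>u\<in>words J a. g i \<otimes> (f u \<otimes> adj A (g i))) = g i \<otimes> (\<Oplus>u\<in>words J a. f u \<otimes> adj A (g i))"
      using i J fw by (intro finsum_rdistr[symmetric]) auto
    also have "(\<Oplus>u\<in>words J a. f u \<otimes> adj A (g i)) = (\<Oplus>u\<in>words J a. f u) \<otimes> adj A (g i)"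
      using i J fw by (intro finsum_ldistr[symmetric]) auto
    finally show "(\<Oplus>u\<in>words J a. f (i # u)) = \<rho> \<odot> (g i \<otimes> ((\<Oplus>u\<in>words J a. f u) \<otimes> adj A (g i)))" .
  qed (use fw in \<open>auto intro!: finsum_closed\<close>)
  also have "\<dots> = \<rho> \<odot> range_sum g J (\<Oplus>u\<in>words J a. f u)"
    unfolding range_sum_def using fw J by (intro finsum_smult_ldistr[symmetric]) (auto intro!: finsum_closed)
  also have "(\<Oplus>u\<in>words J a. f u) = \<one> \<ominus> \<rho> ^ a \<odot> T"
    using Suc.IH by (simp add: f_def D_def T_def)
  also have "range_sum g J (\<one> \<ominus> \<rho> ^ a \<odot> T) = range_sum g J \<one> \<ominus> \<rho> ^ a \<odot> range_sum g J T"
    by (rule range_sum_one_minus_scal[OF gm J]) simp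
  also have "D \<oplus> \<rho> \<odot> (range_sum g J \<one> \<ominus> \<rho> ^ a \<odot> range_sum g J T)
     = (\<one> \<ominus> \<rho> \<odot> range_sum g J \<one>) \<oplus> (\<rho> \<odot> range_sum g J \<one> \<ominus> \<rho> ^ Suc a \<odot> range_sum g J T)"
    using gm by (simp add: D_def minus_eq scal_add_right uminus_eq_scal)
  also have "\<dots> = \<one> \<ominus> \<rho> ^ Suc a \<odot> range_sum g J T"
    using gm scal_closed[of "range_sum g J \<one>" \<rho>] scal_closed[of "range_sum g J T" "\<rho> ^ Suc a"]
      range_sum_closed[OF gm Tc] range_sum_closed[OF gm one_closed] by algebra
  finally show ?case by (simp add: f_def D_def T_def)
qed

end

section \<open>The twisted commutation relations\<close>

locale twisted_isometries = unital_cstar_algebra A for A :: "'a cstar" (structure) +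
  fixes n m :: nat and q :: complex and s t :: "nat \<Rightarrow> 'a"
  assumes relations: "E_relations n m q A s t" and cmod_q: "cmod q = 1"
begin

\<comment> \<open>Membership in the index sets has to stay atomic: it is a premise of most rewrite rules below.\<close>
declare atLeastAtMost_iff [simp del] One_nat_def [simp del]

lemma q_cnj [simp]: "q * cnj q = 1" "cnj q * q = 1"
  using complex_norm_square[of q] cmod_q by (simp_all add: mult.commute)

lemma orthonormal_s: "orthonormal {1..n} s" and orthonormal_t: "orthonormal {1..m} t"
  using relations unfolding E_relations_def orthonormal_def by auto

lemma s_closed [simp]: "i \<in> {1..n} \<Longrightarrow> s i \<in> carrier A"
  and t_closed [simp]: "r \<in> {1..m} \<Longrightarrow> t r \<in> carrier A"
  using orthonormal_closed[OF orthonormal_s] orthonormal_closed[OF orthonormal_t] by auto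

lemma adj_s_s: "i \<in> {1..n} \<Longrightarrow> j \<in> {1..n} \<Longrightarrow> adj A (s i) \<otimes> s j = (if i = j then \<one> else \<zero>)"
  using orthonormal_s unfolding orthonormal_def by blast

lemma adj_t_t: "i \<in> {1..m} \<Longrightarrow> j \<in> {1..m} \<Longrightarrow> adj A (t i) \<otimes> t j = (if i = j then \<one> else \<zero>)"
  using orthonormal_t unfolding orthonormal_def by blast

lemma adj_s_t: "i \<in> {1..n} \<Longrightarrow> r \<in> {1..m} \<Longrightarrow> adj A (s i) \<otimes> t r = q \<odot> (t r \<otimes> adj A (s i))"
  using relations unfolding E_relations_def by blast

lemma adj_t_s:
  assumes "i \<in> {1..n}" "r \<in> {1..m}"
  shows "adj A (t r) \<otimes> s i = cnj q \<odot> (s i \<otimes> adj A (t r))"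
proof -
  have "adj A (t r) \<otimes> s i = adj A (adj A (s i) \<otimes> t r)" using assms by (simp add: adj_mult)
  also have "\<dots> = cnj q \<odot> (s i \<otimes> adj A (t r))"
    using assms by (simp add: adj_s_t adj_smult adj_mult)
  finally show ?thesis .
qed

lemma t_adj_s: 
  assumes "i \<in> {1..n}" "r \<in> {1..m}"
  shows "t r \<otimes> adj A (s i) = cnj q \<odot> (adj A (s i) \<otimes> t r)"
  using assms by (simp add: adj_s_t)

text \<open>
  The relation between the generators themselves is forced by the one between \<open>s\<^sup>*\<close> and \<open>t\<close>. For
  \<open>x = t s - q s t\<close> all four terms of \<open>x\<^sup>* x\<close> equal \<open>\<plusminus>1\<close>, because the phases cancel, and they add up
  to \<open>0\<close>; the C*-identity gives \<open>x = 0\<close>.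
\<close>

lemma t_s:
  assumes i: "i \<in> {1..n}" and r: "r \<in> {1..m}"
  shows "t r \<otimes> s i = q \<odot> (s i \<otimes> t r)"
proof -
  have [simp]: "s i \<in> carrier A" "t r \<in> carrier A" using i r by auto
  define x where "x = t r \<otimes> s i \<ominus> q \<odot> (s i \<otimes> t r)"
  have xc: "x \<in> carrier A" by (simp add: x_def)
  have ss: "adj A (s i) \<otimes> (s i \<otimes> z) = z" if "z \<in> carrier A" for z
    using that i adj_s_s[of i i] by (simp flip: m_assoc)
  have tt: "adj A (t r) \<otimes> (t r \<otimes> z) = z" if "z \<in> carrier A" for z
    using that r adj_t_t[of r r] by (simp flip: m_assoc)
  have st: "adj A (s i) \<otimes> (t r \<otimes> z) = q \<odot> (t r \<otimes> (adj A (s i) \<otimes> z))" if "z \<in> carrier A" for z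
    by (rule swap_assoc[OF adj_s_t]) (use that i r in auto)
  have ts: "adj A (t r) \<otimes> (s i \<otimes> z) = cnj q \<odot> (s i \<otimes> (adj A (t r) \<otimes> z))" if "z \<in> carrier A" for z
    by (rule swap_assoc[OF adj_t_s]) (use that i r in auto)
  have p: "adj A (s i) \<otimes> s i = \<one>" "adj A (t r) \<otimes> t r = \<one>"
    using adj_s_s[OF i i] adj_t_t[OF r r] by simp_all
  have products: "adj A (t r \<otimes> s i) \<otimes> (t r \<otimes> s i) = \<one>"
    "adj A (t r \<otimes> s i) \<otimes> (q \<odot> (s i \<otimes> t r)) = \<one>"
    "adj A (q \<odot> (s i \<otimes> t r)) \<otimes> (t r \<otimes> s i) = \<one>"
    "adj A (q \<odot> (s i \<otimes> t r)) \<otimes> (q \<odot> (s i \<otimes> t r)) = \<one>"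
    by (simp_all add: adj_mult adj_smult m_assoc p ss tt st ts)
  have expand: "adj A (u \<ominus> v) \<otimes> (u \<ominus> v)
      = (adj A u \<otimes> u \<ominus> adj A v \<otimes> u) \<ominus> (adj A u \<otimes> v \<ominus> adj A v \<otimes> v)"
    if "u \<in> carrier A" "v \<in> carrier A" for u v
    using that by (simp add: adj_diff mult_diff_left mult_diff_right)
  have "adj A x \<otimes> x = (\<one> \<ominus> \<one>) \<ominus> (\<one> \<ominus> \<one>)"
    using expand[of "t r \<otimes> s i" "q \<odot> (s i \<otimes> t r)"] unfolding x_def products by simp
  also have "\<dots> = \<zero>" by simp
  finally have "adj A x \<otimes> x = \<zero>" .
  then have "nrm A x = 0" using cstar_identity[OF xc] by simp
  then have "x = \<zero>" using nrm_eq_zero[OF xc] by simp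
  then show ?thesis using eq_of_minus_zero[of "t r \<otimes> s i" "q \<odot> (s i \<otimes> t r)"] by (simp add: x_def)
qed

lemma adj_t_adj_s:
  assumes "i \<in> {1..n}" "r \<in> {1..m}"
  shows "adj A (t r) \<otimes> adj A (s i) = q \<odot> (adj A (s i) \<otimes> adj A (t r))"
proof -
  have "adj A (s i) \<otimes> adj A (t r) = adj A (t r \<otimes> s i)" using assms by (simp add: adj_mult)
  also have "\<dots> = cnj q \<odot> (adj A (t r) \<otimes> adj A (s i))"
    using assms by (simp add: t_s adj_smult adj_mult)
  finally show ?thesis using assms by simp
qed

text \<open>
  Read from left to right, these move \<open>s\<close>, \<open>s\<^sup>*\<close> to the left of \<open>t\<close>, \<open>t\<^sup>*\<close>. As rewrite rules they terminate
  in a common normal form, whereas the defining relation itself goes the other way.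
\<close>

lemmas order_pairs = t_s adj_t_s t_adj_s adj_t_adj_s

lemma order_pairs_assoc:
  assumes "i \<in> {1..n}" "r \<in> {1..m}" "z \<in> carrier A"
  shows "t r \<otimes> (s i \<otimes> z) = q \<odot> (s i \<otimes> (t r \<otimes> z))"
    "adj A (t r) \<otimes> (s i \<otimes> z) = cnj q \<odot> (s i \<otimes> (adj A (t r) \<otimes> z))"
    "t r \<otimes> (adj A (s i) \<otimes> z) = cnj q \<odot> (adj A (s i) \<otimes> (t r \<otimes> z))"
    "adj A (t r) \<otimes> (adj A (s i) \<otimes> z) = q \<odot> (adj A (s i) \<otimes> (adj A (t r) \<otimes> z))"
  using assms by (auto intro!: swap_assoc order_pairs)

text \<open>
  Exchanging the two families replaces \<open>q\<close> by its conjugate; statements about one family are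
  transported to the other in this way.
\<close>

lemma flip: "twisted_isometries A m n (cnj q) t s"
proof
  show "E_relations m n (cnj q) A t s"
    using relations unfolding E_relations_def by (auto intro: adj_t_s)
qed (use cmod_q in simp)

text \<open>
  Moving \<open>s\<close> past \<open>t\<close> and past \<open>t\<^sup>*\<close> produces conjugate phases, which cancel.
\<close>

lemma s_commute_range_t:
  assumes i: "i \<in> {1..n}" and y: "y \<in> carrier A" "s i \<otimes> y = y \<otimes> s i"
  shows "s i \<otimes> range_sum t {1..m} y = range_sum t {1..m} y \<otimes> s i"
proof -
  have sc [simp]: "s i \<in> carrier A" using i by simp
  have "s i \<otimes> range_sum t {1..m} y = (\<Oplus>r\<in>{1..m}. s i \<otimes> (t r \<otimes> (y \<otimes> adj A (t r))))"
    unfolding range_sum_def using y by (intro finsum_rdistr) auto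
  also have "\<dots> = (\<Oplus>r\<in>{1..m}. t r \<otimes> (y \<otimes> adj A (t r)) \<otimes> s i)"
  proof (rule finsum_cong')
    fix r assume r: "r \<in> {1..m}"
    have ys: "y \<otimes> (s i \<otimes> z) = s i \<otimes> (y \<otimes> z)" if "z \<in> carrier A" for z
      using that y by (metis m_assoc sc)
    show "s i \<otimes> (t r \<otimes> (y \<otimes> adj A (t r))) = t r \<otimes> (y \<otimes> adj A (t r)) \<otimes> s i"
      using i r y by (simp add: m_assoc order_pairs order_pairs_assoc ys)
  qed (use y in auto)
  also have "\<dots> = range_sum t {1..m} y \<otimes> s i"
    unfolding range_sum_def using y by (intro finsum_ldistr[symmetric]) auto
  finally show ?thesis .
qed

definition range_t_power :: "nat \<Rightarrow> 'a" where
  "range_t_power b = (range_sum t {1..m} ^^ b) \<one>"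

definition range_s_power :: "nat \<Rightarrow> 'a" where
  "range_s_power a = (range_sum s {1..n} ^^ a) \<one>"

lemma range_t_power_rec: "range_t_power 0 = \<one>"
    "range_t_power (Suc b) = range_sum t {1..m} (range_t_power b)"
  and range_s_power_rec: "range_s_power 0 = \<one>"
    "range_s_power (Suc a) = range_sum s {1..n} (range_s_power a)"
  by (simp_all add: range_t_power_def range_s_power_def)

lemma range_power_one:
  "range_s_power 1 = range_sum s {1..n} \<one>" "range_t_power 1 = range_sum t {1..m} \<one>"
  unfolding range_s_power_def range_t_power_def by (simp_all add: One_nat_def)

lemma projection_range_powers: "projection (range_s_power a)" "projection (range_t_power a)"
  unfolding range_s_power_def range_t_power_def
  by (auto intro!: range_sum_power_projection orthonormal_s orthonormal_t)

lemma range_power_closed [simp]: "range_s_power a \<in> carrier A" "range_t_power a \<in> carrier A"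
  using projection_range_powers by (auto simp: projection_def)

lemma adj_range_power [simp]:
  "adj A (range_s_power a) = range_s_power a" "adj A (range_t_power a) = range_t_power a"
  using projection_range_powers by (auto simp: projection_def)

lemma s_commute_range_t_power:
  assumes "i \<in> {1..n}" shows "s i \<otimes> range_t_power b = range_t_power b \<otimes> s i"
proof (induction b)
  case 0 then show ?case using assms by (simp add: range_t_power_rec)
next
  case (Suc b)
  then show ?case using s_commute_range_t[OF assms, of "range_t_power b"]
    by (simp add: range_t_power_rec)
qed

lemma t_commute_range_s_power:
  assumes "r \<in> {1..m}" shows "t r \<otimes> range_s_power a = range_s_power a \<otimes> t r"
  using twisted_isometries.s_commute_range_t_power[OF flip assms, of a]
  by (simp add: twisted_isometries.range_t_power_def[OF flip] range_s_power_def)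

lemma adj_s_commute_range_t_power:
  assumes "i \<in> {1..n}" shows "adj A (s i) \<otimes> range_t_power b = range_t_power b \<otimes> adj A (s i)"
  using arg_cong[OF s_commute_range_t_power[OF assms, of b], of "adj A"] assms
  by (simp add: adj_mult)

lemma range_powers_commute:
  "range_s_power a \<otimes> range_t_power b = range_t_power b \<otimes> range_s_power a"
proof (induction a)
  case 0 then show ?case by (simp add: range_s_power_rec)
next
  case (Suc a)
  have "range_s_power (Suc a) \<otimes> range_t_power b
     = (\<Oplus>i\<in>{1..n}. s i \<otimes> (range_s_power a \<otimes> adj A (s i)) \<otimes> range_t_power b)"
    unfolding range_s_power_rec range_sum_def by (intro finsum_ldistr) auto
  also have "\<dots> = (\<Oplus>i\<in>{1..n}. range_t_power b \<otimes> (s i \<otimes> (range_s_power a \<otimes> adj A (s i))))"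
  proof (rule finsum_cong')
    fix i assume i: "i \<in> {1..n}"
    have a: "range_s_power a \<otimes> (range_t_power b \<otimes> z) = range_t_power b \<otimes> (range_s_power a \<otimes> z)"
      if "z \<in> carrier A" for z
      using that Suc.IH by (metis m_assoc range_power_closed)
    have b: "s i \<otimes> (range_t_power b \<otimes> z) = range_t_power b \<otimes> (s i \<otimes> z)"
      if "z \<in> carrier A" for z
      using that s_commute_range_t_power[OF i, of b] i by (metis m_assoc s_closed range_power_closed(2))
    show "s i \<otimes> (range_s_power a \<otimes> adj A (s i)) \<otimes> range_t_power b 
        = range_t_power b \<otimes> (s i \<otimes> (range_s_power a \<otimes> adj A (s i)))"
      using i by (simp add: m_assoc adj_s_commute_range_t_power a b)
  qed auto
  also have "\<dots> = range_t_power b \<otimes> range_s_power (Suc a)"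
    unfolding range_s_power_rec range_sum_def by (intro finsum_rdistr[symmetric]) auto
  finally show ?case .
qed

lemma complements_commute:
  assumes "p \<in> carrier A" "p' \<in> carrier A" "p \<otimes> p' = p' \<otimes> p"
  shows "(\<one> \<ominus> p) \<otimes> (\<one> \<ominus> p') = (\<one> \<ominus> p') \<otimes> (\<one> \<ominus> p)"
proof -
  have eq: "(\<one> \<ominus> p) \<ominus> (p' \<ominus> x) = (\<one> \<ominus> p') \<ominus> (p \<ominus> x)" if "x \<in> carrier A" for x
    using assms(1,2) that by algebra
  have "(\<one> \<ominus> p) \<otimes> (\<one> \<ominus> p') = (\<one> \<ominus> p) \<ominus> (p' \<ominus> p \<otimes> p')"
    using assms(1,2) by (simp add: mult_diff_left mult_diff_right)
  also have "\<dots> = (\<one> \<ominus> p') \<ominus> (p \<ominus> p' \<otimes> p)" using assms eq by simp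
  also have "\<dots> = (\<one> \<ominus> p') \<otimes> (\<one> \<ominus> p)"
    using assms(1,2) by (simp add: mult_diff_left mult_diff_right)
  finally show ?thesis .
qed

definition vacuum_s :: 'a where "vacuum_s = \<one> \<ominus> range_s_power 1"
definition vacuum_t :: 'a where "vacuum_t = \<one> \<ominus> range_t_power 1"
definition vacuum :: 'a where "vacuum = vacuum_s \<otimes> vacuum_t"

lemma vacuum_parts: "projection vacuum_s" "projection vacuum_t"
  unfolding vacuum_s_def vacuum_t_def
  by (auto intro: projection_complement projection_range_powers)

lemma vacuum_parts_closed [simp]: "vacuum_s \<in> carrier A" "vacuum_t \<in> carrier A"
  using vacuum_parts by (auto simp: projection_def)

lemma vacuum_commute: "vacuum_s \<otimes> vacuum_t = vacuum_t \<otimes> vacuum_s"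
  unfolding vacuum_s_def vacuum_t_def
  by (rule complements_commute) (auto intro: range_powers_commute)

lemma projection_vacuum: "projection vacuum"
  unfolding vacuum_def using vacuum_parts vacuum_commute by (intro projection_mult)

lemma vacuum_closed [simp]: "vacuum \<in> carrier A"
  and adj_vacuum [simp]: "adj A vacuum = vacuum"
  and vacuum_idem [simp]: "vacuum \<otimes> vacuum = vacuum"
  using projection_vacuum by (auto simp: projection_def)

lemma vacuum_s_s: 
  assumes i: "i \<in> {1..n}" shows "vacuum_s \<otimes> s i = \<zero>"
proof -
  have "range_s_power 1 \<otimes> s i = s i"
    using range_sum_mult[OF orthonormal_s finite_atLeastAtMost i one_closed] i
    by (simp add: range_power_one)
  then show ?thesis using i by (simp add: vacuum_s_def mult_diff_left)
qed

lemma vacuum_mult_s [simp]: 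
  assumes i: "i \<in> {1..n}" shows "vacuum \<otimes> s i = \<zero>"
proof -
  have "vacuum_t \<otimes> s i = s i \<otimes> vacuum_t"
    using i s_commute_range_t_power[OF i, of 1]
    by (simp add: vacuum_t_def mult_diff_left mult_diff_right)
  then have "vacuum \<otimes> s i = vacuum_s \<otimes> s i \<otimes> vacuum_t"
    using i by (simp add: vacuum_def m_assoc)
  then show ?thesis using i by (simp add: vacuum_s_s)
qed

lemma vacuum_mult_t [simp]: 
  assumes r: "r \<in> {1..m}" shows "vacuum \<otimes> t r = \<zero>"
proof -
  have "vacuum = twisted_isometries.vacuum A m n t s"
    unfolding vacuum_def twisted_isometries.vacuum_def[OF flip]
      twisted_isometries.vacuum_s_def[OF flip] twisted_isometries.vacuum_t_def[OF flip]
      twisted_isometries.range_s_power_def[OF flip] twisted_isometries.range_t_power_def[OF flip]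
    using vacuum_commute 
    by (simp add: vacuum_s_def vacuum_t_def range_s_power_def range_t_power_def)
  then show ?thesis using twisted_isometries.vacuum_mult_s[OF flip r] by simp
qed

subsection \<open>The span of words and adjoints of words\<close>

definition letters :: "(nat + nat) set" where
  "letters = Inl ` {1..n} \<union> Inr ` {1..m}"

abbreviation gen :: "nat + nat \<Rightarrow> 'a" where "gen \<equiv> case_sum s t"

lemma gen_closed: "gen \<in> letters \<rightarrow> carrier A"
  by (auto simp: letters_def)

lemma gen_closed' [simp]: "a \<in> letters \<Longrightarrow> gen a \<in> carrier A"
  using gen_closed by auto

lemma mixed_word_closed [simp]: "set u \<subseteq> letters \<Longrightarrow> word gen u \<in> carrier A"
  by (rule word_closed[OF gen_closed])

lemma adj_gen_gen:
  assumes a: "a \<in> letters" and b: "b \<in> letters"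
  shows "adj A (gen a) \<otimes> gen b \<in> {\<one>, \<zero>} \<or>
    (\<exists>c. adj A (gen a) \<otimes> gen b = c \<odot> (gen b \<otimes> adj A (gen a)))"
proof (cases a; cases b)
  fix i j assume "a = Inl i" "b = Inl j"
  then show ?thesis using a b adj_s_s[of i j] by (simp add: letters_def image_iff)
next
  fix i r assume "a = Inl i" "b = Inr r"
  then show ?thesis using a b adj_s_t[of i r] by (auto simp: letters_def image_iff)
next
  fix r i assume "a = Inr r" "b = Inl i"
  then show ?thesis using a b adj_t_s[of i r] by (auto simp: letters_def image_iff)
next
  fix i j assume "a = Inr i" "b = Inr j"
  then show ?thesis using a b adj_t_t[of i j] by (simp add: letters_def image_iff)
qed

text \<open>
  The words may mix both kinds of letters in any order. This family spans more redundantly than the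
  ordered words do, but it is visibly stable under prepending a letter to the first word and under
  appending one to the second.
\<close>

inductive_set word_span :: "'a set" where
  words: "set u \<subseteq> letters \<Longrightarrow> set v \<subseteq> letters \<Longrightarrow> word gen u \<otimes> adj A (word gen v) \<in> word_span"
| zero: "\<zero> \<in> word_span"
| add: "x \<in> word_span \<Longrightarrow> y \<in> word_span \<Longrightarrow> x \<oplus> y \<in> word_span"
| scal: "x \<in> word_span \<Longrightarrow> c \<odot> x \<in> word_span"

lemma word_span_closed: "x \<in> word_span \<Longrightarrow> x \<in> carrier A"
  by (induction rule: word_span.induct) auto

lemma gen_mult_word_span:
  assumes a: "a \<in> letters" and x: "x \<in> word_span" shows "gen a \<otimes> x \<in> word_span"
  using x
proof (induction rule: word_span.induct)
  case (words u v)
  then show ?case using word_span.words[of "a # u" v] a by (simp add: m_assoc)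
next
  case (add x y)
  then show ?case using a by (auto simp: r_distr word_span_closed intro: word_span.add)
qed (use a in \<open>auto simp: word_span_closed intro: word_span.intros\<close>)

text \<open>
  The adjoint of a generator moves to the right through the word \<open>u\<close>: either it meets a generator of
  its own kind and is absorbed, or it only picks up phases and finally joins the word \<open>v\<close>.
\<close>

lemma adj_gen_mult_words:
  assumes a: "a \<in> letters" and u: "set u \<subseteq> letters" and v: "set v \<subseteq> letters"
  shows "adj A (gen a) \<otimes> (word gen u \<otimes> adj A (word gen v)) \<in> word_span"
  using u
proof (induction u)
  case Nil
  have "adj A (gen a) \<otimes> (word gen [] \<otimes> adj A (word gen v)) = word gen [] \<otimes> adj A (word gen (v @ [a]))"
    using a v word_append[OF gen_closed v, of "[a]"] by (simp add: adj_mult)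
  also have "\<dots> \<in> word_span" using a v by (intro word_span.words) auto
  finally show ?case .
next
  case (Cons b u)
  have b: "b \<in> letters" and u: "set u \<subseteq> letters" using Cons by auto
  define y where "y = word gen u \<otimes> adj A (word gen v)"
  have y: "y \<in> word_span" using u v by (auto simp: y_def intro: word_span.words)
  have yc: "y \<in> carrier A" using y by (rule word_span_closed)
  have eq: "adj A (gen a) \<otimes> (word gen (b # u) \<otimes> adj A (word gen v)) = adj A (gen a) \<otimes> gen b \<otimes> y"
    using a b u v by (simp add: y_def m_assoc)
  consider "adj A (gen a) \<otimes> gen b = \<one>" | "adj A (gen a) \<otimes> gen b = \<zero>"
    | c where "adj A (gen a) \<otimes> gen b = c \<odot> (gen b \<otimes> adj A (gen a))"
    using adj_gen_gen[OF a b] by blast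
  then show ?case unfolding eq
  proof cases
    fix c assume c: "adj A (gen a) \<otimes> gen b = c \<odot> (gen b \<otimes> adj A (gen a))"
    have "adj A (gen a) \<otimes> gen b \<otimes> y = c \<odot> (gen b \<otimes> (adj A (gen a) \<otimes> y))"
      unfolding c using a b yc by (simp add: m_assoc)
    also have "\<dots> \<in> word_span"
      using Cons.IH[OF u] b by (auto simp: y_def intro!: word_span.scal gen_mult_word_span)
    finally show "adj A (gen a) \<otimes> gen b \<otimes> y \<in> word_span" .
  qed (use yc y word_span.zero in auto)
qed

lemma adj_gen_mult_word_span:
  assumes a: "a \<in> letters" and x: "x \<in> word_span" shows "adj A (gen a) \<otimes> x \<in> word_span"
  using x
proof (induction rule: word_span.induct)
  case (words u v)
  then show ?case using adj_gen_mult_words[OF a] by blast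
next
  case (add x y)
  then show ?case using a by (auto simp: r_distr word_span_closed intro: word_span.add)
qed (use a in \<open>auto simp: word_span_closed intro: word_span.intros\<close>)

text \<open>
  That the span is closed under products need not be checked directly: the elements that together with
  their adjoints map the span into itself by left multiplication form a *-subalgebra, which contains
  the generators and lies in the span because the span contains \<open>1\<close>.
\<close>

lemma word_span_dense:
  assumes gen: "generates_cstar (s ` {1..n} \<union> t ` {1..m}) A"
    and x: "x \<in> carrier A" and e: "0 < e"
  shows "\<exists>y\<in>word_span. nrm A (x \<ominus> y) < e"
proof -
  \<comment> \<open>The *-subalgebra of left multipliers of the span.\<close>
  define B where "B = {y \<in> carrier A. \<forall>p\<in>word_span. y \<otimes> p \<in> word_span \<and> adj A y \<otimes> p \<in> word_span}"
  have "\<exists>y\<in>B. nrm A (x \<ominus> y) < e"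
  proof (rule dense_of_generates[OF gen])
    have "gen a \<in> B" if "a \<in> letters" for a
      using that gen_mult_word_span adj_gen_mult_word_span by (simp add: B_def)
    from this[of "Inl i" for i] this[of "Inr i" for i]
    show "s ` {1..n} \<union> t ` {1..m} \<subseteq> B" by (auto simp: letters_def)
    show "\<one> \<in> B" by (auto simp: B_def word_span_closed)
    show "u \<oplus> v \<in> B" if "u \<in> B" "v \<in> B" for u v
      using that by (auto simp: B_def l_distr adj_add word_span_closed intro: word_span.add)
    show "u \<otimes> v \<in> B" if "u \<in> B" "v \<in> B" for u v
      using that by (auto simp: B_def adj_mult m_assoc word_span_closed)
    show "c \<odot> u \<in> B" if "u \<in> B" for u c
      using that by (auto simp: B_def adj_smult word_span_closed intro: word_span.scal)
  qed (use x e in \<open>auto simp: B_def\<close>)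
  moreover have "B \<subseteq> word_span"
  proof
    fix y assume y: "y \<in> B"
    have "\<one> \<in> word_span" using word_span.words[of "[]" "[]"] by simp
    then have "y \<otimes> \<one> \<in> word_span" using y by (auto simp: B_def)
    then show "y \<in> word_span" using y by (auto simp: B_def)
  qed
  ultimately show ?thesis by blast
qed

lemma vacuum_compression_word_span:
  assumes "y \<in> word_span" shows "\<exists>c. vacuum \<otimes> (y \<otimes> vacuum) = c \<odot> vacuum"
  using assms
proof (induction rule: word_span.induct)
  case (words u v)
  have z: "vacuum \<otimes> word gen w = \<zero>" if "w \<noteq> []" "set w \<subseteq> letters" for w
  proof -
    obtain a w' where w: "w = a # w'" using \<open>w \<noteq> []\<close> by (cases w) auto
    then have "a \<in> letters" "set w' \<subseteq> letters" using that by auto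
    note w = w this
    have "vacuum \<otimes> gen a = \<zero>" using w by (auto simp: letters_def)
    then show ?thesis using w by (simp flip: m_assoc)
  qed
  consider "u = []" "v = []" | "u \<noteq> []" | "v \<noteq> []" by blast
  then show ?case
  proof cases
    case 1
    then show ?thesis by (intro exI[of _ 1]) simp
  next
    case 2
    have "vacuum \<otimes> (word gen u \<otimes> adj A (word gen v) \<otimes> vacuum) 
       = vacuum \<otimes> word gen u \<otimes> (adj A (word gen v) \<otimes> vacuum)" using words by (simp add: m_assoc)
    also have "\<dots> = 0 \<odot> vacuum" using z[OF 2] words by simp
    finally show ?thesis by blast
  next
    case 3
    have "adj A (word gen v) \<otimes> vacuum = adj A (vacuum \<otimes> word gen v)" using words by (simp add: adj_mult)
    also have "\<dots> = \<zero>" using z[OF 3] words by simp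
    finally have "vacuum \<otimes> (word gen u \<otimes> adj A (word gen v) \<otimes> vacuum) = 0 \<odot> vacuum" 
      using words by (simp add: m_assoc)
    then show ?thesis by blast
  qed
next
  case zero
  then show ?case by (intro exI[of _ 0]) simp
next
  case (add x y)
  then obtain c d where "vacuum \<otimes> (x \<otimes> vacuum) = c \<odot> vacuum" "vacuum \<otimes> (y \<otimes> vacuum) = d \<odot> vacuum" by blast
  then show ?case using add by (intro exI[of _ "c + d"]) (simp add: l_distr r_distr scal_add word_span_closed)
next
  case (scal x c)
  then obtain d where "vacuum \<otimes> (x \<otimes> vacuum) = d \<odot> vacuum" by blast
  then show ?case using scal by (intro exI[of _ "c * d"]) (simp add: word_span_closed)
qed

text \<open>
  The scalars of approximating elements of the span form a Cauchy sequence because a nonzero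
  projection has norm \<open>1\<close>.
\<close>

lemma vacuum_compression:
  assumes gen: "generates_cstar (s ` {1..n} \<union> t ` {1..m}) A" and y: "y \<in> carrier A"
  shows "\<exists>c. vacuum \<otimes> (y \<otimes> vacuum) = c \<odot> vacuum"
proof (cases "vacuum = \<zero>")
  case True
  then show ?thesis using y by simp
next
  case False
  have v1: "nrm A vacuum = 1"
    using False nrm_projection[OF projection_vacuum] nrm_eq_zero[OF vacuum_closed] by auto
  have "\<forall>k. \<exists>p\<in>word_span. nrm A (y \<ominus> p) < 1 / Suc k"
    using word_span_dense[OF gen y] by simp
  then obtain p where p: "\<And>k. p k \<in> word_span" "\<And>k. nrm A (y \<ominus> p k) < 1 / Suc k" by metis
  obtain c where c: "\<And>k. vacuum \<otimes> (p k \<otimes> vacuum) = c k \<odot> vacuum"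
    using vacuum_compression_word_span[OF p(1)] by metis
  define h where "h = vacuum \<otimes> (y \<otimes> vacuum)"
  have hc: "h \<in> carrier A" using y by (simp add: h_def)
  have close: "nrm A (h \<ominus> c k \<odot> vacuum) \<le> 1 / Suc k" for k
  proof -
    have pk: "p k \<in> carrier A" using p(1) by (rule word_span_closed)
    have "h \<ominus> c k \<odot> vacuum = vacuum \<otimes> (y \<ominus> p k) \<otimes> vacuum"
      using y pk by (simp add: h_def c[symmetric] mult_diff_left mult_diff_right m_assoc)
    also have "nrm A \<dots> \<le> nrm A vacuum * nrm A (y \<ominus> p k) * nrm A vacuum"
      using y pk by (intro nrm_mult3) auto
    finally show ?thesis using p(2)[of k] v1 by simp
  qed
  have diff: "dist (c k) (c l) \<le> 1 / Suc k + 1 / Suc l" for k l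
  proof -
    have "dist (c k) (c l) = nrm A ((c k - c l) \<odot> vacuum)" using v1 by (simp add: nrm_smult dist_norm)
    also have "(c k - c l) \<odot> vacuum = (h \<ominus> c l \<odot> vacuum) \<ominus> (h \<ominus> c k \<odot> vacuum)"
      using hc by (simp add: scal_diff minus_minus_cancel)
    also have "nrm A \<dots> \<le> nrm A (h \<ominus> c l \<odot> vacuum) + nrm A (h \<ominus> c k \<odot> vacuum)"
      using hc by (intro nrm_diff_triangle) auto
    finally show ?thesis using close[of k] close[of l] by simp
  qed
  have "Cauchy c"
  proof (rule metric_CauchyI)
    fix e :: real assume e: "0 < e"
    then obtain N where N: "1 / real (Suc N) < e / 2"
      using reals_Archimedean[of "e/2"] by (auto simp: inverse_eq_divide)
    have "dist (c k) (c l) < e" if kl: "N \<le> k" "N \<le> l" for k l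
    proof -
      have "1 / real (Suc k) \<le> 1 / real (Suc N)" "1 / real (Suc l) \<le> 1 / real (Suc N)"
        using kl by (auto simp: field_simps)
      then show ?thesis using diff[of k l] N by linarith
    qed
    then show "\<exists>M. \<forall>k\<ge>M. \<forall>l\<ge>M. dist (c k) (c l) < e" by blast
  qed
  then obtain c0 where c0: "c \<longlonglongrightarrow> c0" using Cauchy_convergent convergent_def by blast
  have "nrm A (h \<ominus> c0 \<odot> vacuum) \<le> 1 / Suc k + norm (c k - c0)" for k
  proof -
    have "h \<ominus> c0 \<odot> vacuum = (h \<ominus> c k \<odot> vacuum) \<oplus> (c k - c0) \<odot> vacuum"
      using hc by (simp add: scal_diff minus_trans)
    then have "nrm A (h \<ominus> c0 \<odot> vacuum) \<le> nrm A (h \<ominus> c k \<odot> vacuum) + nrm A ((c k - c0) \<odot> vacuum)"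
      using hc by (simp add: nrm_triangle)
    then show ?thesis using close[of k] v1 by (simp add: nrm_smult)
  qed
  moreover have "(\<lambda>k. 1 / Suc k + norm (c k - c0)) \<longlonglongrightarrow> 0 + norm (c0 - c0)"
    using LIMSEQ_inverse_real_of_nat c0 by (intro tendsto_intros) (simp_all add: inverse_eq_divide)
  ultimately have "nrm A (h \<ominus> c0 \<odot> vacuum) \<le> 0"
    by (intro LIMSEQ_le_const[of _ 0 ]) auto
  then have "nrm A (h \<ominus> c0 \<odot> vacuum) = 0"
    using nrm_nonneg[of "h \<ominus> c0 \<odot> vacuum"] hc by simp
  then have "h \<ominus> c0 \<odot> vacuum = \<zero>" using nrm_eq_zero hc by simp
  then have "h = c0 \<odot> vacuum" using hc eq_of_minus_zero[of h "c0 \<odot> vacuum"] by simp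
  then show ?thesis unfolding h_def by blast
qed

end

section \<open>Scalar matrices over an orthonormal family\<close>

context unital_cstar_algebra
begin

lemma nrm_le_one_isometry:
  assumes "x \<in> carrier A" "adj A x \<otimes> x = \<one>" shows "nrm A x \<le> 1"
  using nrm_le_one_of_adj_mult_projection[OF assms(1)] assms(2) projection_one by simp

lemma range_sum_mult_left:
  assumes g: "g \<in> S \<rightarrow> carrier A" and S: "finite S" and x: "x \<in> carrier A" "z \<in> carrier A"
  shows "range_sum g S x \<otimes> z = (\<Oplus>v\<in>S. g v \<otimes> (x \<otimes> (adj A (g v) \<otimes> z)))"
proof -
  have gc [simp]: "\<And>i. i \<in> S \<Longrightarrow> g i \<in> carrier A" using g by auto
  have "range_sum g S x \<otimes> z = (\<Oplus>v\<in>S. g v \<otimes> (x \<otimes> adj A (g v)) \<otimes> z)"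
    unfolding range_sum_def using x S by (intro finsum_ldistr) auto
  also have "\<dots> = (\<Oplus>v\<in>S. g v \<otimes> (x \<otimes> (adj A (g v) \<otimes> z)))"
    using x by (intro finsum_cong') (auto simp: m_assoc)
  finally show ?thesis .
qed

lemma range_sum_mult_right:
  assumes g: "g \<in> S \<rightarrow> carrier A" and S: "finite S" and x: "x \<in> carrier A" "z \<in> carrier A"
  shows "z \<otimes> range_sum g S x = (\<Oplus>v\<in>S. z \<otimes> (g v \<otimes> (x \<otimes> adj A (g v))))"
proof -
  have gc [simp]: "\<And>i. i \<in> S \<Longrightarrow> g i \<in> carrier A" using g by auto
  show ?thesis
    unfolding range_sum_def using x S by (intro finsum_rdistr) auto
qed

lemma adj_mult_range_sum:
  assumes g: "orthonormal S g" and S: "finite S" "i \<in> S" and p: "projection p"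
  shows "adj A (g i) \<otimes> range_sum g S p = p \<otimes> adj A (g i)"
proof -
  have gc: "g i \<in> carrier A" using orthonormal_closed[OF g] S by auto
  have "adj A (g i) \<otimes> range_sum g S p = adj A (range_sum g S p \<otimes> g i)"
    using gc range_sum_projection[OF g S(1) p] by (simp add: adj_mult projection_def)
  also have "\<dots> = adj A (g i \<otimes> p)" using range_sum_mult[OF g S] p by (simp add: projection_def)
  also have "\<dots> = p \<otimes> adj A (g i)" using gc p by (simp add: adj_mult projection_def)
  finally show ?thesis .
qed

lemma finsum_scalar:
  assumes "finite S" "\<And>v. v \<in> S \<Longrightarrow> \<exists>c. h v = c \<odot> \<one>"
  shows "\<exists>c. (\<Oplus>v\<in>S. h v) = c \<odot> \<one>"
  using assms
proof (induction S rule: finite_induct)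
  case empty then show ?case by (intro exI[of _ 0]) simp
next
  case (insert i S)
  then obtain c d where cd: "h i = c \<odot> \<one>" "(\<Oplus>v\<in>S. h v) = d \<odot> \<one>" by blast
  have "h v \<in> carrier A" if "v \<in> insert i S" for v
    using insert.prems[OF that] by auto
  then have "(\<Oplus>v\<in>insert i S. h v) = h i \<oplus> (\<Oplus>v\<in>S. h v)" using insert by (intro finsum_insert) auto
  then show ?case using cd by (intro exI[of _ "c + d"]) (simp add: scal_add)
qed

text \<open>
  For orthonormal \<open>f\<close>, these are the combinations of the matrix units \<open>f\<^sub>v f\<^sub>w\<^sup>*\<close>. Membership is
  expressed by the scalar entries rather than by a double sum of coefficients, which makes closure
  under products a matter of inserting \<open>\<Sum> f\<^sub>u f\<^sub>u\<^sup>*\<close>. Commutation with \<open>\<Sum> f\<^sub>u p f\<^sub>u\<^sup>*\<close> makes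
  \<open>z \<mapsto> z \<Sum> f\<^sub>u p f\<^sub>u\<^sup>*\<close> a *-homomorphism.
\<close>

definition scalar_matrix :: "('i \<Rightarrow> 'a) \<Rightarrow> 'i set \<Rightarrow> 'a \<Rightarrow> 'a \<Rightarrow> bool" where
  "scalar_matrix f S p z \<longleftrightarrow> z \<in> carrier A \<and>
     range_sum f S \<one> \<otimes> z = z \<and> z \<otimes> range_sum f S \<one> = z \<and>
     z \<otimes> range_sum f S p = range_sum f S p \<otimes> z \<and>
     (\<forall>v\<in>S. \<forall>w\<in>S. \<exists>c. adj A (f v) \<otimes> (z \<otimes> f w) = c \<odot> \<one>)"

end

locale orthonormal_family = unital_cstar_algebra A for A :: "'a cstar" (structure) +
  fixes f :: "'i \<Rightarrow> 'a" and S :: "'i set" and p :: 'a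
  assumes f: "orthonormal S f" and S: "finite S" and p: "projection p"
begin

lemma family_closed [simp]: "v \<in> S \<Longrightarrow> f v \<in> carrier A"
  using orthonormal_closed[OF f] by auto

lemma family_adj: "v \<in> S \<Longrightarrow> w \<in> S \<Longrightarrow> adj A (f v) \<otimes> f w = (if v = w then \<one> else \<zero>)"
  using f by (auto simp: orthonormal_def)

lemma nrm_family_le: "v \<in> S \<Longrightarrow> nrm A (f v) \<le> 1"
  using nrm_le_one_isometry family_adj by simp

lemma range_sum_closed_family [simp]: "y \<in> carrier A \<Longrightarrow> range_sum f S y \<in> carrier A"
  by (rule range_sum_closed[OF orthonormal_closed[OF f]])

lemma p_closed [simp]: "p \<in> carrier A" and adj_p [simp]: "adj A p = p"
  using p by (auto simp: projection_def)

lemma adj_range_sum_family [simp]: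
  "adj A (range_sum f S \<one>) = range_sum f S \<one>" "adj A (range_sum f S p) = range_sum f S p"
  using range_sum_projection[OF f S p] range_sum_projection[OF f S projection_one]
  by (auto simp: projection_def)

lemma scalar_matrix_closed: "scalar_matrix f S p z \<Longrightarrow> z \<in> carrier A"
  by (simp add: scalar_matrix_def)

lemma scalar_matrix_zero: "scalar_matrix f S p \<zero>"
  unfolding scalar_matrix_def by (auto intro!: exI[of _ 0])

lemma scalar_matrix_add:
  assumes "scalar_matrix f S p z" "scalar_matrix f S p z'"
  shows "scalar_matrix f S p (z \<oplus> z')"
proof -
  have c [simp]: "z \<in> carrier A" "z' \<in> carrier A" using assms by (auto simp: scalar_matrix_def)
  have "\<exists>c. adj A (f v) \<otimes> ((z \<oplus> z') \<otimes> f w) = c \<odot> \<one>" if vw: "v \<in> S" "w \<in> S" for v w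
  proof -
    obtain c d where "adj A (f v) \<otimes> (z \<otimes> f w) = c \<odot> \<one>" "adj A (f v) \<otimes> (z' \<otimes> f w) = d \<odot> \<one>"
      using assms vw unfolding scalar_matrix_def by blast
    then show ?thesis using vw by (intro exI[of _ "c + d"]) (simp add: l_distr r_distr scal_add)
  qed
  then show ?thesis using assms unfolding scalar_matrix_def by (simp add: l_distr r_distr)
qed

lemma scalar_matrix_scal:
  assumes "scalar_matrix f S p z"
  shows "scalar_matrix f S p (a \<odot> z)"
proof -
  have c [simp]: "z \<in> carrier A" using assms by (auto simp: scalar_matrix_def)
  have "\<exists>c. adj A (f v) \<otimes> ((a \<odot> z) \<otimes> f w) = c \<odot> \<one>" if vw: "v \<in> S" "w \<in> S" for v w
  proof -
    obtain c where "adj A (f v) \<otimes> (z \<otimes> f w) = c \<odot> \<one>"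
      using assms vw unfolding scalar_matrix_def by blast
    then show ?thesis using vw by (intro exI[of _ "a * c"]) simp
  qed
  then show ?thesis using assms unfolding scalar_matrix_def by simp
qed

lemma scalar_matrix_finsum:
  assumes "finite T" "\<And>v. v \<in> T \<Longrightarrow> scalar_matrix f S p (h v)"
  shows "scalar_matrix f S p (\<Oplus>v\<in>T. h v)"
  using assms
proof (induction T rule: finite_induct)
  case empty then show ?case by (simp add: scalar_matrix_zero)
next
  case (insert i T)
  have "(\<Oplus>v\<in>insert i T. h v) = h i \<oplus> (\<Oplus>v\<in>T. h v)"
    using insert scalar_matrix_closed by (intro finsum_insert) auto
  then show ?case using insert by (simp add: scalar_matrix_add)
qed

lemma scalar_matrix_adj:
  assumes z: "scalar_matrix f S p z" shows "scalar_matrix f S p (adj A z)"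
proof -
  have c [simp]: "z \<in> carrier A" using z by (auto simp: scalar_matrix_def)
  have eqs: "range_sum f S \<one> \<otimes> z = z" "z \<otimes> range_sum f S \<one> = z"
     "z \<otimes> range_sum f S p = range_sum f S p \<otimes> z" using z by (auto simp: scalar_matrix_def)
  have "\<exists>c. adj A (f v) \<otimes> (adj A z \<otimes> f w) = c \<odot> \<one>" if vw: "v \<in> S" "w \<in> S" for v w
  proof -
    obtain c where "adj A (f w) \<otimes> (z \<otimes> f v) = c \<odot> \<one>"
      using z vw unfolding scalar_matrix_def by blast
    then have "adj A (adj A (f w) \<otimes> (z \<otimes> f v)) = adj A (c \<odot> \<one>)" by simp
    then show ?thesis using vw by (intro exI[of _ "cnj c"]) (simp add: adj_mult adj_smult m_assoc)
  qed
  then show ?thesis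
    using arg_cong[OF eqs(1), of "adj A"] arg_cong[OF eqs(2), of "adj A"] arg_cong[OF eqs(3), of "adj A"]
    unfolding scalar_matrix_def by (simp add: adj_mult)
qed

lemma scalar_matrix_mult:
  assumes z: "scalar_matrix f S p z" and z': "scalar_matrix f S p z'"
  shows "scalar_matrix f S p (z \<otimes> z')"
proof -
  have c [simp]: "z \<in> carrier A" "z' \<in> carrier A" using assms by (auto simp: scalar_matrix_def)
  have eqs: "range_sum f S \<one> \<otimes> z = z" "z' \<otimes> range_sum f S \<one> = z'" "range_sum f S \<one> \<otimes> z' = z'"
     "z \<otimes> range_sum f S p = range_sum f S p \<otimes> z"
     "z' \<otimes> range_sum f S p = range_sum f S p \<otimes> z'" using assms by (auto simp: scalar_matrix_def)
  have "\<exists>c. adj A (f v) \<otimes> (z \<otimes> z' \<otimes> f w) = c \<odot> \<one>" if vw: "v \<in> S" "w \<in> S" for v w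
  proof -
    have [simp]: "f v \<in> carrier A" "f w \<in> carrier A" using vw by auto
    have "adj A (f v) \<otimes> (z \<otimes> z' \<otimes> f w) = adj A (f v) \<otimes> z \<otimes> (range_sum f S \<one> \<otimes> (z' \<otimes> f w))"
      using eqs(3) by (simp add: m_assoc flip: m_assoc[of "range_sum f S \<one>" z' "f w"])
    also have "range_sum f S \<one> \<otimes> (z' \<otimes> f w) = (\<Oplus>u\<in>S. f u \<otimes> (\<one> \<otimes> (adj A (f u) \<otimes> (z' \<otimes> f w))))"
      by (rule range_sum_mult_left[OF orthonormal_closed[OF f] S]) auto
    also have "adj A (f v) \<otimes> z \<otimes> \<dots> = (\<Oplus>u\<in>S. adj A (f v) \<otimes> z \<otimes> (f u \<otimes> (\<one> \<otimes> (adj A (f u) \<otimes> (z' \<otimes> f w)))))"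
      using S by (intro finsum_rdistr) auto
    finally have eq: "adj A (f v) \<otimes> (z \<otimes> z' \<otimes> f w) = \<dots>" .
    show ?thesis unfolding eq
    proof (rule finsum_scalar[OF S])
      fix u assume u: "u \<in> S"
      obtain c d where cd: "adj A (f v) \<otimes> (z \<otimes> f u) = c \<odot> \<one>" "adj A (f u) \<otimes> (z' \<otimes> f w) = d \<odot> \<one>"
        using assms vw u unfolding scalar_matrix_def by blast
      have "adj A (f v) \<otimes> z \<otimes> (f u \<otimes> (\<one> \<otimes> (adj A (f u) \<otimes> (z' \<otimes> f w))))
        = (adj A (f v) \<otimes> (z \<otimes> f u)) \<otimes> (adj A (f u) \<otimes> (z' \<otimes> f w))" using u by (simp add: m_assoc)
      also have "\<dots> = (d * c) \<odot> \<one>" unfolding cd by simp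
      finally show "\<exists>c. adj A (f v) \<otimes> z \<otimes> (f u \<otimes> (\<one> \<otimes> (adj A (f u) \<otimes> (z' \<otimes> f w)))) = c \<odot> \<one>"
        by blast
    qed
  qed
  moreover have "range_sum f S \<one> \<otimes> (z \<otimes> z') = z \<otimes> z'"
    using eqs(1) by (simp flip: m_assoc)
  moreover have "z \<otimes> z' \<otimes> range_sum f S p = range_sum f S p \<otimes> (z \<otimes> z')"
    using eqs(4,5) by (simp add: m_assoc) (simp flip: m_assoc)
  ultimately show ?thesis
    using eqs(2) unfolding scalar_matrix_def by (simp add: m_assoc)
qed

lemma scalar_matrix_unit:
  assumes u: "u \<in> S" "v \<in> S" shows "scalar_matrix f S p (f u \<otimes> adj A (f v))"
proof -
  note R = range_sum_mult[OF f S] adj_mult_range_sum[OF f S]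
  have [simp]: "f u \<in> carrier A" "f v \<in> carrier A" using u by auto
  have "\<exists>c. adj A (f x) \<otimes> (f u \<otimes> adj A (f v) \<otimes> f w) = c \<odot> \<one>" if x: "x \<in> S" "w \<in> S" for x w
  proof -
    have "adj A (f x) \<otimes> (f u \<otimes> adj A (f v) \<otimes> f w) = (adj A (f x) \<otimes> f u) \<otimes> (adj A (f v) \<otimes> f w)"
      using x by (simp add: m_assoc)
    also have "\<dots> = (if x = u \<and> v = w then 1 else 0) \<odot> \<one>" using x u by (simp add: family_adj)
    finally show ?thesis by blast
  qed
  moreover have "range_sum f S y \<otimes> (f u \<otimes> adj A (f v)) = f u \<otimes> y \<otimes> adj A (f v)" 
    if "y \<in> carrier A" for y
    using that R(1)[OF u(1) that] by (simp flip: m_assoc)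
  moreover have "f u \<otimes> adj A (f v) \<otimes> range_sum f S y = f u \<otimes> y \<otimes> adj A (f v)" 
    if "projection y" for y
    using R(2)[OF u(2) that] projectionD(1)[OF that] by (simp add: m_assoc)
  ultimately show ?thesis
    using p projection_one unfolding scalar_matrix_def by simp
qed

text \<open>
  The entries of \<open>z \<Sum> f\<^sub>u p f\<^sub>u\<^sup>*\<close> are those of \<open>z\<close> multiplied by \<open>p\<close>, hence of the same norm, and \<open>z\<close> is
  bounded by the sum of the norms of its entries. This gives the inequality with the square of the
  number of labels as a factor, which \<open>power_bound_comparison\<close> removes.
\<close>

theorem nrm_scalar_matrix_le:
  assumes nz: "p \<noteq> \<zero>" and z: "scalar_matrix f S p z"
  shows "nrm A z \<le> nrm A (z \<otimes> range_sum f S p)"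
proof (rule power_bound_comparison[where R = "\<lambda>y z. scalar_matrix f S p z \<and> y = z \<otimes> range_sum f S p"])
  define G where "G = range_sum f S p"
  have G: "G \<in> carrier A" "adj A G = G" "G \<otimes> G = G"
    using range_sum_projection[OF f S p] by (auto simp: G_def projection_def)
  fix y z assume yz: "scalar_matrix f S p z \<and> y = z \<otimes> range_sum f S p"
  then have zc [simp]: "z \<in> carrier A" and y: "y = z \<otimes> G" by (auto simp: scalar_matrix_def G_def)
  have zz: "scalar_matrix f S p (adj A z \<otimes> z)"
    using yz by (auto intro: scalar_matrix_mult scalar_matrix_adj)
  then have "adj A z \<otimes> z \<otimes> G = G \<otimes> (adj A z \<otimes> z)" by (simp add: scalar_matrix_def G_def)
  then have "adj A y \<otimes> y = adj A z \<otimes> z \<otimes> G \<otimes> G"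
    using G by (simp add: y adj_mult m_assoc)
  also have "\<dots> = adj A z \<otimes> z \<otimes> G" using G by (simp add: m_assoc)
  finally show "y \<in> carrier A \<and> z \<in> carrier A \<and> scalar_matrix f S p (adj A z \<otimes> z) \<and>
      adj A y \<otimes> y = adj A z \<otimes> z \<otimes> range_sum f S p"
    using zz G y unfolding G_def by simp
next
  define G where "G = range_sum f S p"
  have G [simp]: "G \<in> carrier A" by (simp add: G_def)
  have p1: "nrm A p = 1" using nrm_projection[OF p] nrm_eq_zero[of p] nz by auto
  fix y z assume yz: "scalar_matrix f S p z \<and> y = z \<otimes> range_sum f S p"
  then have zc [simp]: "z \<in> carrier A" and y: "y = z \<otimes> G" 
    and zF: "range_sum f S \<one> \<otimes> z = z" "z \<otimes> range_sum f S \<one> = z"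
    by (auto simp: scalar_matrix_def G_def)
  have yc: "y \<in> carrier A" by (simp add: y)
  have entry: "nrm A (adj A (f v) \<otimes> (z \<otimes> (f w \<otimes> adj A (f w)))) \<le> nrm A y" if vw: "v \<in> S" "w \<in> S" for v w
  proof -
    obtain c where c: "adj A (f v) \<otimes> (z \<otimes> f w) = c \<odot> \<one>"
      using yz vw unfolding scalar_matrix_def by blast
    have "adj A (f v) \<otimes> (z \<otimes> (f w \<otimes> adj A (f w))) = adj A (f v) \<otimes> (z \<otimes> f w) \<otimes> adj A (f w)"
      using vw by (simp add: m_assoc)
    also have "\<dots> = c \<odot> adj A (f w)" unfolding c using vw by simp
    also have "nrm A \<dots> \<le> cmod c * 1" 
      using vw nrm_family_le by (simp add: nrm_smult mult_left_le)
    \<comment> \<open>The scalar entry is read off after compression by \<open>p\<close>, where it is an entry of \<open>y\<close>.\<close>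
    also have "\<dots> = nrm A (c \<odot> p)" by (simp add: nrm_smult p1)
    also have "c \<odot> p = adj A (f v) \<otimes> (z \<otimes> f w) \<otimes> p" unfolding c by simp
    also have "\<dots> = adj A (f v) \<otimes> y \<otimes> f w"
      using vw range_sum_mult[OF f S vw(2), of p] by (simp add: y G_def m_assoc)
    also have "nrm A \<dots> \<le> nrm A (adj A (f v)) * nrm A y * nrm A (f w)"
      using vw yc by (intro nrm_mult3) auto
    also have "\<dots> \<le> 1 * nrm A y * 1"
      using vw yc nrm_nonneg nrm_family_le by (intro mult_mono) auto
    finally show ?thesis by simp
  qed
  have row: "nrm A (f v \<otimes> (\<one> \<otimes> (adj A (f v) \<otimes> z))) \<le> real (card S) * nrm A y" if v: "v \<in> S" for v
  proof -
    have "adj A (f v) \<otimes> z = (\<Oplus>w\<in>S. adj A (f v) \<otimes> z \<otimes> (f w \<otimes> (\<one> \<otimes> adj A (f w))))"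
      using range_sum_mult_right[OF orthonormal_closed[OF f] S one_closed, of "adj A (f v) \<otimes> z"] v zF
      by (simp add: m_assoc)
    also have "nrm A \<dots> \<le> (\<Sum>w\<in>S. nrm A (adj A (f v) \<otimes> z \<otimes> (f w \<otimes> (\<one> \<otimes> adj A (f w)))))"
      using v S by (intro nrm_finsum) auto
    also have "\<dots> \<le> (\<Sum>w\<in>S. nrm A y)"
      using entry v by (intro sum_mono) (simp add: m_assoc)
    finally have row_sum: "nrm A (adj A (f v) \<otimes> z) \<le> real (card S) * nrm A y" by simp
    have "nrm A (f v \<otimes> (\<one> \<otimes> (adj A (f v) \<otimes> z))) \<le> nrm A (f v) * nrm A (adj A (f v) \<otimes> z)"
      using v nrm_mult[of "f v" "adj A (f v) \<otimes> z"] by simp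
    also have "\<dots> \<le> 1 * nrm A (adj A (f v) \<otimes> z)"
      using v nrm_family_le nrm_nonneg by (intro mult_right_mono) auto
    finally show ?thesis using row_sum by simp
  qed
  have "nrm A z = nrm A (\<Oplus>v\<in>S. f v \<otimes> (\<one> \<otimes> (adj A (f v) \<otimes> z)))"
    using range_sum_mult_left[OF orthonormal_closed[OF f] S one_closed zc] zF by simp
  also have "\<dots> \<le> (\<Sum>v\<in>S. nrm A (f v \<otimes> (\<one> \<otimes> (adj A (f v) \<otimes> z))))"
    using S by (intro nrm_finsum) auto
  also have "\<dots> \<le> (\<Sum>v\<in>S. real (card S) * nrm A y)"
    by (intro sum_mono row)
  finally show "nrm A z \<le> (real (card S) * real (card S)) * nrm A y" by simp
qed (use z in simp)

text \<open>
  The rows \<open>y\<^sub>w\<close> are permuted, up to phases, by right multiplication with \<open>g\<close>: row \<open>h v\<close> becomes row \<open>v\<close>,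
  and the rows outside the image of \<open>h\<close> die. On the coded column this is left multiplication by a
  matrix with entries in \<open>\<complex>\<close>.
\<close>

lemma shift_intertwines:
  assumes T: "T \<subseteq> S" and h: "inj_on h T" "h ` T \<subseteq> S"
    and y: "\<And>w. w \<in> S \<Longrightarrow> y w \<in> carrier A" and g: "g \<in> carrier A"
    and eq: "\<And>v. v \<in> T \<Longrightarrow> y (h v) \<otimes> g = \<kappa> v \<odot> y v"
    and zero: "\<And>w. w \<in> S - h ` T \<Longrightarrow> y w \<otimes> g = \<zero>"
  shows "(\<Oplus>w\<in>S. f w \<otimes> y w) \<otimes> g = (\<Oplus>v\<in>T. \<kappa> v \<odot> (f (h v) \<otimes> adj A (f v))) \<otimes> (\<Oplus>w\<in>S. f w \<otimes> y w)"
    (is "?V \<otimes> g = ?L \<otimes> ?V")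
proof -
  have Tc [simp]: "\<And>v. v \<in> T \<Longrightarrow> f v \<in> carrier A" "\<And>v. v \<in> T \<Longrightarrow> f (h v) \<in> carrier A"
    "\<And>v. v \<in> T \<Longrightarrow> y v \<in> carrier A" "\<And>v. v \<in> T \<Longrightarrow> y (h v) \<in> carrier A"
    using T h y by auto
  have fT: "finite T" using T S by (rule finite_subset)
  have "?V \<otimes> g = (\<Oplus>w\<in>S. f w \<otimes> y w \<otimes> g)" using S y g by (intro finsum_ldistr) auto
  also have "\<dots> = (\<Oplus>w\<in>h ` T. f w \<otimes> y w \<otimes> g)"
    using S h y g zero by (intro finsum_restrict) (auto simp: m_assoc)
  also have "\<dots> = (\<Oplus>v\<in>T. f (h v) \<otimes> y (h v) \<otimes> g)"
    using h y g by (intro finsum_reindex) auto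
  also have "\<dots> = (\<Oplus>v\<in>T. \<kappa> v \<odot> (f (h v) \<otimes> adj A (f v)) \<otimes> ?V)"
  proof (rule finsum_cong')
    fix v assume v: "v \<in> T"
    have Vc: "?V \<in> carrier A" using y by (intro finsum_closed) auto
    have "adj A (f v) \<otimes> ?V = y v"
      using orthonormal_mult_sum[OF f S subset_refl, of v y] y v T by auto
    then have "\<kappa> v \<odot> (f (h v) \<otimes> adj A (f v)) \<otimes> ?V = \<kappa> v \<odot> (f (h v) \<otimes> y v)"
      using v Vc by (simp add: m_assoc)
    also have "\<dots> = f (h v) \<otimes> y (h v) \<otimes> g" using v g by (simp add: m_assoc eq)
    finally show "f (h v) \<otimes> y (h v) \<otimes> g = \<kappa> v \<odot> (f (h v) \<otimes> adj A (f v)) \<otimes> ?V" by simp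
  qed (use y in \<open>auto intro!: finsum_closed\<close>)
  also have "\<dots> = ?L \<otimes> ?V"
    using y fT by (intro finsum_ldistr[symmetric]) (auto intro!: finsum_closed)
  finally show ?thesis .
qed

text \<open>
  The kernel \<open>k\<close> transforms under the same shift by \<open>c g\<close>. Restricting the column to \<open>U\<close> restricts the
  result to those \<open>v\<close> with \<open>h v \<in> U\<close>, so truncations are tracked exactly.
\<close>

lemma adj_sum_mult_shift:
  assumes T: "T \<subseteq> S" and h: "h ` T \<subseteq> S" and U: "U \<subseteq> S" "U' = {v \<in> T. h v \<in> U}"
    and k: "\<And>w. w \<in> S \<Longrightarrow> k w \<in> carrier A" and g: "g \<in> carrier A"
    and eq: "\<And>v. v \<in> T \<Longrightarrow> \<kappa> v \<odot> adj A (k (h v)) = c \<odot> (g \<otimes> adj A (k v))"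
  shows "adj A (\<Oplus>w\<in>U. f w \<otimes> k w) \<otimes> (\<Oplus>v\<in>T. \<kappa> v \<odot> (f (h v) \<otimes> adj A (f v)))
       = c \<odot> (g \<otimes> adj A (\<Oplus>w\<in>U'. f w \<otimes> k w))"
proof -
  have Tc [simp]: "\<And>v. v \<in> T \<Longrightarrow> f v \<in> carrier A" "\<And>v. v \<in> T \<Longrightarrow> f (h v) \<in> carrier A"
    "\<And>v. v \<in> T \<Longrightarrow> k v \<in> carrier A" "\<And>v. v \<in> T \<Longrightarrow> k (h v) \<in> carrier A"
    "\<And>v. v \<in> U \<Longrightarrow> f v \<in> carrier A" "\<And>v. v \<in> U \<Longrightarrow> k v \<in> carrier A"
    using T h U k by auto
  have U'T: "U' \<subseteq> T" using U by auto
  have fin: "finite T" "finite U" "finite U'"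
    using finite_subset[OF T S] finite_subset[OF U(1) S] finite_subset[OF U'T] by auto
  have Cc: "(\<Oplus>w\<in>U. f w \<otimes> k w) \<in> carrier A" by (intro finsum_closed) auto
  have fh: "adj A (\<Oplus>w\<in>U. f w \<otimes> k w) \<otimes> f (h v) = (if h v \<in> U then adj A (k (h v)) else \<zero>)"
    if v: "v \<in> T" for v
  proof -
    have "adj A (\<Oplus>w\<in>U. f w \<otimes> k w) \<otimes> f (h v) = adj A (adj A (f (h v)) \<otimes> (\<Oplus>w\<in>U. f w \<otimes> k w))"
      using v Cc by (simp add: adj_mult)
    also have "adj A (f (h v)) \<otimes> (\<Oplus>w\<in>U. f w \<otimes> k w) = (if h v \<in> U then k (h v) else \<zero>)"
      using orthonormal_mult_sum[OF f fin(2) U(1), of "h v" k] v h by auto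
    finally show ?thesis by simp
  qed
  have "adj A (\<Oplus>w\<in>U. f w \<otimes> k w) \<otimes> (\<Oplus>v\<in>T. \<kappa> v \<odot> (f (h v) \<otimes> adj A (f v)))
     = (\<Oplus>v\<in>T. adj A (\<Oplus>w\<in>U. f w \<otimes> k w) \<otimes> (\<kappa> v \<odot> (f (h v) \<otimes> adj A (f v))))"
    using fin Cc by (intro finsum_rdistr) auto
  also have "\<dots> = (\<Oplus>v\<in>T. if v \<in> U' then c \<odot> (g \<otimes> (adj A (k v) \<otimes> adj A (f v))) else \<zero>)"
  proof (rule finsum_cong')
    fix v assume v: "v \<in> T"
    have "adj A (\<Oplus>w\<in>U. f w \<otimes> k w) \<otimes> (\<kappa> v \<odot> (f (h v) \<otimes> adj A (f v)))
      = \<kappa> v \<odot> (adj A (\<Oplus>w\<in>U. f w \<otimes> k w) \<otimes> f (h v) \<otimes> adj A (f v))"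
      using v Cc by (simp add: m_assoc)
    also have "\<dots> = (if v \<in> U' then \<kappa> v \<odot> adj A (k (h v)) \<otimes> adj A (f v) else \<zero>)"
      using v U by (simp add: fh)
    also have "\<dots> = (if v \<in> U' then c \<odot> (g \<otimes> (adj A (k v) \<otimes> adj A (f v))) else \<zero>)"
      using v g unfolding eq[OF v] by (simp add: m_assoc)
    finally show "adj A (\<Oplus>w\<in>U. f w \<otimes> k w) \<otimes> (\<kappa> v \<odot> (f (h v) \<otimes> adj A (f v)))
      = (if v \<in> U' then c \<odot> (g \<otimes> (adj A (k v) \<otimes> adj A (f v))) else \<zero>)" .
  qed (use g in auto)
  also have "\<dots> = (\<Oplus>v\<in>U'. if v \<in> U' then c \<odot> (g \<otimes> (adj A (k v) \<otimes> adj A (f v))) else \<zero>)"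
    using fin U'T g by (intro finsum_restrict) auto
  also have "\<dots> = (\<Oplus>v\<in>U'. c \<odot> (g \<otimes> adj A (f v \<otimes> k v)))"
    using U'T g by (intro finsum_cong') (auto simp: adj_mult subset_iff)
  also have "\<dots> = c \<odot> (\<Oplus>v\<in>U'. g \<otimes> adj A (f v \<otimes> k v))"
    using U'T g fin by (intro finsum_smult_ldistr[symmetric]) (auto simp: subset_iff)
  also have "(\<Oplus>v\<in>U'. g \<otimes> adj A (f v \<otimes> k v)) = g \<otimes> (\<Oplus>v\<in>U'. adj A (f v \<otimes> k v))"
    using U'T g fin by (intro finsum_rdistr[symmetric]) (auto simp: subset_iff)
  also have "(\<Oplus>v\<in>U'. adj A (f v \<otimes> k v)) = adj A (\<Oplus>v\<in>U'. f v \<otimes> k v)"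
    using U'T fin by (intro adj_finsum[symmetric]) (auto simp: subset_iff)
  finally show ?thesis .
qed

end

section \<open>The Fock basis and its truncated shifts\<close>

locale nondegenerate_twisted_isometries = twisted_isometries +
  assumes two_le_n: "2 \<le> n" and vacuum_nonzero: "vacuum \<noteq> \<zero>"
begin

subsection \<open>Labels\<close>

text \<open>
  The isometries \<open>s\<^sub>1\<^sup>k s\<^sub>2\<close> have mutually orthogonal ranges; they supply arbitrarily many labels.
\<close>

primrec iterated_label :: "nat \<Rightarrow> 'a" where
  "iterated_label 0 = s 2"
| "iterated_label (Suc k) = s 1 \<otimes> iterated_label k"

lemma one_two: "1 \<in> {1..n}" "2 \<in> {1..n}"
  using two_le_n by (auto simp: atLeastAtMost_iff)

lemma iterated_label_closed [simp]: "iterated_label k \<in> carrier A"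
  using one_two by (induction k) auto

lemma orthonormal_iterated_label: "orthonormal UNIV iterated_label"
proof -
  have eq: "adj A (iterated_label i) \<otimes> iterated_label j = (if i = j then \<one> else \<zero>)" for i j
  proof (induction i arbitrary: j)
    case 0
    show ?case
    proof (cases j)
      case 0 then show ?thesis using one_two adj_s_s[of 2 2] by simp
    next
      case (Suc k)
      have "adj A (s 2) \<otimes> (s 1 \<otimes> iterated_label k) = adj A (s 2) \<otimes> s 1 \<otimes> iterated_label k"
        using one_two by (simp add: m_assoc)
      then show ?thesis using Suc one_two adj_s_s[of 2 1] by simp
    qed
  next
    case (Suc i)
    have [simp]: "s 1 \<in> carrier A" "s 2 \<in> carrier A" using one_two by auto
    have adj_Suc: "adj A (iterated_label (Suc i)) \<otimes> (s k \<otimes> y) = adj A (iterated_label i) \<otimes> ((adj A (s 1) \<otimes> s k) \<otimes> y)"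
      if "k \<in> {1..n}" "y \<in> carrier A" for k y
      using that by (simp add: adj_mult m_assoc)
    show ?case
    proof (cases j)
      case 0
      have "adj A (iterated_label (Suc i)) \<otimes> (s 2 \<otimes> \<one>) = \<zero>"
        unfolding adj_Suc[OF one_two(2) one_closed] adj_s_s[OF one_two] by simp
      then show ?thesis unfolding 0 by simp
    next
      case (Suc k)
      have "adj A (iterated_label (Suc i)) \<otimes> (s 1 \<otimes> iterated_label k) = adj A (iterated_label i) \<otimes> iterated_label k"
        unfolding adj_Suc[OF one_two(1) iterated_label_closed] adj_s_s[OF one_two(1,1)] by simp
      then show ?thesis unfolding Suc using Suc.IH[of k] by simp
    qed
  qed
  show ?thesis by (simp add: orthonormal_def eq)
qed

definition label :: "nat list \<times> nat list \<Rightarrow> 'a" where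
  "label w = iterated_label (to_nat w)"

lemma label_closed [simp]: "label w \<in> carrier A" by (simp add: label_def)

lemma orthonormal_label: "orthonormal S label"
  using orthonormal_iterated_label by (auto simp: orthonormal_def label_def)

subsection \<open>The Fock basis\<close>

text \<open>
  The elements \<open>x\<^sub>w\<close> of the introduction. In a Fock representation they send the vacuum vector to an
  orthonormal basis.
\<close>

definition fock_word :: "nat list \<times> nat list \<Rightarrow> 'a" where
  "fock_word w = word s (fst w) \<otimes> word t (snd w)"

definition box :: "nat \<Rightarrow> nat \<Rightarrow> (nat list \<times> nat list) set" where
  "box a b = words {1..n} a \<times> words {1..m} b"

lemma finite_box [simp]: "finite (box a b)" by (simp add: box_def)

lemma word_s_closed [simp]: "set u \<subseteq> {1..n} \<Longrightarrow> word s u \<in> carrier A"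
  and word_t_closed [simp]: "set u \<subseteq> {1..m} \<Longrightarrow> word t u \<in> carrier A"
  using word_closed[of s "{1..n}" u] word_closed[of t "{1..m}" u] by auto

lemma fock_word_closed [simp]: "w \<in> box a b \<Longrightarrow> fock_word w \<in> carrier A"
  by (auto simp: fock_word_def box_def words_def)

lemma adj_word_t_s:
  assumes "i \<in> {1..n}" "set v \<subseteq> {1..m}"
  shows "adj A (word t v) \<otimes> s i = cnj q ^ length v \<odot> (s i \<otimes> adj A (word t v))"
  using assms(2)
proof (induction v)
  case (Cons r v)
  have r: "r \<in> {1..m}" and v: "set v \<subseteq> {1..m}" using Cons by auto
  have "adj A (word t (r # v)) \<otimes> s i = adj A (word t v) \<otimes> (adj A (t r) \<otimes> s i)"
    using assms r v by (simp add: adj_mult m_assoc)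
  also have "\<dots> = cnj q \<odot> (adj A (word t v) \<otimes> s i \<otimes> adj A (t r))"
    using assms r v by (simp add: adj_t_s m_assoc)
  also have "\<dots> = cnj q ^ length (r # v) \<odot> (s i \<otimes> adj A (word t (r # v)))"
    unfolding Cons.IH[OF v] using assms r v by (simp add: adj_mult m_assoc)
  finally show ?case .
qed (use assms in simp)

lemma adj_word_s_t:
  assumes "r \<in> {1..m}" "set u \<subseteq> {1..n}"
  shows "adj A (word s u) \<otimes> t r = q ^ length u \<odot> (t r \<otimes> adj A (word s u))"
  using assms(2)
proof (induction u)
  case (Cons i u)
  have i: "i \<in> {1..n}" and u: "set u \<subseteq> {1..n}" using Cons by auto
  have "adj A (word s (i # u)) \<otimes> t r = adj A (word s u) \<otimes> (adj A (s i) \<otimes> t r)"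
    using assms i u by (simp add: adj_mult m_assoc)
  also have "\<dots> = q \<odot> (adj A (word s u) \<otimes> t r \<otimes> adj A (s i))"
    using assms i u by (simp add: adj_s_t m_assoc)
  also have "\<dots> = q ^ length (i # u) \<odot> (t r \<otimes> adj A (word s (i # u)))"
    unfolding Cons.IH[OF u] using assms i u by (simp add: adj_mult m_assoc)
  finally show ?case .
qed (use assms in simp)

lemma t_word_s:
  assumes "r \<in> {1..m}" "set u \<subseteq> {1..n}"
  shows "t r \<otimes> word s u = q ^ length u \<odot> (word s u \<otimes> t r)"
  using assms(2)
proof (induction u)
  case (Cons i u)
  have i: "i \<in> {1..n}" and u: "set u \<subseteq> {1..n}" using Cons by auto
  have "t r \<otimes> word s (i # u) = q \<odot> (s i \<otimes> (t r \<otimes> word s u))"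
    using assms i u by (simp add: order_pairs_assoc)
  also have "\<dots> = q ^ length (i # u) \<odot> (word s (i # u) \<otimes> t r)"
    unfolding Cons.IH[OF u] using assms i u by (simp add: m_assoc)
  finally show ?case .
qed (use assms in simp)

lemma vacuum_mult_assoc [simp]:
  assumes "z \<in> carrier A"
  shows "i \<in> {1..n} \<Longrightarrow> vacuum \<otimes> (s i \<otimes> z) = \<zero>" "r \<in> {1..m} \<Longrightarrow> vacuum \<otimes> (t r \<otimes> z) = \<zero>"
  using assms by (simp_all flip: m_assoc)

definition bra :: "nat list \<times> nat list \<Rightarrow> 'a" where
  "bra w = vacuum \<otimes> adj A (fock_word w)"

lemma bra_eq: "set u \<subseteq> {1..n} \<Longrightarrow> set v \<subseteq> {1..m} \<Longrightarrow>
    bra (u, v) = vacuum \<otimes> (adj A (word t v) \<otimes> adj A (word s u))"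
  by (simp add: bra_def fock_word_def adj_mult)

lemma bra_closed [simp]: "w \<in> box a b \<Longrightarrow> bra w \<in> carrier A"
  by (simp add: bra_def)

lemma bra_closed' [simp]: "set u \<subseteq> {1..n} \<Longrightarrow> set v \<subseteq> {1..m} \<Longrightarrow> bra (u, v) \<in> carrier A"
  by (simp add: bra_eq)

lemma bra_Nil_s:
  assumes i: "i \<in> {1..n}" and v: "set v \<subseteq> {1..m}" shows "bra ([], v) \<otimes> s i = \<zero>"
proof -
  have "bra ([], v) \<otimes> s i = vacuum \<otimes> (adj A (word t v) \<otimes> s i)"
    using i v by (simp add: bra_eq m_assoc)
  also have "\<dots> = cnj q ^ length v \<odot> (vacuum \<otimes> s i \<otimes> adj A (word t v))"
    unfolding adj_word_t_s[OF i v] using i v by (simp add: m_assoc)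
  finally show ?thesis using i v by simp
qed

lemma bra_Cons_s:
  assumes i: "i \<in> {1..n}" "j \<in> {1..n}" and u: "set u \<subseteq> {1..n}" and v: "set v \<subseteq> {1..m}"
  shows "bra (j # u, v) \<otimes> s i = (if i = j then bra (u, v) else \<zero>)"
proof -
  have "bra (j # u, v) \<otimes> s i = vacuum \<otimes> (adj A (word t v) \<otimes> (adj A (word s u) \<otimes> (adj A (s j) \<otimes> s i)))"
    using i u v by (simp add: bra_eq adj_mult m_assoc)
  then show ?thesis using i u v by (simp add: adj_s_s bra_eq)
qed

lemma bra_Nil_t:
  assumes r: "r \<in> {1..m}" and u: "set u \<subseteq> {1..n}" shows "bra (u, []) \<otimes> t r = \<zero>"
proof -
  have "bra (u, []) \<otimes> t r = vacuum \<otimes> (adj A (word s u) \<otimes> t r)"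
    using r u by (simp add: bra_eq m_assoc)
  also have "\<dots> = q ^ length u \<odot> (vacuum \<otimes> t r \<otimes> adj A (word s u))"
    unfolding adj_word_s_t[OF r u] using r u by (simp add: m_assoc)
  finally show ?thesis using r u by simp
qed

lemma bra_Cons_t:
  assumes r: "r \<in> {1..m}" "l \<in> {1..m}" and u: "set u \<subseteq> {1..n}" and v: "set v \<subseteq> {1..m}"
  shows "bra (u, l # v) \<otimes> t r = (if r = l then q ^ length u \<odot> bra (u, v) else \<zero>)"
proof -
  have "bra (u, l # v) \<otimes> t r = vacuum \<otimes> (adj A (word t v) \<otimes> (adj A (t l) \<otimes> (adj A (word s u) \<otimes> t r)))"
    using r u v by (simp add: bra_eq adj_mult m_assoc)
  also have "\<dots> = q ^ length u \<odot> (vacuum \<otimes> (adj A (word t v) \<otimes> (adj A (t l) \<otimes> t r \<otimes> adj A (word s u))))"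
    unfolding adj_word_s_t[OF r(1) u] using r u v by (simp add: m_assoc)
  finally show ?thesis using r u v by (simp add: adj_t_t bra_eq)
qed

lemma bra_vacuum:
  assumes u: "set u \<subseteq> {1..n}" and v: "set v \<subseteq> {1..m}"
  shows "bra (u, v) \<otimes> vacuum = (if u = [] \<and> v = [] then vacuum else \<zero>)"
proof -
  have "bra (u, v) \<otimes> vacuum = vacuum \<otimes> adj A (vacuum \<otimes> fock_word (u, v))"
    using u v by (simp add: bra_def fock_word_def adj_mult m_assoc)
  also have "vacuum \<otimes> fock_word (u, v) = (if u = [] \<and> v = [] then vacuum else \<zero>)"
  proof (cases u)
    case (Cons i u')
    then have "vacuum \<otimes> fock_word (u, v) = vacuum \<otimes> s i \<otimes> (word s u' \<otimes> word t v)"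
      using u v by (simp add: fock_word_def m_assoc)
    then show ?thesis using Cons u v by simp
  next
    case Nil
    show ?thesis
    proof (cases v)
      case (Cons r v')
      then have "vacuum \<otimes> fock_word (u, v) = vacuum \<otimes> t r \<otimes> word t v'"
        using \<open>u = []\<close> u v by (simp add: fock_word_def m_assoc)
      then show ?thesis using Cons u v by simp
    qed (use Nil in \<open>simp add: fock_word_def\<close>)
  qed
  finally show ?thesis by simp
qed

lemma bra_word_t_vacuum:
  assumes "set u \<subseteq> {1..n}" "set v \<subseteq> {1..m}" "set v' \<subseteq> {1..m}"
  shows "bra (u, v) \<otimes> (word t v' \<otimes> vacuum) = (if u = [] \<and> v = v' then vacuum else \<zero>)"
  using assms(2,3)
proof (induction v' arbitrary: v)
  case Nil then show ?case using assms(1) by (simp add: bra_vacuum)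
next
  case (Cons r v')
  have r: "r \<in> {1..m}" and v': "set v' \<subseteq> {1..m}" using Cons by auto
  have eq: "bra (u, v) \<otimes> (word t (r # v') \<otimes> vacuum) = bra (u, v) \<otimes> t r \<otimes> (word t v' \<otimes> vacuum)"
    using assms(1) Cons.prems r v' by (simp add: m_assoc)
  show ?case
  proof (cases v)
    case Nil
    then show ?thesis using eq bra_Nil_t[OF r assms(1)] v' by simp
  next
    case (Cons l v0)
    have l: "l \<in> {1..m}" "set v0 \<subseteq> {1..m}" using \<open>set v \<subseteq> _\<close> Cons by auto
    show ?thesis
      unfolding eq unfolding Cons bra_Cons_t[OF r l(1) assms(1) l(2)]
      using assms(1) Cons.IH[OF l(2) v'] l v' by auto
  qed
qed

text \<open>
  Orthogonality of the Fock basis. The letters of the right-hand word are absorbed one by one, first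
  the \<open>s\<close> and then the \<open>t\<close>. The phase from \<open>bra_Cons_t\<close> does not survive, since a nonzero
  value requires that no \<open>s\<close> is left when the \<open>t\<close> are absorbed.
\<close>

lemma bra_ket:
  assumes "set u \<subseteq> {1..n}" "set v \<subseteq> {1..m}" "set u' \<subseteq> {1..n}" "set v' \<subseteq> {1..m}"
  shows "bra (u, v) \<otimes> (word s u' \<otimes> (word t v' \<otimes> vacuum)) = (if u = u' \<and> v = v' then vacuum else \<zero>)"
  using assms(1,3)
proof (induction u' arbitrary: u)
  case Nil then show ?case using assms(2,4) by (simp add: bra_word_t_vacuum)
next
  case (Cons i u')
  have i: "i \<in> {1..n}" and u': "set u' \<subseteq> {1..n}" using Cons by auto
  have eq: "bra (u, v) \<otimes> (word s (i # u') \<otimes> (word t v' \<otimes> vacuum))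
     = bra (u, v) \<otimes> s i \<otimes> (word s u' \<otimes> (word t v' \<otimes> vacuum))"
    using assms(2,4) Cons.prems i u' by (simp add: m_assoc)
  show ?case
  proof (cases u)
    case Nil
    then show ?thesis using eq bra_Nil_s[OF i assms(2)] u' assms(4) by simp
  next
    case (Cons l u0)
    have l: "l \<in> {1..n}" "set u0 \<subseteq> {1..n}" using \<open>set u \<subseteq> _\<close> Cons by auto
    show ?thesis
      unfolding eq unfolding Cons bra_Cons_s[OF i l(1) l(2) assms(2)]
      using assms(2,4) Cons.IH[OF l(2) u'] l u' by auto
  qed
qed

lemma bra_mult_adj_bra:
  assumes w: "w \<in> box a b" "w' \<in> box a b"
  shows "bra w \<otimes> adj A (bra w') = (if w = w' then vacuum else \<zero>)"
proof -
  obtain u v u' v' where uv: "w = (u, v)" "w' = (u', v')" by (cases w; cases w')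
  then have m: "set u \<subseteq> {1..n}" "set v \<subseteq> {1..m}" "set u' \<subseteq> {1..n}" "set v' \<subseteq> {1..m}"
    using w by (auto simp: box_def words_def)
  have "adj A (bra w') = word s u' \<otimes> (word t v' \<otimes> vacuum)"
    using m by (simp add: uv bra_eq adj_mult m_assoc)
  then show ?thesis using bra_ket[OF m] uv by simp
qed

subsection \<open>Truncated shifts\<close>

lemma label_family: "orthonormal_family A label (box N N') vacuum"
  by unfold_locales (auto intro: orthonormal_label projection_vacuum)

text \<open>
  The partial isometry \<open>V\<close> of the introduction.
\<close>

definition fock_map :: "nat \<Rightarrow> 'a" where
  "fock_map N = (\<Oplus>w\<in>box N N. label w \<otimes> bra w)"

definition prepend :: "nat + nat \<Rightarrow> nat list \<times> nat list \<Rightarrow> nat list \<times> nat list" where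
  "prepend a w = (case a of Inl i \<Rightarrow> (i # fst w, snd w) | Inr r \<Rightarrow> (fst w, r # snd w))"

text \<open>
  Prepending \<open>t\<^sub>r\<close> to \<open>s\<^sub>\<mu> t\<^sub>\<nu>\<close> in normal order moves it past \<open>s\<^sub>\<mu>\<close>.
\<close>

definition phase :: "nat + nat \<Rightarrow> nat list \<times> nat list \<Rightarrow> complex" where
  "phase a w = (case a of Inl i \<Rightarrow> 1 | Inr r \<Rightarrow> q ^ length (fst w))"

text \<open>
  The pairs of words that remain in the box after the letter is prepended. For \<open>k = 0\<close> or \<open>l = 0\<close> the
  truncated subtraction is correct, as the box is then empty.
\<close>

definition sub_box :: "nat + nat \<Rightarrow> nat \<Rightarrow> nat \<Rightarrow> (nat list \<times> nat list) set" where
  "sub_box a k l = (case a of Inl i \<Rightarrow> box (k - 1) l | Inr r \<Rightarrow> box k (l - 1))"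

definition shift :: "nat \<Rightarrow> nat + nat \<Rightarrow> 'a" where
  "shift N a = (\<Oplus>v\<in>sub_box a N N. phase a v \<odot> (label (prepend a v) \<otimes> adj A (label v)))"

lemma box_mono: "a \<le> a' \<Longrightarrow> b \<le> b' \<Longrightarrow> box a b \<subseteq> box a' b'"
  by (auto simp: box_def words_def)

lemma sub_box_subset: "sub_box a k l \<subseteq> box k l"
  by (auto simp: sub_box_def box_def words_def split: sum.splits)

lemma prepend_sub_box: "a \<in> letters \<Longrightarrow> prepend a ` sub_box a k l \<subseteq> box k l"
  by (auto simp: letters_def sub_box_def prepend_def box_def words_def)

lemma prepend_in_box_iff:
  assumes "a \<in> letters" "v \<in> box N N'"
  shows "prepend a v \<in> box k l \<longleftrightarrow> v \<in> sub_box a k l"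
  using assms by (auto simp: letters_def sub_box_def prepend_def box_def words_def)

lemma inj_prepend: "inj_on (prepend a) V"
  by (auto simp: inj_on_def prepend_def prod_eq_iff split: sum.splits)

lemma bra_prepend:
  assumes "a \<in> letters" "v \<in> sub_box a N N"
  shows "bra (prepend a v) \<otimes> gen a = phase a v \<odot> bra v"
proof -
  have v: "set (fst v) \<subseteq> {1..n}" "set (snd v) \<subseteq> {1..m}"
    using assms(2) by (auto simp: sub_box_def box_def words_def split: sum.splits)
  have [simp]: "bra v \<in> carrier A" using v bra_closed'[of "fst v" "snd v"] by simp
  from assms(1) consider i where "a = Inl i" "i \<in> {1..n}" | r where "a = Inr r" "r \<in> {1..m}"
    by (auto simp: letters_def)
  then show ?thesis
    by cases (use v in \<open>simp_all add: prepend_def phase_def bra_Cons_s bra_Cons_t\<close>)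
qed

lemma bra_not_prepend:
  assumes a: "a \<in> letters" and w: "w \<in> box N N - prepend a ` sub_box a N N"
  shows "bra w \<otimes> gen a = \<zero>"
proof -
  obtain u v where uv: "w = (u, v)" by (cases w)
  have m: "set u \<subseteq> {1..n}" "set v \<subseteq> {1..m}" and l: "length u < N" "length v < N"
    using w uv by (auto simp: box_def words_def)
  from a consider i where "a = Inl i" "i \<in> {1..n}" | r where "a = Inr r" "r \<in> {1..m}"
    by (auto simp: letters_def)
  then show ?thesis
  proof cases
    case 1
    show ?thesis
    proof (cases u)
      case Nil then show ?thesis using 1 m uv by (simp add: bra_Nil_s)
    next
      case (Cons j u')
      have j: "j \<in> {1..n}" "set u' \<subseteq> {1..n}" using Cons m by auto
      have "j \<noteq> i"
      proof
        assume "j = i"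
        then have "w = prepend a (u', v)" "(u', v) \<in> sub_box a N N"
          using Cons uv 1 m l by (auto simp: prepend_def sub_box_def box_def words_def)
        then show False using w by blast
      qed
      then show ?thesis using 1 uv Cons bra_Cons_s[OF 1(2) j m(2)] by simp
    qed
  next
    case 2
    show ?thesis
    proof (cases v)
      case Nil then show ?thesis using 2 m uv by (simp add: bra_Nil_t)
    next
      case (Cons j v')
      have j: "j \<in> {1..m}" "set v' \<subseteq> {1..m}" using Cons m by auto
      have "j \<noteq> r"
      proof
        assume "j = r"
        then have "w = prepend a (u, v')" "(u, v') \<in> sub_box a N N"
          using Cons uv 2 m l by (auto simp: prepend_def sub_box_def box_def words_def)
        then show False using w by blast
      qed
      then show ?thesis using 2 uv Cons bra_Cons_t[OF 2(2) j(1) m(1) j(2)] by simp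
    qed
  qed
qed

lemma shift_intertwines_gen:
  assumes a: "a \<in> letters"
  shows "fock_map N \<otimes> gen a = shift N a \<otimes> fock_map N"
  unfolding fock_map_def shift_def
  by (rule orthonormal_family.shift_intertwines[OF label_family])
    (use a bra_prepend bra_not_prepend sub_box_subset prepend_sub_box inj_prepend in auto)

end

context nondegenerate_twisted_isometries
begin

subsection \<open>The truncated Fock matrix\<close>

lemma fock_map_closed [simp]: "fock_map N \<in> carrier A"
  unfolding fock_map_def by (intro finsum_closed) auto

lemma label_range_closed [simp]: "y \<in> carrier A \<Longrightarrow> range_sum label J y \<in> carrier A"
  by (rule range_sum_closed) auto

lemma adj_fock_map: "adj A (fock_map N) = (\<Oplus>w\<in>box N N. adj A (bra w) \<otimes> adj A (label w))"
proof -
  have "adj A (fock_map N) = (\<Oplus>w\<in>box N N. adj A (label w \<otimes> bra w))"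
    unfolding fock_map_def by (rule adj_finsum) auto
  also have "\<dots> = (\<Oplus>w\<in>box N N. adj A (bra w) \<otimes> adj A (label w))"
    by (intro finsum_cong') (auto simp: adj_mult)
  finally show ?thesis .
qed

lemma bra_mult_adj_fock_map:
  assumes y: "y \<in> carrier A"
    and z: "\<And>w'. w' \<in> box N N \<Longrightarrow> y \<otimes> adj A (bra w') = (if w = w' then c else \<zero>)"
    and c: "c \<in> carrier A" and w: "w \<in> box N N"
  shows "y \<otimes> adj A (fock_map N) = c \<otimes> adj A (label w)"
proof -
  have "y \<otimes> adj A (fock_map N) = (\<Oplus>w'\<in>box N N. y \<otimes> (adj A (bra w') \<otimes> adj A (label w')))"
    unfolding adj_fock_map using y by (intro finsum_rdistr) auto
  also have "\<dots> = (\<Oplus>w'\<in>box N N. if w = w' then c \<otimes> adj A (label w) else \<zero>)"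
  proof (rule finsum_cong')
    fix w' assume w': "w' \<in> box N N"
    have "y \<otimes> (adj A (bra w') \<otimes> adj A (label w')) = y \<otimes> adj A (bra w') \<otimes> adj A (label w')"
      using y w' by (subst m_assoc) auto
    then show "y \<otimes> (adj A (bra w') \<otimes> adj A (label w')) = (if w = w' then c \<otimes> adj A (label w) else \<zero>)"
      using z[OF w'] by simp
  qed (use c in auto)
  also have "\<dots> = c \<otimes> adj A (label w)" using w c by (simp add: finsum_delta)
  finally show ?thesis .
qed

lemma fock_map_mult_adj: "fock_map N \<otimes> adj A (fock_map N) = range_sum label (box N N) vacuum"
proof -
  have "fock_map N \<otimes> adj A (fock_map N) = (\<Oplus>w\<in>box N N. label w \<otimes> bra w \<otimes> adj A (fock_map N))"
    unfolding fock_map_def[of N] by (rule finsum_ldistr) (auto simp flip: fock_map_def)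
  also have "\<dots> = range_sum label (box N N) vacuum"
    unfolding range_sum_def
  proof (rule finsum_cong')
    fix w assume w: "w \<in> box N N"
    have "label w \<otimes> bra w \<otimes> adj A (fock_map N) = label w \<otimes> (bra w \<otimes> adj A (fock_map N))"
      using w by (intro m_assoc) auto
    also have "bra w \<otimes> adj A (fock_map N) = vacuum \<otimes> adj A (label w)"
      using w by (intro bra_mult_adj_fock_map) (auto simp: bra_mult_adj_bra)
    finally show "label w \<otimes> bra w \<otimes> adj A (fock_map N) = label w \<otimes> (vacuum \<otimes> adj A (label w))" .
  qed auto
  finally show ?thesis .
qed

lemma nrm_fock_map: "nrm A (fock_map N) \<le> 1"
proof -
  have "projection (range_sum label (box N N) vacuum)"
    by (rule range_sum_projection[OF orthonormal_label finite_box projection_vacuum])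
  then have "nrm A (adj A (fock_map N)) \<le> 1"
    by (intro nrm_le_one_of_adj_mult_projection) (simp_all add: fock_map_mult_adj)
  then show ?thesis by simp
qed

text \<open>
  The element \<open>V a V\<^sup>*\<close> is the matrix of the \<open>Q x\<^sub>w\<^sup>* a x\<^bsub>w'\<^esub> Q\<close> coded by the labels.
\<close>

lemma fock_map_compression_zero:
  assumes a: "a \<in> carrier A"
    and z: "\<And>w w'. w \<in> box N N \<Longrightarrow> w' \<in> box N N \<Longrightarrow> bra w \<otimes> a \<otimes> adj A (bra w') = \<zero>"
  shows "fock_map N \<otimes> a \<otimes> adj A (fock_map N) = \<zero>"
proof -
  have "fock_map N \<otimes> a \<otimes> adj A (fock_map N) = fock_map N \<otimes> (a \<otimes> adj A (fock_map N))"
    using a by (simp add: m_assoc)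
  also have "\<dots> = (\<Oplus>w\<in>box N N. label w \<otimes> bra w \<otimes> (a \<otimes> adj A (fock_map N)))"
    unfolding fock_map_def[of N] using a by (intro finsum_ldistr) (auto simp flip: fock_map_def)
  also have "\<dots> = (\<Oplus>w\<in>box N N. \<zero>)"
  proof (rule finsum_cong')
    fix w assume w: "w \<in> box N N"
    have "label w \<otimes> bra w \<otimes> (a \<otimes> adj A (fock_map N)) = label w \<otimes> (bra w \<otimes> a \<otimes> adj A (fock_map N))"
      using w a by (simp add: m_assoc)
    also have "bra w \<otimes> a \<otimes> adj A (fock_map N) = \<zero> \<otimes> adj A (label w)"
      using w a by (intro bra_mult_adj_fock_map) (auto simp: z)
    finally show "label w \<otimes> bra w \<otimes> (a \<otimes> adj A (fock_map N)) = \<zero>" by simp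
  qed auto
  finally show ?thesis by (simp add: finsum_zero)
qed

text \<open>
  The empty word is represented by the unit of the algebra of scalar matrices.
\<close>

fun shift_word :: "nat \<Rightarrow> (nat + nat) list \<Rightarrow> 'a" where
  "shift_word N [] = range_sum label (box N N) \<one>"
| "shift_word N (a # u) = shift N a \<otimes> shift_word N u"

lemma scalar_matrix_shift: "a \<in> letters \<Longrightarrow> scalar_matrix label (box N N) vacuum (shift N a)"
  unfolding shift_def
  using sub_box_subset[of a N N] prepend_sub_box[of a N N] finite_subset[OF sub_box_subset finite_box]
  by (intro orthonormal_family.scalar_matrix_finsum[OF label_family]
      orthonormal_family.scalar_matrix_scal[OF label_family]
      orthonormal_family.scalar_matrix_unit[OF label_family]) auto

lemma scalar_matrix_one: "scalar_matrix label (box N N) vacuum (range_sum label (box N N) \<one>)"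
  unfolding range_sum_def
  by (intro orthonormal_family.scalar_matrix_finsum[OF label_family]) 
    (auto intro: orthonormal_family.scalar_matrix_unit[OF label_family])

lemma scalar_matrix_shift_word:
  "set u \<subseteq> letters \<Longrightarrow> scalar_matrix label (box N N) vacuum (shift_word N u)"
  by (induction u)
    (auto intro: scalar_matrix_one orthonormal_family.scalar_matrix_mult[OF label_family] scalar_matrix_shift)

lemma shift_closed [simp]: "a \<in> letters \<Longrightarrow> shift N a \<in> carrier A"
  using scalar_matrix_shift[of a N] by (simp add: scalar_matrix_def)

lemma shift_word_closed [simp]: "set u \<subseteq> letters \<Longrightarrow> shift_word N u \<in> carrier A"
  using scalar_matrix_shift_word[of u N] by (simp add: scalar_matrix_def)

lemma label_projection_fock_map: "range_sum label (box N N) \<one> \<otimes> fock_map N = fock_map N"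
proof -
  have "range_sum label (box N N) \<one> \<otimes> fock_map N
      = (\<Oplus>v\<in>box N N. label v \<otimes> (\<one> \<otimes> (adj A (label v) \<otimes> fock_map N)))"
    by (rule range_sum_mult_left) auto
  also have "\<dots> = (\<Oplus>v\<in>box N N. label v \<otimes> bra v)"
  proof (rule finsum_cong')
    fix v assume v: "v \<in> box N N"
    have "adj A (label v) \<otimes> fock_map N = bra v"
      using orthonormal_mult_sum[OF orthonormal_label[of "box N N"] finite_box subset_refl v, of bra] v
      by (simp add: fock_map_def)
    then show "label v \<otimes> (\<one> \<otimes> (adj A (label v) \<otimes> fock_map N)) = label v \<otimes> bra v" using v by simp
  qed auto
  finally show ?thesis by (simp add: fock_map_def)
qed

lemma fock_map_word:
  "set u \<subseteq> letters \<Longrightarrow> fock_map N \<otimes> word gen u = shift_word N u \<otimes> fock_map N"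
proof (induction u)
  case Nil then show ?case by (simp add: label_projection_fock_map)
next
  case (Cons a u)
  then have au: "a \<in> letters" "set u \<subseteq> letters" by auto
  have "fock_map N \<otimes> word gen (a # u) = fock_map N \<otimes> gen a \<otimes> word gen u"
    using au by (simp add: m_assoc)
  also have "\<dots> = shift N a \<otimes> (fock_map N \<otimes> word gen u)"
    using au by (simp add: shift_intertwines_gen m_assoc)
  also have "\<dots> = shift_word N (a # u) \<otimes> fock_map N"
    using au Cons.IH by (simp add: m_assoc)
  finally show ?case .
qed

definition word_matrix :: "nat \<Rightarrow> (nat + nat) list \<Rightarrow> (nat + nat) list \<Rightarrow> 'a" where
  "word_matrix N u v = shift_word N u \<otimes> adj A (shift_word N v)"

lemma scalar_matrix_word_matrix:
  "set u \<subseteq> letters \<Longrightarrow> set v \<subseteq> letters \<Longrightarrow> scalar_matrix label (box N N) vacuum (word_matrix N u v)"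
  unfolding word_matrix_def
  by (intro orthonormal_family.scalar_matrix_mult[OF label_family]
      orthonormal_family.scalar_matrix_adj[OF label_family] scalar_matrix_shift_word)

text \<open>
  Intertwining on both sides gives \<open>V x\<^sub>u x\<^sub>v\<^sup>* V\<^sup>* = L\<^sub>u (V V\<^sup>*) L\<^sub>v\<^sup>*\<close>, and \<open>V V\<^sup>*\<close> commutes with scalar
  matrices.
\<close>

lemma fock_map_word_matrix:
  assumes u: "set u \<subseteq> letters" and v: "set v \<subseteq> letters"
  shows "fock_map N \<otimes> (word gen u \<otimes> adj A (word gen v)) \<otimes> adj A (fock_map N)
      = word_matrix N u v \<otimes> range_sum label (box N N) vacuum"
proof -
  let ?G = "range_sum label (box N N) vacuum"
  have "fock_map N \<otimes> (word gen u \<otimes> adj A (word gen v)) \<otimes> adj A (fock_map N)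
     = fock_map N \<otimes> word gen u \<otimes> adj A (fock_map N \<otimes> word gen v)"
    using u v by (simp add: adj_mult m_assoc)
  also have "\<dots> = shift_word N u \<otimes> ((fock_map N \<otimes> adj A (fock_map N)) \<otimes> adj A (shift_word N v))"
    using u v by (simp add: fock_map_word adj_mult m_assoc)
  also have "\<dots> = shift_word N u \<otimes> (?G \<otimes> adj A (shift_word N v))"
    by (simp add: fock_map_mult_adj)
  also have "?G \<otimes> adj A (shift_word N v) = adj A (shift_word N v) \<otimes> ?G"
    using orthonormal_family.scalar_matrix_adj[OF label_family scalar_matrix_shift_word[OF v, of N]]
    by (simp add: scalar_matrix_def)
  finally show ?thesis using u v by (simp add: word_matrix_def m_assoc)
qed

end

section \<open>The Poisson kernel\<close>

locale poisson_kernel = nondegenerate_twisted_isometries +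
  fixes \<rho> :: real
  assumes rho: "0 \<le> \<rho>" "\<rho> < 1"
begin

text \<open>
  The number \<open>1 - \<surd>(1 - \<rho>\<^sup>2)\<close> makes \<open>1 - damping P\<close> the square root of \<open>1 - \<rho>\<^sup>2 P\<close> for every
  projection \<open>P\<close>.
\<close>

definition damping :: complex where "damping = complex_of_real (1 - sqrt (1 - \<rho>\<^sup>2))"
definition damp_s :: 'a where "damp_s = \<one> \<ominus> damping \<odot> range_s_power 1"
definition damp_t :: 'a where "damp_t = \<one> \<ominus> damping \<odot> range_t_power 1"

lemma damp_closed [simp]: "damp_s \<in> carrier A" "damp_t \<in> carrier A"
  by (simp_all add: damp_s_def damp_t_def)

lemma adj_damp [simp]: "adj A damp_s = damp_s" "adj A damp_t = damp_t"
  by (simp_all add: damp_s_def damp_t_def damping_def adj_diff adj_smult)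

lemma square_one_minus_scal:
  assumes p: "projection p"
  shows "(\<one> \<ominus> damping \<odot> p) \<otimes> (\<one> \<ominus> damping \<odot> p) = \<one> \<ominus> complex_of_real (\<rho>\<^sup>2) \<odot> p"
proof -
  note [simp] = projectionD[OF p]
  have "\<rho>\<^sup>2 \<le> 1" using rho by (simp add: power_le_one)
  define d where "d = sqrt (1 - \<rho>\<^sup>2)"
  have "d * d = 1 - \<rho>\<^sup>2" using \<open>\<rho>\<^sup>2 \<le> 1\<close> by (simp add: d_def)
  then have "(1 - d) * (1 - d) - (1 - d) - (1 - d) = - (\<rho>\<^sup>2)" by (simp add: algebra_simps)
  then have eq: "damping * damping - damping - damping = - complex_of_real (\<rho>\<^sup>2)"
    unfolding damping_def d_def[symmetric] by (metis of_real_diff of_real_mult of_real_minus)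
  have "(\<one> \<ominus> damping \<odot> p) \<otimes> (\<one> \<ominus> damping \<odot> p) 
     = (\<one> \<ominus> damping \<odot> p) \<ominus> (damping \<odot> p \<ominus> (damping * damping) \<odot> p)"
    by (simp add: mult_diff_left mult_diff_right scal_minus_right)
  also have "\<dots> = \<one> \<oplus> (damping * damping - damping - damping) \<odot> p"
  proof -
    have "(\<one> \<ominus> x) \<ominus> (x \<ominus> y) = \<one> \<oplus> (y \<ominus> x \<ominus> x)" if "x \<in> carrier A" "y \<in> carrier A" for x y
      using that by algebra
    then show ?thesis by (simp only: scal_diff scal_closed projectionD(1)[OF p])
  qed
  also have "\<dots> = \<one> \<ominus> complex_of_real (\<rho>\<^sup>2) \<odot> p"
    by (simp only: eq) (simp add: minus_eq scal_minus_left)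
  finally show ?thesis .
qed

lemma damp_s_commute_damp_t: "damp_s \<otimes> damp_t = damp_t \<otimes> damp_s"
  unfolding damp_s_def damp_t_def
  by (rule complements_commute) (simp_all add: range_powers_commute mult.commute)

definition gap_s :: 'a where "gap_s = \<one> \<ominus> complex_of_real (\<rho>\<^sup>2) \<odot> range_s_power 1"
definition gap_t :: 'a where "gap_t = \<one> \<ominus> complex_of_real (\<rho>\<^sup>2) \<odot> range_t_power 1"

lemma gap_closed [simp]: "gap_s \<in> carrier A" "gap_t \<in> carrier A"
  by (simp_all add: gap_s_def gap_t_def)

lemma damp_square: "damp_s \<otimes> damp_s = gap_s" "damp_t \<otimes> damp_t = gap_t"
  unfolding damp_s_def damp_t_def gap_s_def gap_t_def
  by (rule square_one_minus_scal, rule projection_range_powers)+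

lemma damp_product: "damp_s \<otimes> damp_t \<otimes> (damp_t \<otimes> damp_s) = gap_s \<otimes> gap_t"
proof -
  have "damp_s \<otimes> damp_t \<otimes> (damp_t \<otimes> damp_s) = damp_s \<otimes> damp_t \<otimes> (damp_s \<otimes> damp_t)"
    by (simp only: damp_s_commute_damp_t)
  also have "\<dots> = damp_s \<otimes> (damp_t \<otimes> damp_s) \<otimes> damp_t" by (simp add: m_assoc)
  also have "\<dots> = damp_s \<otimes> damp_s \<otimes> (damp_t \<otimes> damp_t)"
    by (simp add: m_assoc flip: damp_s_commute_damp_t)
  finally show ?thesis by (simp only: damp_square)
qed

definition weight :: "nat list \<times> nat list \<Rightarrow> complex" where
  "weight w = complex_of_real \<rho> ^ (length (fst w) + length (snd w))"

text \<open>
  The adjoint of \<open>kernel\<close> is \<open>\<rho>\<^bsup>|w|\<^esup> x\<^sub>w D\<close>, so prepending a generator to \<open>w\<close> multiplies it from the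
  left by \<open>\<rho>\<close> times the generator, while the products \<open>kernel\<^sup>* kernel\<close> contain
  \<open>D\<^sup>2 = (1 - \<rho>\<^sup>2 P)(1 - \<rho>\<^sup>2 P')\<close> and telescope.
\<close>

definition kernel :: "nat list \<times> nat list \<Rightarrow> 'a" where
  "kernel w = weight w \<odot> (damp_t \<otimes> damp_s \<otimes> adj A (fock_word w))"

lemma kernel_closed [simp]: "w \<in> box a b \<Longrightarrow> kernel w \<in> carrier A"
  by (simp add: kernel_def)

lemma adj_kernel:
  "w \<in> box a b \<Longrightarrow> adj A (kernel w) = weight w \<odot> (fock_word w \<otimes> (damp_s \<otimes> damp_t))"
  by (simp add: kernel_def adj_smult adj_mult m_assoc weight_def)

lemma adj_kernel_prepend:
  assumes a: "a \<in> letters" and v: "v \<in> sub_box a N N"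
  shows "phase a v \<odot> adj A (kernel (prepend a v)) = complex_of_real \<rho> \<odot> (gen a \<otimes> adj A (kernel v))"
proof -
  have vb: "v \<in> box N N" using v sub_box_subset by blast
  have pb: "prepend a v \<in> box N N" using prepend_sub_box[OF a, of N N] v by blast
  have m: "set (fst v) \<subseteq> {1..n}" "set (snd v) \<subseteq> {1..m}"
    using vb by (auto simp: box_def words_def)
  have fw: "phase a v \<odot> fock_word (prepend a v) = gen a \<otimes> fock_word v"
  proof -
    from a consider i where "a = Inl i" "i \<in> {1..n}" | r where "a = Inr r" "r \<in> {1..m}"
      by (auto simp: letters_def)
    then show ?thesis
    proof cases
      case 1 then show ?thesis using m by (simp add: fock_word_def prepend_def phase_def m_assoc)
    next
      case 2
      have "phase a v \<odot> fock_word (prepend a v) = (q ^ length (fst v) \<odot> (word s (fst v) \<otimes> t r)) \<otimes> word t (snd v)"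
        using 2 m by (simp add: fock_word_def prepend_def phase_def m_assoc)
      also have "\<dots> = gen a \<otimes> fock_word v"
        using 2 m by (simp add: fock_word_def m_assoc flip: t_word_s)
      finally show ?thesis .
    qed
  qed
  have w: "weight (prepend a v) = complex_of_real \<rho> * weight v"
    by (simp add: weight_def prepend_def split: sum.split)
  have "phase a v \<odot> adj A (kernel (prepend a v))
     = weight (prepend a v) \<odot> (phase a v \<odot> fock_word (prepend a v) \<otimes> (damp_s \<otimes> damp_t))"
    using pb by (simp add: adj_kernel mult.commute)
  also have "\<dots> = complex_of_real \<rho> \<odot> (gen a \<otimes> adj A (kernel v))"
    unfolding fw w using vb a by (simp add: adj_kernel m_assoc)
  finally show ?thesis .
qed

text \<open>
  The column \<open>c\<close> of the introduction; independent bounds for the two words are kept because shifts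
  shorten them separately.
\<close>

definition poisson :: "nat \<Rightarrow> nat \<Rightarrow> 'a" where
  "poisson a b = (\<Oplus>w\<in>box a b. label w \<otimes> kernel w)"

lemma poisson_closed [simp]: "poisson a b \<in> carrier A"
  unfolding poisson_def by (intro finsum_closed) auto

definition lower_s :: "nat + nat \<Rightarrow> nat \<Rightarrow> nat" where
  "lower_s a k = (case a of Inl i \<Rightarrow> k - 1 | Inr r \<Rightarrow> k)"
definition lower_t :: "nat + nat \<Rightarrow> nat \<Rightarrow> nat" where
  "lower_t a k = (case a of Inl i \<Rightarrow> k | Inr r \<Rightarrow> k - 1)"

lemma sub_box_eq: "sub_box a k l = box (lower_s a k) (lower_t a l)"
  by (simp add: sub_box_def lower_s_def lower_t_def split: sum.split)

lemma adj_poisson_shift: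
  assumes a: "a \<in> letters" and kl: "k \<le> N" "l \<le> N"
  shows "adj A (poisson k l) \<otimes> shift N a
    = complex_of_real \<rho> \<odot> (gen a \<otimes> adj A (poisson (lower_s a k) (lower_t a l)))"
  unfolding poisson_def shift_def
proof (rule orthonormal_family.adj_sum_mult_shift[OF label_family[of N N]])
  show "box (lower_s a k) (lower_t a l) = {v \<in> sub_box a N N. prepend a v \<in> box k l}"
  proof -
    have "sub_box a k l \<subseteq> sub_box a N N"
      unfolding sub_box_eq using kl 
      by (intro box_mono) (auto simp: lower_s_def lower_t_def split: sum.split)
    then show ?thesis
      using prepend_in_box_iff[OF a] sub_box_subset[of a N N]
      unfolding sub_box_eq[of a k l, symmetric] by blast
  qed
qed (use a kl sub_box_subset prepend_sub_box adj_kernel_prepend box_mono in auto)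

text \<open>
  How far the length bounds drop when the letters of a word are absorbed by \<open>adj_poisson_shift\<close>.
\<close>

fun cut_s :: "(nat + nat) list \<Rightarrow> nat \<Rightarrow> nat" where
  "cut_s [] k = k" | "cut_s (a # u) k = cut_s u (lower_s a k)"
fun cut_t :: "(nat + nat) list \<Rightarrow> nat \<Rightarrow> nat" where
  "cut_t [] k = k" | "cut_t (a # u) k = cut_t u (lower_t a k)"

lemma cut_ge: "k - length u \<le> cut_s u k" "k - length u \<le> cut_t u k"
proof (induction u arbitrary: k)
  case (Cons a u)
  { case 1 show ?case using Cons.IH(1)[of "lower_s a k"] by (auto simp: lower_s_def split: sum.splits) }
  { case 2 show ?case using Cons.IH(2)[of "lower_t a k"] by (auto simp: lower_t_def split: sum.splits) }
qed auto

lemma adj_poisson_label_projection: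
  assumes kl: "k \<le> N" "l \<le> N"
  shows "adj A (poisson k l) \<otimes> range_sum label (box N N) \<one> = adj A (poisson k l)"
proof -
  have sub: "box k l \<subseteq> box N N" using kl by (rule box_mono)
  have "range_sum label (box N N) \<one> \<otimes> poisson k l
      = (\<Oplus>v\<in>box N N. label v \<otimes> (\<one> \<otimes> (adj A (label v) \<otimes> poisson k l)))"
    by (rule range_sum_mult_left) auto
  also have "\<dots> = (\<Oplus>v\<in>box N N. if v \<in> box k l then label v \<otimes> kernel v else \<zero>)"
  proof (rule finsum_cong')
    fix v assume v: "v \<in> box N N"
    have "adj A (label v) \<otimes> poisson k l = (if v \<in> box k l then kernel v else \<zero>)"
      unfolding poisson_def
      by (rule orthonormal_mult_sum[OF orthonormal_label[of UNIV]]) auto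
    then show "label v \<otimes> (\<one> \<otimes> (adj A (label v) \<otimes> poisson k l)) = (if v \<in> box k l then label v \<otimes> kernel v else \<zero>)"
      by simp
  qed auto
  also have "\<dots> = (\<Oplus>v\<in>box k l. if v \<in> box k l then label v \<otimes> kernel v else \<zero>)"
    using sub by (intro finsum_restrict) auto
  also have "\<dots> = poisson k l" unfolding poisson_def by (intro finsum_cong') auto
  finally have "adj A (range_sum label (box N N) \<one> \<otimes> poisson k l) = adj A (poisson k l)" by simp
  then show ?thesis
    using range_sum_projection[OF orthonormal_label[of "box N N"] finite_box projection_one]
    by (simp add: adj_mult projection_def)
qed

text \<open>
  The adjoint of the Poisson column intertwines the shifts with the generators, up to a factor \<open>\<rho>\<close> per
  letter and a smaller truncation.
\<close>

lemma adj_poisson_shift_word: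
  assumes "set u \<subseteq> letters" "k \<le> N" "l \<le> N"
  shows "adj A (poisson k l) \<otimes> shift_word N u
    = complex_of_real \<rho> ^ length u \<odot> (word gen u \<otimes> adj A (poisson (cut_s u k) (cut_t u l)))"
  using assms
proof (induction u arbitrary: k l)
  case Nil then show ?case by (simp add: adj_poisson_label_projection)
next
  case (Cons a u)
  then have au: "a \<in> letters" "set u \<subseteq> letters" by auto
  have le: "lower_s a k \<le> N" "lower_t a l \<le> N"
    using Cons.prems by (auto simp: lower_s_def lower_t_def split: sum.split)
  have "adj A (poisson k l) \<otimes> shift_word N (a # u) = adj A (poisson k l) \<otimes> shift N a \<otimes> shift_word N u"
    using au by (simp add: m_assoc)
  also have "\<dots> = complex_of_real \<rho> \<odot> (gen a \<otimes> (adj A (poisson (lower_s a k) (lower_t a l)) \<otimes> shift_word N u))"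
    using au Cons.prems by (simp add: adj_poisson_shift m_assoc)
  also have "\<dots> = complex_of_real \<rho> ^ length (a # u) \<odot>
      (word gen (a # u) \<otimes> adj A (poisson (cut_s (a # u) k) (cut_t (a # u) l)))"
    unfolding Cons.IH[OF au(2) le] using au by (simp add: m_assoc)
  finally show ?case .
qed

text \<open>
  The value of \<open>c\<^sup>* c\<close> for truncated boxes, which tends to \<open>1\<close> as the boxes grow.
\<close>

definition tail :: "nat \<Rightarrow> nat \<Rightarrow> 'a" where
  "tail a b = (\<one> \<ominus> complex_of_real (\<rho>\<^sup>2) ^ a \<odot> range_s_power a)
     \<otimes> (\<one> \<ominus> complex_of_real (\<rho>\<^sup>2) ^ b \<odot> range_t_power b)"

lemma t_word_commute_range_s: "set v \<subseteq> {1..m} \<Longrightarrow> word t v \<otimes> range_s_power a = range_s_power a \<otimes> word t v"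
proof (induction v)
  case (Cons r v)
  then have r: "r \<in> {1..m}" "set v \<subseteq> {1..m}" by auto
  have "word t (r # v) \<otimes> range_s_power a = t r \<otimes> range_s_power a \<otimes> word t v"
    using Cons.IH r by (simp add: m_assoc)
  then show ?case using r by (simp add: t_commute_range_s_power m_assoc)
qed simp

lemma s_word_commute_range_t: "set u \<subseteq> {1..n} \<Longrightarrow> word s u \<otimes> range_t_power a = range_t_power a \<otimes> word s u"
proof (induction u)
  case (Cons r u)
  then have r: "r \<in> {1..n}" "set u \<subseteq> {1..n}" by auto
  have "word s (r # u) \<otimes> range_t_power a = s r \<otimes> range_t_power a \<otimes> word s u"
    using Cons.IH r by (simp add: m_assoc)
  then show ?case using r by (simp add: s_commute_range_t_power m_assoc)
qed simp

text \<open>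
  As \<open>P\<close> commutes with the \<open>t\<close>, the sum over the words in \<open>t\<close> can be carried out first; its value commutes
  with the words in \<open>s\<close>, and the remaining sum telescopes in the same way.
\<close>

lemma sum_adj_kernel_kernel:
  "(\<Oplus>w\<in>box a b. adj A (kernel w) \<otimes> kernel w) = tail a b"
proof -
  define \<sigma> where "\<sigma> = complex_of_real (\<rho>\<^sup>2)"
  define T where "T = \<one> \<ominus> \<sigma> ^ b \<odot> range_t_power b"
  have Tc [simp]: "T \<in> carrier A" by (simp add: T_def)
  have T: "(\<Oplus>v\<in>words {1..m} b. \<sigma> ^ length v \<odot> (word t v \<otimes> (gap_t \<otimes> adj A (word t v)))) = T"
    using telescoping_words[OF orthonormal_t finite_atLeastAtMost, of \<sigma> b]
    by (simp add: T_def gap_t_def \<sigma>_def range_t_power_rec range_t_power_def One_nat_def)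
  have Sm: "(\<Oplus>u\<in>words {1..n} a. \<sigma> ^ length u \<odot> (word s u \<otimes> (gap_s \<otimes> adj A (word s u))))
      = \<one> \<ominus> \<sigma> ^ a \<odot> range_s_power a"
    using telescoping_words[OF orthonormal_s finite_atLeastAtMost, of \<sigma> a]
    by (simp add: gap_s_def \<sigma>_def range_s_power_rec range_s_power_def One_nat_def)
  have uw [simp]: "set u \<subseteq> {1..n}" if "u \<in> words {1..n} a" for u using that by (simp add: words_def)
  have vw [simp]: "set v \<subseteq> {1..m}" if "v \<in> words {1..m} b" for v using that by (simp add: words_def)
  \<comment> \<open>The summands with the \<open>t\<close>-part nested inside, ready for summation over \<open>v\<close>.\<close>
  define F where "F = (\<lambda>u v. \<sigma> ^ length u \<odot> (word s u \<otimes> (gap_s \<otimes>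
      (\<sigma> ^ length v \<odot> (word t v \<otimes> (gap_t \<otimes> adj A (word t v)))) \<otimes> adj A (word s u))))"
  have Fc: "F u v \<in> carrier A" if "u \<in> words {1..n} a" "v \<in> words {1..m} b" for u v
    using that by (simp add: F_def)
  have sq: "complex_of_real \<rho> ^ k * complex_of_real \<rho> ^ k = \<sigma> ^ k" for k
    unfolding \<sigma>_def by (metis of_real_power power2_eq_square power_mult_distrib)
  have entry: "adj A (kernel w) \<otimes> kernel w = F (fst w) (snd w)" if w: "w \<in> box a b" for w
  proof -
    obtain u v where uv: "w = (u, v)" by (cases w)
    have u: "set u \<subseteq> {1..n}" and v: "set v \<subseteq> {1..m}" using w uv uw vw by (simp_all add: box_def)
    have wt: "weight w * weight w = \<sigma> ^ length u * \<sigma> ^ length v"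
      unfolding uv weight_def by (simp add: power_add flip: sq)
    have "adj A (kernel w) \<otimes> kernel w
       = (weight w * weight w) \<odot> (fock_word w \<otimes> (damp_s \<otimes> damp_t \<otimes> (damp_t \<otimes> damp_s)) \<otimes> adj A (fock_word w))"
      unfolding adj_kernel[OF w] using w by (simp add: kernel_def m_assoc)
    also have "\<dots> = (\<sigma> ^ length u * \<sigma> ^ length v) \<odot> (word s u \<otimes> (word t v \<otimes> gap_s \<otimes> (gap_t \<otimes> adj A (word t v)) \<otimes> adj A (word s u)))"
      unfolding damp_product wt using u v by (simp add: uv fock_word_def adj_mult m_assoc)
    also have "word t v \<otimes> gap_s = gap_s \<otimes> word t v"
      using v by (simp add: gap_s_def mult_diff_left mult_diff_right t_word_commute_range_s)
    finally show ?thesis using u v by (simp add: F_def uv m_assoc)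
  qed
  have "(\<Oplus>w\<in>box a b. adj A (kernel w) \<otimes> kernel w) = (\<Oplus>w\<in>box a b. F (fst w) (snd w))"
    using Fc by (intro finsum_cong') (auto simp: entry, auto simp: box_def)
  also have "\<dots> = (\<Oplus>u\<in>words {1..n} a. \<Oplus>v\<in>words {1..m} b. F u v)"
    unfolding box_def using Fc by (intro finsum_product) auto
  also have "\<dots> = (\<Oplus>u\<in>words {1..n} a. \<sigma> ^ length u \<odot> (word s u \<otimes> (gap_s \<otimes> adj A (word s u))) \<otimes> T)"
  proof (rule finsum_cong')
    fix u assume u: "u \<in> words {1..n} a"
    define g where "g = (\<lambda>v. \<sigma> ^ length v \<odot> (word t v \<otimes> (gap_t \<otimes> adj A (word t v))))"
    have gc: "g v \<in> carrier A" if "v \<in> words {1..m} b" for v using that by (simp add: g_def)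
    have "(\<Oplus>v\<in>words {1..m} b. F u v)
      = (\<Oplus>v\<in>words {1..m} b. (\<sigma> ^ length u \<odot> (word s u \<otimes> gap_s)) \<otimes> (g v \<otimes> adj A (word s u)))"
    proof (rule finsum_cong')
      fix v assume v: "v \<in> words {1..m} b"
      have "F u v = \<sigma> ^ length u \<odot> (word s u \<otimes> (gap_s \<otimes> g v \<otimes> adj A (word s u)))"
        by (simp only: F_def g_def)
      then show "F u v = (\<sigma> ^ length u \<odot> (word s u \<otimes> gap_s)) \<otimes> (g v \<otimes> adj A (word s u))"
        using u gc[OF v] by (simp add: m_assoc)
    qed (use u gc in auto)
    also have "\<dots> = (\<sigma> ^ length u \<odot> (word s u \<otimes> gap_s)) \<otimes> (\<Oplus>v\<in>words {1..m} b. g v \<otimes> adj A (word s u))"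
      using u gc by (intro finsum_rdistr[symmetric]) auto
    also have "(\<Oplus>v\<in>words {1..m} b. g v \<otimes> adj A (word s u)) = (\<Oplus>v\<in>words {1..m} b. g v) \<otimes> adj A (word s u)"
      using u gc by (intro finsum_ldistr[symmetric]) auto
    also have "(\<Oplus>v\<in>words {1..m} b. g v) = T" unfolding g_def by (rule T)
    also have "T \<otimes> adj A (word s u) = adj A (word s u) \<otimes> T"
      using arg_cong[OF s_word_commute_range_t[of u b], of "adj A"] u
      by (simp add: T_def mult_diff_left mult_diff_right adj_mult)
    finally show "(\<Oplus>v\<in>words {1..m} b. F u v) = \<sigma> ^ length u \<odot> (word s u \<otimes> (gap_s \<otimes> adj A (word s u))) \<otimes> T"
      using u by (simp add: m_assoc)
  qed auto
  also have "\<dots> = (\<Oplus>u\<in>words {1..n} a. \<sigma> ^ length u \<odot> (word s u \<otimes> (gap_s \<otimes> adj A (word s u)))) \<otimes> T"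
    by (intro finsum_ldistr[symmetric]) auto
  finally show ?thesis unfolding Sm by (simp add: tail_def T_def \<sigma>_def)
qed

lemma adj_poisson_mult_poisson:
  "adj A (poisson a b) \<otimes> poisson a' b' = tail (min a a') (min b b')"
proof -
  have "adj A (poisson a b) = (\<Oplus>w\<in>box a b. adj A (label w \<otimes> kernel w))"
    unfolding poisson_def by (rule adj_finsum) auto
  also have "\<dots> = (\<Oplus>w\<in>box a b. adj A (kernel w) \<otimes> adj A (label w))"
    by (intro finsum_cong') (auto simp: adj_mult)
  finally have "adj A (poisson a b) \<otimes> poisson a' b'
     = (\<Oplus>w\<in>box a b. adj A (kernel w) \<otimes> adj A (label w)) \<otimes> (\<Oplus>w\<in>box a' b'. label w \<otimes> kernel w)"
    by (simp add: poisson_def)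
  also have "\<dots> = (\<Oplus>w\<in>box a b \<inter> box a' b'. adj A (kernel w) \<otimes> kernel w)"
    by (rule orthonormal_sum_mult_sum[OF orthonormal_label[of UNIV]]) auto
  also have "box a b \<inter> box a' b' = box (min a a') (min b b')"
    by (auto simp: box_def words_def)
  finally show ?thesis by (simp add: sum_adj_kernel_kernel)
qed

lemma rho_power: "complex_of_real (\<rho>\<^sup>2) ^ a = complex_of_real ((\<rho>\<^sup>2) ^ a)"
  "0 \<le> (\<rho>\<^sup>2) ^ a" "(\<rho>\<^sup>2) ^ a \<le> 1"
  using rho by (auto simp: power_le_one)

lemma tail_closed [simp]: "tail a b \<in> carrier A" by (simp add: tail_def)

lemma tail_factor_le:
  "nrm A (\<one> \<ominus> complex_of_real (\<rho>\<^sup>2) ^ a \<odot> range_s_power a) \<le> 1"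
  "nrm A (\<one> \<ominus> complex_of_real (\<rho>\<^sup>2) ^ b \<odot> range_t_power b) \<le> 1"
  unfolding rho_power(1)
  by (rule nrm_one_minus_scal_projection[OF projection_range_powers(1) rho_power(2,3)],
      rule nrm_one_minus_scal_projection[OF projection_range_powers(2) rho_power(2,3)])

lemma nrm_tail: "nrm A (tail a b) \<le> 1"
proof -
  have "nrm A (tail a b) \<le> nrm A (\<one> \<ominus> complex_of_real (\<rho>\<^sup>2) ^ a \<odot> range_s_power a)
     * nrm A (\<one> \<ominus> complex_of_real (\<rho>\<^sup>2) ^ b \<odot> range_t_power b)"
    unfolding tail_def by (rule nrm_mult) auto
  also have "\<dots> \<le> 1" using tail_factor_le nrm_nonneg by (intro mult_le_one) auto
  finally show ?thesis .
qed

lemma nrm_poisson: "nrm A (poisson a b) \<le> 1"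
  using cstar_identity[OF poisson_closed, of a b] nrm_tail[of a b] nrm_nonneg[OF poisson_closed, of a b]
  by (simp add: adj_poisson_mult_poisson power_le_one_iff abs_square_le_1)

lemma nrm_one_minus_tail: "nrm A (\<one> \<ominus> tail a b) \<le> (\<rho>\<^sup>2) ^ a + (\<rho>\<^sup>2) ^ b"
proof -
  define H where "H = \<one> \<ominus> complex_of_real (\<rho>\<^sup>2) ^ a \<odot> range_s_power a"
  define K where "K = complex_of_real (\<rho>\<^sup>2) ^ b \<odot> range_t_power b"
  have c [simp]: "H \<in> carrier A" "K \<in> carrier A" by (simp_all add: H_def K_def)
  have "tail a b = H \<ominus> H \<otimes> K"
    unfolding tail_def H_def[symmetric] K_def[symmetric] by (simp add: mult_diff_right)
  moreover have "\<one> \<ominus> (H \<ominus> y) = (\<one> \<ominus> H) \<oplus> y" if "y \<in> carrier A" for y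
    using that c by algebra
  ultimately have "\<one> \<ominus> tail a b = (\<one> \<ominus> H) \<oplus> H \<otimes> K" by simp
  moreover have "\<one> \<ominus> (\<one> \<ominus> y) = y" if "y \<in> carrier A" for y
    using that by algebra
  ultimately have "\<one> \<ominus> tail a b = complex_of_real (\<rho>\<^sup>2) ^ a \<odot> range_s_power a \<oplus> H \<otimes> K"
    by (simp add: H_def)
  then have "nrm A (\<one> \<ominus> tail a b) \<le> nrm A (complex_of_real (\<rho>\<^sup>2) ^ a \<odot> range_s_power a) + nrm A (H \<otimes> K)"
    by (simp add: nrm_triangle)
  also have "\<dots> \<le> (\<rho>\<^sup>2) ^ a + (\<rho>\<^sup>2) ^ b"
  proof (rule add_mono)
    show "nrm A (complex_of_real (\<rho>\<^sup>2) ^ a \<odot> range_s_power a) \<le> (\<rho>\<^sup>2) ^ a"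
      using nrm_projection_le[OF projection_range_powers(1), of a] rho_power(2)[of a]
      by (simp add: nrm_smult norm_power mult_left_le)
    have "nrm A (H \<otimes> K) \<le> nrm A H * nrm A K" by (rule nrm_mult) auto
    also have "\<dots> \<le> 1 * nrm A K"
      using tail_factor_le(1)[of a] nrm_nonneg by (intro mult_right_mono) (auto simp: H_def)
    also have "\<dots> \<le> (\<rho>\<^sup>2) ^ b"
      using nrm_projection_le[OF projection_range_powers(2), of b] rho_power(2)[of b]
      by (simp add: K_def nrm_smult norm_power mult_left_le)
    finally show "nrm A (H \<otimes> K) \<le> (\<rho>\<^sup>2) ^ b" .
  qed
  finally show ?thesis .
qed

lemma nrm_word_le: "set u \<subseteq> letters \<Longrightarrow> nrm A (word gen u) \<le> 1"
proof (induction u)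
  case Nil then show ?case by (simp add: nrm_one_le)
next
  case (Cons a u)
  then have au: "a \<in> letters" "set u \<subseteq> letters" by auto
  have "adj A (gen a) \<otimes> gen a = \<one>"
    using au by (auto simp: letters_def adj_s_s adj_t_t)
  then have "nrm A (gen a) \<le> 1" using au by (intro nrm_le_one_isometry) auto
  then have "nrm A (gen a) * nrm A (word gen u) \<le> 1"
    using Cons.IH[OF au(2)] au nrm_nonneg by (intro mult_le_one) auto
  then show ?case using nrm_mult[of "gen a" "word gen u"] au by simp
qed

text \<open>
  The intertwining relation on both sides turns \<open>c\<^sup>* z c\<close> into \<open>\<rho>\<^bsup>|u|+|v|\<^esup> x\<^sub>u T x\<^sub>v\<^sup>*\<close>, where \<open>T\<close> is the
  product of two truncated Poisson columns. Words of length at most \<open>M\<close> shorten the boxes by at most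
  \<open>M\<close>, hence the exponent \<open>N - M\<close> in the distance of \<open>T\<close> from \<open>1\<close>.
\<close>

lemma poisson_transform_word:
  assumes u: "set u \<subseteq> letters" and v: "set v \<subseteq> letters"
    and N: "length u \<le> M" "length v \<le> M" "M \<le> N"
  shows "nrm A (word gen u \<otimes> adj A (word gen v)
      \<ominus> adj A (poisson N N) \<otimes> word_matrix N u v \<otimes> poisson N N)
    \<le> (1 - \<rho> ^ (length u + length v)) + 2 * (\<rho>\<^sup>2) ^ (N - M)"
proof -
  define a b where "a = min (cut_s u N) (cut_s v N)" and "b = min (cut_t u N) (cut_t v N)"
  have ab: "N - M \<le> a" "N - M \<le> b"
    using cut_ge[of N u] cut_ge[of N v] N by (auto simp: a_def b_def)
  define c where "c = \<rho> ^ (length u + length v)"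
  have c01: "0 \<le> c" "c \<le> 1" using rho by (auto simp: c_def power_le_one)
  have damped_tail: "nrm A (\<one> \<ominus> complex_of_real c \<odot> tail a b) \<le> (1 - c) + 2 * (\<rho>\<^sup>2) ^ (N - M)"
  proof -
    have "\<one> \<ominus> complex_of_real c \<odot> tail a b = (\<one> \<ominus> tail a b) \<oplus> complex_of_real (1 - c) \<odot> tail a b"
      using scal_diff[of "tail a b" 1 "complex_of_real c"] by (simp add: minus_trans)
    then have "nrm A (\<one> \<ominus> complex_of_real c \<odot> tail a b)
        \<le> nrm A (\<one> \<ominus> tail a b) + nrm A (complex_of_real (1 - c) \<odot> tail a b)"
      by (simp add: nrm_triangle del: of_real_diff)
    moreover have "nrm A (complex_of_real (1 - c) \<odot> tail a b) \<le> 1 - c"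
      using nrm_tail[of a b] c01 by (simp add: nrm_smult mult_left_le del: of_real_diff)
    moreover have "(\<rho>\<^sup>2) ^ a \<le> (\<rho>\<^sup>2) ^ (N - M)" "(\<rho>\<^sup>2) ^ b \<le> (\<rho>\<^sup>2) ^ (N - M)"
      using ab rho by (auto intro!: power_decreasing simp: power_le_one)
    ultimately show ?thesis using nrm_one_minus_tail[of a b] by linarith
  qed
  note L = adj_poisson_shift_word[OF _ order.refl order.refl, of _ N]
  have L2: "adj A (shift_word N v) \<otimes> poisson N N 
     = complex_of_real \<rho> ^ length v \<odot> (poisson (cut_s v N) (cut_t v N) \<otimes> adj A (word gen v))"
    using arg_cong[OF L[OF v], of "adj A"] v by (simp add: adj_mult adj_smult)
  have cc: "complex_of_real \<rho> ^ length u * complex_of_real \<rho> ^ length v = complex_of_real c"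
      "complex_of_real \<rho> ^ length v * complex_of_real \<rho> ^ length u = complex_of_real c"
    by (simp_all add: c_def power_add)
  have "adj A (poisson N N) \<otimes> word_matrix N u v \<otimes> poisson N N
     = (adj A (poisson N N) \<otimes> shift_word N u) \<otimes> (adj A (shift_word N v) \<otimes> poisson N N)"
    using u v by (simp add: word_matrix_def m_assoc)
  also have "\<dots> = complex_of_real c \<odot> (word gen u \<otimes> ((adj A (poisson (cut_s u N) (cut_t u N))
       \<otimes> poisson (cut_s v N) (cut_t v N)) \<otimes> adj A (word gen v)))"
    unfolding L[OF u] L2 using u v cc by (simp add: m_assoc)
  also have "\<dots> = word gen u \<otimes> (complex_of_real c \<odot> tail a b) \<otimes> adj A (word gen v)"
    using u v by (simp add: adj_poisson_mult_poisson a_def b_def m_assoc)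
  finally have difference: "word gen u \<otimes> adj A (word gen v) \<ominus> adj A (poisson N N) \<otimes> word_matrix N u v \<otimes> poisson N N
     = word gen u \<otimes> (\<one> \<ominus> complex_of_real c \<odot> tail a b) \<otimes> adj A (word gen v)"
    using u v by (simp add: mult_diff_left mult_diff_right m_assoc)
  have "nrm A (word gen u \<otimes> (\<one> \<ominus> complex_of_real c \<odot> tail a b) \<otimes> adj A (word gen v))
      \<le> nrm A (word gen u) * nrm A (\<one> \<ominus> complex_of_real c \<odot> tail a b) * nrm A (adj A (word gen v))"
    using u v by (intro nrm_mult3) auto
  also have "\<dots> \<le> 1 * nrm A (\<one> \<ominus> complex_of_real c \<odot> tail a b) * 1"
    using u v nrm_nonneg by (intro mult_mono) (auto simp: nrm_word_le)
  finally show ?thesis unfolding difference using damped_tail by (simp add: c_def)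
qed

end

section \<open>Elements with vanishing Fock matrix\<close>

context nondegenerate_twisted_isometries
begin

abbreviation poisson_at :: "real \<Rightarrow> nat \<Rightarrow> 'a" where
  "poisson_at \<rho> N \<equiv> poisson_kernel.poisson A n m s t \<rho> N N"

text \<open>
  At the level \<open>N\<close>, the scalar matrix \<open>z\<close> that represents \<open>x\<close> on the Fock basis reproduces \<open>x\<close> up to \<open>e\<close>
  under the Poisson transform with parameter \<open>\<rho>\<close>.
\<close>

definition recovers :: "'a \<Rightarrow> real \<Rightarrow> real \<Rightarrow> nat \<Rightarrow> bool" where
  "recovers x e \<rho> N \<longleftrightarrow> (\<exists>z. scalar_matrix label (box N N) vacuum z \<and>
     fock_map N \<otimes> x \<otimes> adj A (fock_map N) = z \<otimes> range_sum label (box N N) vacuum \<and>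
     nrm A (x \<ominus> adj A (poisson_at \<rho> N) \<otimes> z \<otimes> poisson_at \<rho> N) \<le> e)"

lemma poisson_kernel: "0 \<le> \<rho> \<Longrightarrow> \<rho> < 1 \<Longrightarrow> poisson_kernel A n m q s t \<rho>"
  by unfold_locales

lemma poisson_at:
  assumes "0 \<le> \<rho>" "\<rho> < 1"
  shows "poisson_at \<rho> N \<in> carrier A" "nrm A (poisson_at \<rho> N) \<le> 1"
  using poisson_kernel.poisson_closed[OF poisson_kernel[OF assms]]
    poisson_kernel.nrm_poisson[OF poisson_kernel[OF assms]] by auto

lemma recovers_add:
  assumes \<rho>: "0 \<le> \<rho>" "\<rho> < 1" and xy [simp]: "x \<in> carrier A" "y \<in> carrier A"
    and r: "recovers x d \<rho> N" "recovers y e \<rho> N"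
  shows "recovers (x \<oplus> y) (d + e) \<rho> N"
proof -
  note [simp] = poisson_at(1)[OF \<rho>]
  let ?c = "poisson_at \<rho> N" and ?V = "fock_map N" and ?G = "range_sum label (box N N) vacuum"
  obtain z w where z: "scalar_matrix label (box N N) vacuum z" "?V \<otimes> x \<otimes> adj A ?V = z \<otimes> ?G"
      "nrm A (x \<ominus> adj A ?c \<otimes> z \<otimes> ?c) \<le> d"
    and w: "scalar_matrix label (box N N) vacuum w" "?V \<otimes> y \<otimes> adj A ?V = w \<otimes> ?G"
      "nrm A (y \<ominus> adj A ?c \<otimes> w \<otimes> ?c) \<le> e"
    using r unfolding recovers_def by blast
  have zc [simp]: "z \<in> carrier A" "w \<in> carrier A" using z w by (auto simp: scalar_matrix_def)
  have rearrange: "(x \<oplus> y) \<ominus> (x' \<oplus> y') = (x \<ominus> x') \<oplus> (y \<ominus> y')"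
    if "x' \<in> carrier A" "y' \<in> carrier A" for x' y'
    using that xy by algebra
  have "adj A ?c \<otimes> (z \<oplus> w) \<otimes> ?c = adj A ?c \<otimes> z \<otimes> ?c \<oplus> adj A ?c \<otimes> w \<otimes> ?c"
    by (simp add: l_distr r_distr)
  then have "nrm A ((x \<oplus> y) \<ominus> adj A ?c \<otimes> (z \<oplus> w) \<otimes> ?c)
     \<le> nrm A (x \<ominus> adj A ?c \<otimes> z \<otimes> ?c) + nrm A (y \<ominus> adj A ?c \<otimes> w \<otimes> ?c)"
    by (simp add: rearrange nrm_triangle)
  then have "nrm A ((x \<oplus> y) \<ominus> adj A ?c \<otimes> (z \<oplus> w) \<otimes> ?c) \<le> d + e" using z w by linarith
  moreover have "?V \<otimes> (x \<oplus> y) \<otimes> adj A ?V = (z \<oplus> w) \<otimes> ?G"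
    using z w by (simp add: l_distr r_distr)
  moreover have "scalar_matrix label (box N N) vacuum (z \<oplus> w)"
    using z w by (intro orthonormal_family.scalar_matrix_add[OF label_family])
  ultimately show ?thesis unfolding recovers_def by blast
qed

lemma recovers_scal:
  assumes \<rho>: "0 \<le> \<rho>" "\<rho> < 1" and x [simp]: "x \<in> carrier A" and r: "recovers x d \<rho> N"
  shows "recovers (a \<odot> x) (cmod a * d) \<rho> N"
proof -
  note [simp] = poisson_at(1)[OF \<rho>]
  let ?c = "poisson_at \<rho> N" and ?V = "fock_map N" and ?G = "range_sum label (box N N) vacuum"
  obtain z where z: "scalar_matrix label (box N N) vacuum z" "?V \<otimes> x \<otimes> adj A ?V = z \<otimes> ?G"
      "nrm A (x \<ominus> adj A ?c \<otimes> z \<otimes> ?c) \<le> d"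
    using r unfolding recovers_def by blast
  have zc [simp]: "z \<in> carrier A" using z by (auto simp: scalar_matrix_def)
  have "a \<odot> x \<ominus> adj A ?c \<otimes> (a \<odot> z) \<otimes> ?c = a \<odot> (x \<ominus> adj A ?c \<otimes> z \<otimes> ?c)"
    by (simp add: scal_minus_right)
  then have "nrm A (a \<odot> x \<ominus> adj A ?c \<otimes> (a \<odot> z) \<otimes> ?c) \<le> cmod a * d"
    using z(3) by (simp add: nrm_smult mult_left_mono)
  moreover have "?V \<otimes> (a \<odot> x) \<otimes> adj A ?V = (a \<odot> z) \<otimes> ?G"
    using z by simp
  moreover have "scalar_matrix label (box N N) vacuum (a \<odot> z)"
    using z by (intro orthonormal_family.scalar_matrix_scal[OF label_family])
  ultimately show ?thesis unfolding recovers_def by blast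
qed

lemma eventually_damping: "\<forall>\<^sub>F \<rho> in at_left 1. 0 \<le> \<rho> \<and> \<rho> < (1::real)"
  using eventually_at_left_real[of 0 "1::real"] by (rule eventually_mono) auto

text \<open>
  The iterated limit, first \<open>N \<rightarrow> \<infinity>\<close> and then \<open>\<rho> \<rightarrow> 1\<close>, avoids coupling the two parameters, and the
  nested filters pass to finite sums without choosing common bounds.
\<close>

lemma eventually_recovers:
  assumes "x \<in> word_span" "0 < e"
  shows "\<forall>\<^sub>F \<rho> in at_left 1. \<forall>\<^sub>F N in sequentially. recovers x e \<rho> N"
  using assms
proof (induction arbitrary: e rule: word_span.induct)
  case (words u v)
  define k M where "k = length u + length v" and "M = max (length u) (length v)"
  have "((\<lambda>\<rho>. 1 - \<rho> ^ k) \<longlongrightarrow> 1 - 1 ^ k) (at_left (1::real))"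
    by (intro tendsto_intros)
  then have "\<forall>\<^sub>F \<rho> in at_left (1::real). 1 - \<rho> ^ k < e / 2"
    using words.prems by (intro order_tendstoD(2)) auto
  with eventually_damping show ?case
  proof eventually_elim
    case (elim \<rho>)
    note close_to_one = elim(2)
    have pk: "poisson_kernel A n m q s t \<rho>" using elim by (intro poisson_kernel) auto
    have "\<rho>\<^sup>2 < 1" using elim by (simp add: power_less_one_iff)
    then have "(\<lambda>N. 2 * (\<rho>\<^sup>2) ^ N) \<longlonglongrightarrow> 2 * 0"
      by (intro tendsto_intros LIMSEQ_power_zero) simp
    then have "\<forall>\<^sub>F N in sequentially. 2 * (\<rho>\<^sup>2) ^ N < e / 2"
      by (rule order_tendstoD(2)) (use words.prems in simp)
    then have "\<forall>\<^sub>F N in sequentially. 2 * (\<rho>\<^sup>2) ^ (N - M) < e / 2"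
      using filterlim_minus_const_nat_at_top[of M] unfolding filterlim_iff by blast
    with eventually_ge_at_top[of M] show ?case
    proof eventually_elim
      case (elim N)
      have "nrm A (word gen u \<otimes> adj A (word gen v) \<ominus> adj A (poisson_at \<rho> N) \<otimes> word_matrix N u v \<otimes> poisson_at \<rho> N) \<le> e"
        using poisson_kernel.poisson_transform_word[OF pk words(1,2), of M N] elim close_to_one
        by (simp add: M_def k_def)
      then show ?case
        unfolding recovers_def
        using scalar_matrix_word_matrix[OF words(1,2), of N] fock_map_word_matrix[OF words(1,2), of N] by blast
    qed
  qed
next
  case zero
  show ?case
    using eventually_damping
  proof eventually_elim
    case (elim \<rho>)
    have "recovers \<zero> e \<rho> N" for N
      unfolding recovers_def using zero poisson_at(1)[of \<rho> N] elim
      by (intro exI[of _ \<zero>]) (simp add: orthonormal_family.scalar_matrix_zero[OF label_family])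
    then show ?case by simp
  qed
next
  case (add x y)
  have xy: "x \<in> carrier A" "y \<in> carrier A" using add word_span_closed by auto
  have "e / 2 > 0" using add.prems by simp
  from eventually_damping add.IH(1)[OF this] add.IH(2)[OF this] show ?case
  proof eventually_elim
    case (elim \<rho>)
    from elim(2,3) show ?case
    proof eventually_elim
      case (elim N)
      then show ?case using recovers_add[OF _ _ xy, of \<rho> "e/2" N "e/2"] \<open>0 \<le> \<rho> \<and> \<rho> < 1\<close> by simp
    qed
  qed
next
  case (scal x a)
  have x: "x \<in> carrier A" using scal word_span_closed by auto
  \<comment> \<open>The summand \<open>1\<close> covers \<open>a = 0\<close>.\<close>
  define d where "d = e / (cmod a + 1)"
  have pos: "0 < cmod a + 1" by (simp add: add_nonneg_pos)
  then have "d > 0" using scal.prems by (simp add: d_def)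
  have ad: "cmod a * d \<le> e"
  proof -
    have "cmod a * d \<le> (cmod a + 1) * d" using \<open>d > 0\<close> by (intro mult_right_mono) auto
    also have "\<dots> = e" using pos by (simp add: d_def)
    finally show ?thesis .
  qed
  from eventually_damping scal.IH[OF \<open>d > 0\<close>] show ?case
  proof eventually_elim
    case (elim \<rho>)
    from elim(2) show ?case
    proof eventually_elim
      case (elim N)
      then have "recovers (a \<odot> x) (cmod a * d) \<rho> N"
        using recovers_scal[OF _ _ x] \<open>0 \<le> \<rho> \<and> \<rho> < 1\<close> by blast
      then show ?case unfolding recovers_def using ad order_trans by blast
    qed
  qed
qed

text \<open>
  For a word polynomial \<open>p\<close> near \<open>a\<close>, the Fock matrices of \<open>p\<close> and \<open>p - a\<close> agree. The former controls \<open>p\<close>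
  through the Poisson transform, the latter has norm at most \<open>\<parallel>p - a\<parallel>\<close>.
\<close>

theorem zero_of_vacuum_compressions:
  assumes gen: "generates_cstar (s ` {1..n} \<union> t ` {1..m}) A" and a: "a \<in> carrier A"
    and compr: "\<And>x y. x \<in> carrier A \<Longrightarrow> y \<in> carrier A \<Longrightarrow> vacuum \<otimes> (x \<otimes> a \<otimes> y \<otimes> vacuum) = \<zero>"
  shows "a = \<zero>"
proof -
  have bound: "nrm A a \<le> 3 * e" if e: "e > 0" for e
  proof -
    obtain p where p: "p \<in> word_span" "nrm A (a \<ominus> p) < e" using word_span_dense[OF gen a e] by blast
    have pc [simp]: "p \<in> carrier A" using p(1) by (rule word_span_closed)
    have "\<forall>\<^sub>F \<rho> in at_left (1::real). (0 \<le> \<rho> \<and> \<rho> < 1) \<and> (\<forall>\<^sub>F N in sequentially. recovers p e \<rho> N)"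
      by (intro eventually_conj eventually_damping eventually_recovers p e)
    from eventually_happens[OF this] obtain \<rho> :: real where \<rho>: "0 \<le> \<rho>" "\<rho> < 1"
      and ev: "\<forall>\<^sub>F N in sequentially. recovers p e \<rho> N" by auto
    from eventually_happens[OF ev] obtain N where "recovers p e \<rho> N" by auto
    then obtain z where z: "scalar_matrix label (box N N) vacuum z"
      "fock_map N \<otimes> p \<otimes> adj A (fock_map N) = z \<otimes> range_sum label (box N N) vacuum"
      "nrm A (p \<ominus> adj A (poisson_at \<rho> N) \<otimes> z \<otimes> poisson_at \<rho> N) \<le> e"
      unfolding recovers_def by blast
    have zc [simp]: "z \<in> carrier A" using z by (simp add: scalar_matrix_def)
    note [simp] = poisson_at(1)[OF \<rho>]
    have "bra w \<otimes> a \<otimes> adj A (bra w') = \<zero>" if "w \<in> box N N" "w' \<in> box N N" for w w'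
    proof -
      have "bra w \<otimes> a \<otimes> adj A (bra w') = vacuum \<otimes> (adj A (fock_word w) \<otimes> a \<otimes> fock_word w' \<otimes> vacuum)"
        using that a by (simp add: bra_def adj_mult m_assoc)
      then show ?thesis using compr that a by simp
    qed
    then have Va: "fock_map N \<otimes> a \<otimes> adj A (fock_map N) = \<zero>"
      by (rule fock_map_compression_zero[OF a])
    have "nrm A (adj A (poisson_at \<rho> N) \<otimes> z \<otimes> poisson_at \<rho> N)
        \<le> nrm A (adj A (poisson_at \<rho> N)) * nrm A z * nrm A (poisson_at \<rho> N)"
      by (intro nrm_mult3) auto
    also have "\<dots> \<le> 1 * nrm A z * 1"
      using poisson_at[OF \<rho>] nrm_nonneg by (intro mult_mono) auto
    also have "\<dots> \<le> nrm A (z \<otimes> range_sum label (box N N) vacuum)"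
      using orthonormal_family.nrm_scalar_matrix_le[OF label_family vacuum_nonzero z(1)] by simp
    also have "z \<otimes> range_sum label (box N N) vacuum
        = fock_map N \<otimes> (p \<ominus> a) \<otimes> adj A (fock_map N)"
    proof -
      have "fock_map N \<otimes> (p \<ominus> a) \<otimes> adj A (fock_map N)
         = fock_map N \<otimes> p \<otimes> adj A (fock_map N) \<ominus> fock_map N \<otimes> a \<otimes> adj A (fock_map N)"
        using a by (simp add: mult_diff_left mult_diff_right)
      then show ?thesis unfolding Va z(2) by (simp add: minus_eq)
    qed
    also have "nrm A (fock_map N \<otimes> (p \<ominus> a) \<otimes> adj A (fock_map N))
        \<le> nrm A (fock_map N) * nrm A (p \<ominus> a) * nrm A (adj A (fock_map N))"
      using a by (intro nrm_mult3) auto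
    also have "\<dots> \<le> 1 * nrm A (p \<ominus> a) * 1"
      using a nrm_fock_map[of N] nrm_nonneg by (intro mult_mono) auto
    finally have "nrm A (adj A (poisson_at \<rho> N) \<otimes> z \<otimes> poisson_at \<rho> N) \<le> nrm A (a \<ominus> p)"
      using a by (simp add: nrm_diff_commute)
    then have "nrm A p \<le> nrm A (a \<ominus> p) + e"
      using nrm_le_add_diff[of p "adj A (poisson_at \<rho> N) \<otimes> z \<otimes> poisson_at \<rho> N"] z(3) by simp
    then show ?thesis using nrm_le_add_diff[OF a pc] p(2) by linarith
  qed
  have "nrm A a \<le> 0"
  proof (rule field_le_epsilon)
    fix e :: real assume "0 < e"
    then show "nrm A a \<le> 0 + e" using bound[of "e/3"] by simp
  qed
  then have "nrm A a = 0" using nrm_nonneg[OF a] by simp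
  then show ?thesis using nrm_eq_zero[OF a] by simp
qed

end

section \<open>Faithfulness of the Fock representation\<close>

lemma scaleC_one: "1 *\<^sub>C (x::'h::complex_hilbert_space) = x"
  using scaleC_of_real[of 1 x] by simp

lemma scaleC_zero_left: "0 *\<^sub>C (x::'h::complex_hilbert_space) = 0"
  using scaleC_of_real[of 0 x] by simp

lemma scaleC_minus_one: "(-1) *\<^sub>C (x::'h::complex_hilbert_space) = - x"
  using scaleC_of_real[of "-1" x] by simp

lemma scaleC_eq_zero:
  assumes "c *\<^sub>C (x::'h::complex_hilbert_space) = 0" "x \<noteq> 0" shows "c = 0"
proof (rule ccontr)
  assume "c \<noteq> 0"
  have "x = (inverse c * c) *\<^sub>C x" using \<open>c \<noteq> 0\<close> by (simp add: scaleC_one)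
  also have "\<dots> = inverse c *\<^sub>C 0" using assms(1) by (simp flip: scaleC_scaleC)
  also have "\<dots> = 0" using scaleC_add_right[of "inverse c" 0 "0::'h"] by simp
  finally show False using assms(2) by simp
qed

context unital_cstar_algebra
begin

context
  fixes \<pi> :: "'a \<Rightarrow> 'h::complex_hilbert_space \<Rightarrow> 'h"
  assumes rep: "star_representation A \<pi>"
begin

lemma rep_one: "\<pi> \<one> v = v"
  using rep by (simp add: star_representation_def)

lemma rep_add: "x \<in> carrier A \<Longrightarrow> y \<in> carrier A \<Longrightarrow> \<pi> (x \<oplus> y) v = \<pi> x v + \<pi> y v"
  using rep by (simp add: star_representation_def)

lemma rep_mult: "x \<in> carrier A \<Longrightarrow> y \<in> carrier A \<Longrightarrow> \<pi> (x \<otimes> y) v = \<pi> x (\<pi> y v)"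
  using rep by (simp add: star_representation_def)

lemma rep_scal: "x \<in> carrier A \<Longrightarrow> \<pi> (c \<odot> x) v = c *\<^sub>C \<pi> x v"
  using rep by (simp add: star_representation_def)

lemma rep_vector_zero: "x \<in> carrier A \<Longrightarrow> \<pi> x 0 = 0"
  using rep by (auto simp: star_representation_def bounded_clinear_def linear_simps)

lemma rep_zero: "\<pi> \<zero> v = 0"
  using rep_scal[of \<one> 0 v] by (simp add: scaleC_zero_left)

lemma rep_diff: "x \<in> carrier A \<Longrightarrow> y \<in> carrier A \<Longrightarrow> \<pi> (x \<ominus> y) v = \<pi> x v - \<pi> y v"
  by (simp add: minus_eq uminus_eq_scal rep_add rep_scal scaleC_minus_one)

lemma rep_finsum_zero:
  assumes "finite S" "f \<in> S \<rightarrow> carrier A" "\<And>i. i \<in> S \<Longrightarrow> \<pi> (f i) v = 0"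
  shows "\<pi> (\<Oplus>i\<in>S. f i) v = 0"
  using assms
proof (induction S rule: finite_induct)
  case (insert i S)
  have "(\<Oplus>i\<in>S. f i) \<in> carrier A" using insert by (auto intro: finsum_closed)
  then show ?case using insert by (simp add: finsum_insert Pi_def rep_add)
qed (simp add: rep_zero)

lemma rep_range_sum_zero:
  assumes "finite S" "g \<in> S \<rightarrow> carrier A" "\<And>i. i \<in> S \<Longrightarrow> \<pi> (adj A (g i)) v = 0"
  shows "\<pi> (range_sum g S \<one>) v = 0"
  unfolding range_sum_def
proof (rule rep_finsum_zero[OF assms(1)])
  fix i assume i: "i \<in> S"
  then have "g i \<in> carrier A" using assms by auto
  then show "\<pi> (g i \<otimes> (\<one> \<otimes> adj A (g i))) v = 0"
    using assms(3)[OF i] by (simp add: rep_mult rep_vector_zero)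
qed (use assms in \<open>auto simp: Pi_def\<close>)

end

end

text \<open>
  The range projections \<open>P\<close> and \<open>P'\<close> annihilate the vacuum vector.
\<close>

lemma (in twisted_isometries) rep_vacuum:
  fixes \<pi> :: "'a \<Rightarrow> 'h::complex_hilbert_space \<Rightarrow> 'h"
  assumes rep: "star_representation A \<pi>"
    and \<Omega>: "\<And>i. i \<in> {1..n} \<Longrightarrow> \<pi> (adj A (s i)) \<Omega> = 0" "\<And>r. r \<in> {1..m} \<Longrightarrow> \<pi> (adj A (t r)) \<Omega> = 0"
  shows "\<pi> vacuum \<Omega> = \<Omega>"
proof -
  have "\<pi> (range_s_power 1) \<Omega> = 0" "\<pi> (range_t_power 1) \<Omega> = 0"
    unfolding range_power_one
    by (rule rep_range_sum_zero[OF rep]; use \<Omega> in auto)+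
  then show ?thesis
    by (simp add: vacuum_def vacuum_s_def vacuum_t_def rep_mult[OF rep] rep_diff[OF rep] rep_one[OF rep])
qed

theorem theorem3p16:
  fixes n m :: nat and q :: complex
    and A :: "'a cstar" and s t :: "nat \<Rightarrow> 'a"
    and \<pi> :: "'a \<Rightarrow> 'h::complex_hilbert_space \<Rightarrow> 'h"
  assumes "n \<ge> 2" and "m \<ge> 2" and "cmod q = 1"
    and "universal_E n m q A s t"
    and "fock_representation n m A s t \<pi>"
  shows "faithful_representation A \<pi>"
proof -
  have alg: "unital_cstar_algebra A" and rel: "E_relations n m q A s t"
    and gen: "generates_cstar (s ` {1..n} \<union> t ` {1..m}) A"
    using \<open>universal_E n m q A s t\<close> by (auto simp: universal_E_def)
  interpret unital_cstar_algebra A by (rule alg)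
  interpret twisted_isometries A n m q s t
    by unfold_locales (use rel \<open>cmod q = 1\<close> in auto)
  have rep: "star_representation A \<pi>"
    using assms(5) by (simp add: fock_representation_def irreducible_representation_def)
  obtain \<Omega> where \<Omega>: "norm \<Omega> = 1" "\<forall>j\<in>{1..n}. \<pi> (adj A (s j)) \<Omega> = 0"
      "\<forall>r\<in>{1..m}. \<pi> (adj A (t r)) \<Omega> = 0"
    using assms(5) by (auto simp: fock_representation_def)
  have \<Omega>0: "\<Omega> \<noteq> 0" using \<Omega>(1) by auto
  have vac: "\<pi> vacuum \<Omega> = \<Omega>" using \<Omega> by (intro rep_vacuum[OF rep]) auto
  have "vacuum \<noteq> \<zero>\<^bsub>A\<^esub>" using vac rep_zero[OF rep, of \<Omega>] \<Omega>0 by auto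
  then interpret nondegenerate_twisted_isometries A n m q s t
    by unfold_locales (use \<open>n \<ge> 2\<close> in auto)
  have kernel: "a = \<zero>\<^bsub>A\<^esub>" if a: "a \<in> carrier A" and \<pi>a: "\<And>v. \<pi> a v = 0" for a
  proof (rule zero_of_vacuum_compressions[OF gen a])
    fix x y assume xy: "x \<in> carrier A" "y \<in> carrier A"
    define b where "b = x \<otimes>\<^bsub>A\<^esub> a \<otimes>\<^bsub>A\<^esub> y"
    have b: "b \<in> carrier A" using xy a by (simp add: b_def)
    obtain c where c: "vacuum \<otimes>\<^bsub>A\<^esub> (b \<otimes>\<^bsub>A\<^esub> vacuum) = c \<odot>\<^bsub>A\<^esub> vacuum"
      using vacuum_compression[OF gen b] by blast
    have "\<pi> (vacuum \<otimes>\<^bsub>A\<^esub> (b \<otimes>\<^bsub>A\<^esub> vacuum)) \<Omega> = 0"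
      using xy a by (simp add: b_def rep_mult[OF rep] \<pi>a rep_vector_zero[OF rep])
    then have "c *\<^sub>C \<Omega> = 0" unfolding c by (simp add: rep_scal[OF rep] vac)
    then have "c = 0" using \<Omega>0 by (rule scaleC_eq_zero)
    then show "vacuum \<otimes>\<^bsub>A\<^esub> (x \<otimes>\<^bsub>A\<^esub> a \<otimes>\<^bsub>A\<^esub> y \<otimes>\<^bsub>A\<^esub> vacuum) = \<zero>\<^bsub>A\<^esub>"
      using c by (simp add: b_def)
  qed
  show ?thesis
    unfolding faithful_representation_def
  proof (rule inj_onI)
    fix x y assume xy: "x \<in> carrier A" "y \<in> carrier A" "\<pi> x = \<pi> y"
    then have "x \<ominus>\<^bsub>A\<^esub> y = \<zero>\<^bsub>A\<^esub>" by (intro kernel) (auto simp: rep_diff[OF rep])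
    then show "x = y" using xy eq_of_minus_zero[of x y] by blast
  qed
qed

end
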